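(* Let $\alpha\in(0,2)$ and assume that $$\sum_{n=1}^\infty\frac{\sigma_n^\alpha}{1+\gamma_n}<\infty .$$ Then the process $X=(X_t)_{t\in[0,1]}$, $X_t=\sum_{n=1}^\infty X^{(n)}_te_n$, has the cylindrical càdlàg property if and only if $$\sum_{n=1}^\infty\sigma_n^{\frac{2\alpha}{2-\alpha}}<\infty .$$
   Context: $H$ is a real separable (infinite-dimensional) Hilbert space with orthonormal basis $(e_n)_{n\ge1}$. For each $n$ let $\gamma_n>0$ and $\sigma_n\ge0$. The processes $L^{(n)}$, $n\ge1$, are independent càdlàg standard symmetric $\alpha$-stable Lévy processes on $\mathbb{R}$, i.e. $\mathbf{E}e^{i\theta L^{(n)}_t}=e^{-t|\theta|^\alpha}$, and $$X^{(n)}_t=\int_0^t e^{-\gamma_n(t-s)}\sigma_n\,dL^{(n)}_s .$$ Under the condition $\sum_n\sigma_n^\alpha/(1+\gamma_n)<\infty$ the process $X_t=\sum_nX^{(n)}_te_n$ takes values in $H$ (i.e. $\sum_n(X^{(n)}_t)^2<\infty$ a.s. for each $t$). An $H$-valued process $X$ is said to be cylindrical càdlàg (to have the cylindrical càdlàg property) if for every $z\in H$ the real-valued process $\langle z,X_t\rangle=\sum_{n}\langle z,e_n\rangle X^{(n)}_t$, $t\in[0,1]$, has a càdlàg modification. *)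

theory Defs
  imports "HOL-Probability.Probability"
begin

definition cadlag_on :: "real set \<Rightarrow> (real \<Rightarrow> real) \<Rightarrow> bool" where
  "cadlag_on T f \<longleftrightarrow> (\<forall>t\<in>T.
     continuous (at t within (T \<inter> {t..})) f \<and>
     (\<exists>l. (f \<longlongrightarrow> l) (at t within (T \<inter> {..<t}))))"

(* Paths are required to be cadlag only almost surely; redefining the process to be 0 on the
   exceptional null set changes it only up to indistinguishability. *)
definition cadlag_process :: "'a measure \<Rightarrow> real set \<Rightarrow> (real \<Rightarrow> 'a \<Rightarrow> real) \<Rightarrow> bool" where
  "cadlag_process M T Y \<longleftrightarrow>
     (\<forall>t\<in>T. Y t \<in> borel_measurable M) \<and> (AE \<omega> in M. cadlag_on T (\<lambda>t. Y t \<omega>))"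

definition levy_process :: "'a measure \<Rightarrow> (real \<Rightarrow> 'a \<Rightarrow> real) \<Rightarrow> bool" where
  "levy_process M L \<longleftrightarrow>
     cadlag_process M {0..} L \<and>
     (AE \<omega> in M. L 0 \<omega> = 0) \<and>
     (\<forall>(t :: nat \<Rightarrow> real) n. 0 \<le> t 0 \<longrightarrow> (\<forall>i<n. t i \<le> t (Suc i)) \<longrightarrow>
        prob_space.indep_vars M (\<lambda>_. borel) (\<lambda>i \<omega>. L (t (Suc i)) \<omega> - L (t i) \<omega>) {..<n}) \<and>
     (\<forall>s\<ge>0. \<forall>h\<ge>0. distr M borel (\<lambda>\<omega>. L (s + h) \<omega> - L s \<omega>) = distr M borel (L h))"

definition std_sym_stable_levy :: "real \<Rightarrow> 'a measure \<Rightarrow> (real \<Rightarrow> 'a \<Rightarrow> real) \<Rightarrow> bool" where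
  "std_sym_stable_levy \<alpha> M L \<longleftrightarrow>
     levy_process M L \<and>
     (\<forall>t\<ge>0. \<forall>\<theta>. char (distr M borel (L t)) \<theta> = complex_of_real (exp (- t * \<bar>\<theta>\<bar> powr \<alpha>)))"

definition indep_processes :: "'a measure \<Rightarrow> (nat \<Rightarrow> real \<Rightarrow> 'a \<Rightarrow> real) \<Rightarrow> bool" where
  "indep_processes M L \<longleftrightarrow>
     prob_space.indep_vars M (\<lambda>_. PiM {0..} (\<lambda>_. borel)) (\<lambda>n \<omega>. \<lambda>t\<in>{0..}. L n t \<omega>) UNIV"

definition conv_in_prob ::
    "'a measure \<Rightarrow> (nat \<Rightarrow> 'a \<Rightarrow> real) \<Rightarrow> ('a \<Rightarrow> real) \<Rightarrow> bool" where
  "conv_in_prob M Z Y \<longleftrightarrow>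
     (\<forall>\<epsilon>>0. (\<lambda>k. measure M {\<omega> \<in> space M. \<epsilon> < \<bar>Z k \<omega> - Y \<omega>\<bar>}) \<longlonglongrightarrow> 0)"

(* p k 0 \<le> p k 1 \<le> ... \<le> p k (N k) is the k-th partition of the interval from 0 to t. *)
definition vanishing_mesh_partitions :: "real \<Rightarrow> (nat \<Rightarrow> nat) \<Rightarrow> (nat \<Rightarrow> nat \<Rightarrow> real) \<Rightarrow> bool" where
  "vanishing_mesh_partitions t N p \<longleftrightarrow>
     (\<forall>k. p k 0 = 0 \<and> p k (N k) = t \<and> (\<forall>i<N k. p k i \<le> p k (Suc i))) \<and>
     (\<forall>\<delta>>0. eventually (\<lambda>k. \<forall>i<N k. p k (Suc i) - p k i < \<delta>) sequentially)"

(* Y is a version of the stochastic integral of the deterministic continuous integrand f against L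
   over the interval from 0 to t: the limit in probability of the left-endpoint Riemann sums along
   every sequence of partitions whose mesh tends to 0. It determines Y almost surely. *)
definition is_stoch_integral ::
    "'a measure \<Rightarrow> (real \<Rightarrow> 'a \<Rightarrow> real) \<Rightarrow> (real \<Rightarrow> real) \<Rightarrow> real \<Rightarrow> ('a \<Rightarrow> real) \<Rightarrow> bool" where
  "is_stoch_integral M L f t Y \<longleftrightarrow>
     Y \<in> borel_measurable M \<and>
     (\<forall>N p. vanishing_mesh_partitions t N p \<longrightarrow>
        conv_in_prob M
          (\<lambda>k \<omega>. \<Sum>i<N k. f (p k i) * (L (p k (Suc i)) \<omega> - L (p k i) \<omega>)) Y)"

definition orthonormal_basis :: "(nat \<Rightarrow> 'h::{real_inner, complete_space}) \<Rightarrow> bool" where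
  "orthonormal_basis e \<longleftrightarrow>
     (\<forall>m n. inner (e m) (e n) = (if m = n then 1 else 0)) \<and> closure (span (range e)) = UNIV"

definition modification_on ::
    "'a measure \<Rightarrow> real set \<Rightarrow> (real \<Rightarrow> 'a \<Rightarrow> real) \<Rightarrow> (real \<Rightarrow> 'a \<Rightarrow> real) \<Rightarrow> bool" where
  "modification_on M T Y U \<longleftrightarrow> (\<forall>t\<in>T. AE \<omega> in M. Y t \<omega> = U t \<omega>)"

definition cylindrical_cadlag ::
    "'a measure \<Rightarrow> (real \<Rightarrow> 'a \<Rightarrow> 'h::{real_inner, complete_space}) \<Rightarrow> bool" where
  "cylindrical_cadlag M U \<longleftrightarrow>
     (\<forall>z. \<exists>Y. cadlag_process M {0..1} Y \<and>
               modification_on M {0..1} Y (\<lambda>t \<omega>. inner z (U t \<omega>)))"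

end

theory Submission
  imports Defs
begin

text \<open>Fix a vector \<open>z\<close> with coordinates \<open>z n\<close> and put \<open>c n = z n * \<sigma> n\<close>. The heart of the matter is a
scalar statement: the process \<open>\<langle>z, X t\<rangle> = (\<Sum>n. z n * X n t)\<close> has a cadlag modification if and only if
\<open>\<Sum>n. \<bar>c n\<bar> powr \<alpha>\<close> converges. Heuristically, \<open>\<bar>c n\<bar> powr \<alpha>\<close> is, up to a constant factor, the rate at
which the n-th coordinate contributes jumps of size at least 1; a cadlag path has finitely many of
those, and conversely summable rates suffice, however fast the decay rates \<open>\<gamma> n\<close> may grow. For square
summable \<open>z\<close> the sequence \<open>\<bar>z n\<bar> powr \<alpha>\<close> ranges over the nonnegative sequences whose power \<open>2 / \<alpha>\<close> is
summable. So the scalar condition holds for every \<open>z\<close> if and only if \<open>\<sigma> n powr \<alpha>\<close> lies in the dual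
sequence space, whose exponent is \<open>2 / (2 - \<alpha>)\<close>: one half is Young's inequality
(\<open>powr_product_le\<close>), the other an Abel-Dini construction (\<open>exists_square_summable_multiplier\<close>).

All probability takes place on uniform time grids. There the coordinates are limits of Riemann sums,
which are finite linear combinations of independent symmetric stable increments. The convergence
holds along almost every path: integration by parts turns the sums into ordinary integrals of cadlag
functions (\<open>ou_sum_convergence\<close>). This also provides cadlag versions of the single coordinates.

If the series converges, the partial sums have to be controlled uniformly in time. Given the absolute
values of the increments, only random signs remain, and the Riemann sum becomes a signed sum of
kernels \<open>k \<mapsto> exp (- \<gamma> (k - i) h)\<close>. Such a kernel jumps from 0 to at most 1 and then decreases; its
variation is at most 2, whatever \<open>\<gamma>\<close> is. Therefore the conditional fourth moment of an increment of
the process is bounded, up to a constant factor, by the square of the increment of one nondecreasing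
clock, and bisecting the clock gives a maximal inequality (\<open>fourth_moment_maximal\<close>, \<open>prob_max_linear_le\<close>). The total clock is a
sum of squares of stable variables, estimated in \<open>prob_square_sum_le\<close>. The resulting bound depends on
neither the grid nor the decay rates (\<open>maximal_inequality\<close>), and the Borel-Cantelli lemma yields
uniform convergence of a subsequence of the partial sums (\<open>cadlag_series\<close>).

If \<open>\<langle>z, X t\<rangle>\<close> has a cadlag modification, its increments over a grid of mesh \<open>1 / N\<close> are bounded in
probability, uniformly in \<open>N\<close>. A reflection argument (\<open>prob_block_max_le\<close>) transfers this bound to the
fresh noise that the first \<open>m\<close> coordinates contribute to each of the \<open>N\<close> cells. These contributions are
independent, and each is large with probability at least of order \<open>(\<Sum>n<m. \<bar>c n\<bar> powr \<alpha>) / N\<close>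
(\<open>stable_tail_lower_bound\<close>). So the partial sums are bounded (\<open>summable_of_cadlag\<close>).\<close>

section \<open>Cadlag paths\<close>

lemma cadlag_on_subset: "cadlag_on T f \<Longrightarrow> S \<subseteq> T \<Longrightarrow> cadlag_on S f"
  unfolding cadlag_on_def
  by (meson Int_mono continuous_within_subset order_refl subsetD tendsto_within_subset)

lemma continuous_imp_cadlag_on: "continuous_on T f \<Longrightarrow> cadlag_on T f"
  unfolding cadlag_on_def
  by (meson Int_lower1 continuous_on_eq_continuous_within continuous_within continuous_within_subset
      tendsto_within_subset)

lemma cadlag_on_add: "cadlag_on T f \<Longrightarrow> cadlag_on T g \<Longrightarrow> cadlag_on T (\<lambda>t. f t + g t)"
  unfolding cadlag_on_def by (blast intro: continuous_add tendsto_add)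

lemma cadlag_on_mult: "cadlag_on T f \<Longrightarrow> cadlag_on T g \<Longrightarrow> cadlag_on T (\<lambda>t. f t * g t)"
  unfolding cadlag_on_def by (blast intro: continuous_mult tendsto_mult)

lemma cadlag_on_const: "cadlag_on T (\<lambda>t. c)"
  by (simp add: continuous_imp_cadlag_on)

lemma cadlag_on_sum: "(\<And>n. n \<in> A \<Longrightarrow> cadlag_on T (f n)) \<Longrightarrow> cadlag_on T (\<lambda>t. \<Sum>n\<in>A. f n t)"
  by (induction A rule: infinite_finite_induct) (auto simp: cadlag_on_const cadlag_on_add)

lemma cadlag_on_compact_bounded:
  assumes "compact T" "cadlag_on T f"
  obtains B where "\<And>t. t \<in> T \<Longrightarrow> \<bar>f t\<bar> \<le> B"
proof -
  have "\<exists>U B. open U \<and> t \<in> U \<and> (\<forall>s\<in>U \<inter> T. \<bar>f s\<bar> \<le> B)" if t: "t \<in> T" for t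
  proof -
    have "(f \<longlongrightarrow> f t) (at t within (T \<inter> {t..}))"
      using assms(2) t by (auto simp: cadlag_on_def continuous_within)
    then have "eventually (\<lambda>s. dist (f s) (f t) < 1) (at t within (T \<inter> {t..}))"
      by (rule tendstoD) simp
    then obtain U where U: "open U" "t \<in> U" "\<And>s. s \<in> U \<Longrightarrow> s \<noteq> t \<Longrightarrow> s \<in> T \<inter> {t..} \<Longrightarrow> dist (f s) (f t) < 1"
      unfolding eventually_at_topological by blast
    obtain l where "(f \<longlongrightarrow> l) (at t within (T \<inter> {..<t}))"
      using assms(2) t by (auto simp: cadlag_on_def)
    then have "eventually (\<lambda>s. dist (f s) l < 1) (at t within (T \<inter> {..<t}))"
      by (rule tendstoD) simp
    then obtain V where V: "open V" "t \<in> V" "\<And>s. s \<in> V \<Longrightarrow> s \<noteq> t \<Longrightarrow> s \<in> T \<inter> {..<t} \<Longrightarrow> dist (f s) l < 1"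
      unfolding eventually_at_topological by blast
    have "\<bar>f s\<bar> \<le> \<bar>f t\<bar> + \<bar>l\<bar> + 1" if s: "s \<in> (U \<inter> V) \<inter> T" for s
    proof (cases "s = t")
      case False
      then consider "s > t" | "s < t" by linarith
      then show ?thesis
      proof cases
        case 1 then show ?thesis using U(3)[of s] s by (auto simp: dist_real_def)
      next
        case 2 then show ?thesis using V(3)[of s] s by (auto simp: dist_real_def)
      qed
    qed auto
    then show ?thesis using U V by (intro exI[of _ "U \<inter> V"]) blast
  qed
  then obtain U B where UB: "\<And>t. t \<in> T \<Longrightarrow> open (U t) \<and> t \<in> U t \<and> (\<forall>s\<in>U t \<inter> T. \<bar>f s\<bar> \<le> B t)"
    by metis
  obtain C where C: "C \<subseteq> T" "finite C" "T \<subseteq> (\<Union>c\<in>C. U c)"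
    using compactE_image[OF assms(1), of T U] UB by blast
  have "\<bar>f t\<bar> \<le> (\<Sum>c\<in>C. \<bar>B c\<bar>)" if t: "t \<in> T" for t
  proof -
    obtain c where c: "c \<in> C" "t \<in> U c" using C t by auto
    then have "\<bar>f t\<bar> \<le> B c" using UB[of c] C t by blast
    then have "\<bar>f t\<bar> \<le> \<bar>B c\<bar>" by linarith
    also have "\<dots> \<le> (\<Sum>c\<in>C. \<bar>B c\<bar>)" using c C by (intro member_le_sum) auto
    finally show ?thesis .
  qed
  then show thesis by (rule that)
qed

text \<open>Uniform convergence allows the interchange of limits. The left limits of the approximating functions
form a Cauchy sequence, and its limit is the left limit of \<open>g\<close>.\<close>

lemma cadlag_on_uniform_limit:
  assumes f: "\<And>n. cadlag_on T (f n)" and lim: "uniform_limit T f g sequentially"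
  shows "cadlag_on T g"
  unfolding cadlag_on_def
proof (intro ballI conjI)
  fix t assume t: "t \<in> T"
  have sub: "uniform_limit S f g sequentially" if "S \<subseteq> T" for S
    using lim that by (rule uniform_limit_on_subset)
  have ev: "\<forall>\<^sub>F n in sequentially. \<forall>x\<in>S. dist (f n x) (g x) < e" if "S \<subseteq> T" "e > 0" for S e
    using sub[OF that(1)] that(2) by (auto simp: uniform_limit_iff)
  show "continuous (at t within (T \<inter> {t..})) g"
    unfolding continuous_within
  proof (rule tendstoI)
    fix e :: real assume e: "e > 0"
    from ev[OF order_refl, of "e/3"] e obtain n where n: "\<And>x. x \<in> T \<Longrightarrow> dist (f n x) (g x) < e/3"
      by (force simp: eventually_sequentially)
    have "(f n \<longlongrightarrow> f n t) (at t within (T \<inter> {t..}))"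
      using f t by (auto simp: cadlag_on_def continuous_within)
    then have "eventually (\<lambda>s. dist (f n s) (f n t) < e/3) (at t within (T \<inter> {t..}))"
      by (rule tendstoD) (use e in simp)
    moreover have "eventually (\<lambda>s. s \<in> T) (at t within (T \<inter> {t..}))"
      by (auto simp: eventually_at_filter)
    ultimately show "eventually (\<lambda>s. dist (g s) (g t) < e) (at t within (T \<inter> {t..}))"
    proof eventually_elim
      case (elim s)
      then show ?case using n[of s] n[of t] t unfolding dist_real_def by linarith
    qed
  qed
  let ?F = "at t within (T \<inter> {..<t})"
  show "\<exists>l. (g \<longlongrightarrow> l) ?F"
  proof (cases "?F = bot")
    case False
    have "\<forall>n. \<exists>l. (f n \<longlongrightarrow> l) ?F"
      using f t unfolding cadlag_on_def by blast
    then obtain h where h: "\<And>n. (f n \<longlongrightarrow> h n) ?F" by metis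
    have "Cauchy h"
    proof (rule metric_CauchyI)
      fix e :: real assume e: "e > 0"
      from ev[OF order_refl, of "e/3"] e obtain N where
        N: "\<And>n x. n \<ge> N \<Longrightarrow> x \<in> T \<Longrightarrow> dist (f n x) (g x) < e/3"
        by (force simp: eventually_sequentially)
      have "dist (h m) (h n) < e" if "m \<ge> N" "n \<ge> N" for m n
      proof -
        have "eventually (\<lambda>s. s \<in> T) ?F" by (auto simp: eventually_at_filter)
        then have "eventually (\<lambda>s. dist (f m s) (f n s) \<le> 2*e/3) ?F"
        proof eventually_elim
          case (elim s)
          then show ?case using N[OF that(1), of s] N[OF that(2), of s] unfolding dist_real_def by linarith
        qed
        then have "dist (h m) (h n) \<le> 2*e/3"
          by (rule tendsto_upperbound[OF tendsto_dist[OF h h]]) (use False in simp)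
        then show ?thesis using e by simp
      qed
      then show "\<exists>M. \<forall>m\<ge>M. \<forall>n\<ge>M. dist (h m) (h n) < e" by blast
    qed
    then obtain l where l: "h \<longlonglongrightarrow> l" using convergent_eq_Cauchy by blast
    have "(g \<longlongrightarrow> l) ?F"
    proof (rule swap_uniform_limit)
      show "\<forall>\<^sub>F n in sequentially. (f n \<longlongrightarrow> h n) ?F" using h by simp
      show "uniform_limit (T \<inter> {..<t}) f g sequentially" by (rule sub) auto
    qed (use l in auto)
    then show ?thesis by blast
  qed simp
qed

text \<open>A countable dense subset of the unit interval that contains the right end point, which no limit
from the right can reach.\<close>

definition dyadic_points :: "real set" where
  "dyadic_points = (\<Union>m. (\<lambda>k. real k / 2 ^ m) ` {..2 ^ m})"

lemma dyadic_points_subset: "dyadic_points \<subseteq> {0..1}"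
  by (auto simp: dyadic_points_def divide_simps)

lemma countable_dyadic_points: "countable dyadic_points"
  by (simp add: dyadic_points_def)

text \<open>Probabilities control a path at countably many times only; right continuity extends a bound from
there to the whole interval.\<close>

lemma cadlag_le_of_le_on_grid:
  assumes f: "cadlag_on {0..1} f" and le: "\<And>t. t \<in> dyadic_points \<Longrightarrow> \<bar>f t\<bar> \<le> c" and t: "t \<in> {0..1}"
  shows "\<bar>f t\<bar> \<le> c"
proof (cases "t = 1")
  case True
  have "(1::real) \<in> dyadic_points" unfolding dyadic_points_def by (auto intro!: exI[of _ 0] image_eqI[of _ _ 1])
  then show ?thesis using le True by simp
next
  case False
  then have t1: "0 \<le> t" "t < 1" using t by auto
  define s where "s m = real (nat (\<lceil>t * 2^m\<rceil>)) / 2^m" for m :: nat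
  have s_ge: "t \<le> s m" for m
    unfolding s_def using t1 by (simp add: divide_simps)
  have s_le: "s m \<le> t + (1/2)^m" for m
    unfolding s_def using t1 by (simp add: divide_simps power_one_over)
  have le1: "nat \<lceil>t * 2^m\<rceil> \<le> 2^m" for m :: nat
  proof -
    have "\<lceil>t * 2^m\<rceil> \<le> 2^m" using t1 by (intro ceiling_le) auto
    then show ?thesis by (simp add: nat_le_iff)
  qed
  have s_in: "s m \<in> dyadic_points" for m
    unfolding dyadic_points_def s_def using le1[of m] by blast
  have s_lim: "s \<longlonglongrightarrow> t"
  proof (rule tendsto_sandwich[of "\<lambda>_. t" s _ "\<lambda>m. t + (1/2)^m"])
    have "(\<lambda>m. (1/2::real)^m) \<longlonglongrightarrow> 0" by (rule LIMSEQ_realpow_zero) auto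
    from tendsto_add[OF tendsto_const this, of t] show "(\<lambda>m. t + (1/2)^m) \<longlonglongrightarrow> t" by simp
  qed (use s_ge s_le in auto)
  have "(f \<longlongrightarrow> f t) (at t within ({0..1} \<inter> {t..}))"
    using f t by (auto simp: cadlag_on_def continuous_within)
  then have "(\<lambda>m. f (s m)) \<longlonglongrightarrow> f t"
  proof (rule continuous_within_tendsto_compose[rotated 2, OF s_lim, unfolded continuous_within])
    show "\<forall>\<^sub>F m in sequentially. s m \<in> {0..1} \<inter> {t..}"
      using s_in dyadic_points_subset s_ge by (intro always_eventually) force
  qed
  then have "(\<lambda>m. \<bar>f (s m)\<bar>) \<longlonglongrightarrow> \<bar>f t\<bar>" by (rule tendsto_rabs)
  then show ?thesis by (rule LIMSEQ_le_const2) (use le s_in in blast)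
qed

section \<open>Ornstein-Uhlenbeck paths driven by cadlag functions\<close>

text \<open>The solution of \<open>dy = - g y dt + df\<close> with \<open>y 0 = f 0 = 0\<close>, that is the integral of
\<open>exp (- g (t - s))\<close> against \<open>df s\<close>, written by means of integration by parts so that it makes sense
for each single path \<open>f\<close>.\<close>

definition ou_path :: "real \<Rightarrow> (real \<Rightarrow> real) \<Rightarrow> real \<Rightarrow> real" where
  "ou_path g f t = f t - exp (- g * t) * integral {0..t} (\<lambda>s. f s * (g * exp (g * s)))"

text \<open>The left end point Riemann sum for \<open>ou_path\<close> at time \<open>J * h\<close> on a uniform mesh of width \<open>h\<close>.\<close>

definition ou_sum :: "real \<Rightarrow> (real \<Rightarrow> real) \<Rightarrow> real \<Rightarrow> nat \<Rightarrow> real" where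
  "ou_sum g f h J = (\<Sum>i<J. exp (- g * (real (J - i) * h)) * (f (real (Suc i) * h) - f (real i * h)))"

lemma ou_sum_by_parts:
  assumes "f 0 = 0"
  shows "ou_sum g f h J = f (real J * h) - exp (- g * (real J * h)) *
    (\<Sum>i<J. f (real (Suc i) * h) * (exp (g * (real (Suc i) * h)) - exp (g * (real i * h))))"
proof -
  have "(\<Sum>i<n. exp (g * (real i * h)) * (f (real (Suc i) * h) - f (real i * h))) =
     exp (g * (real n * h)) * f (real n * h) -
     (\<Sum>i<n. f (real (Suc i) * h) * (exp (g * (real (Suc i) * h)) - exp (g * (real i * h))))" for n
    using assms by (induction n) (auto simp: algebra_simps)
  note parts = this[of J]
  have e: "exp (- g * (real (J - i) * h)) = exp (- g * (real J * h)) * exp (g * (real i * h))" if "i < J" for i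
    unfolding exp_add[symmetric] using that by (simp add: of_nat_diff algebra_simps)
  have "ou_sum g f h J = (\<Sum>i<J. exp (- g * (real J * h)) * (exp (g * (real i * h)) * (f (real (Suc i) * h) - f (real i * h))))"
    unfolding ou_sum_def
    by (intro sum.cong refl) (simp only: e lessThan_iff mult.assoc)
  also have "\<dots> = exp (- g * (real J * h)) * (exp (g * (real J * h)) * f (real J * h) -
     (\<Sum>i<J. f (real (Suc i) * h) * (exp (g * (real (Suc i) * h)) - exp (g * (real i * h)))))"
    unfolding sum_distrib_left[symmetric] parts ..
  also have "exp (- g * (real J * h)) * exp (g * (real J * h)) = 1"
    by (simp flip: exp_add)
  then have "exp (- g * (real J * h)) * (exp (g * (real J * h)) * f (real J * h) - S) =
     f (real J * h) - exp (- g * (real J * h)) * S" for S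
    by (simp add: right_diff_distrib mult.assoc[symmetric])
  finally show ?thesis .
qed

text \<open>After summation by parts \<open>f\<close> is evaluated at the right end points of the cells. The sum is then
exactly the integral of a step function, and \<open>h * \<lceil>s / h\<rceil>\<close> approaches \<open>s\<close> from the side on which a
cadlag function is continuous.\<close>

lemma has_integral_right_sampled:
  fixes h :: real
  assumes h: "h > 0"
  shows "((\<lambda>s. f (h * \<lceil>s / h\<rceil>) * (g * exp (g * s))) has_integral
     (\<Sum>i<J. f (real (Suc i) * h) * (exp (g * (real (Suc i) * h)) - exp (g * (real i * h))))) {0..real J * h}"
proof (induction J)
  case 0
  then show ?case using has_integral_refl(2)[of _ "0::real"] by simp
next
  case (Suc J)
  have "((\<lambda>s. g * exp (g * s)) has_integral exp (g * (real (Suc J) * h)) - exp (g * (real J * h)))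
      {real J * h..real (Suc J) * h}"
    using h by (intro fundamental_theorem_of_calculus)
      (auto intro!: derivative_eq_intros mult_right_mono simp flip: has_real_derivative_iff_has_vector_derivative)
  then have *: "((\<lambda>s. f (real (Suc J) * h) * (g * exp (g * s))) has_integral
      f (real (Suc J) * h) * (exp (g * (real (Suc J) * h)) - exp (g * (real J * h))))
      {real J * h..real (Suc J) * h}"
    by (rule has_integral_mult_right)
  have "((\<lambda>s. f (h * \<lceil>s / h\<rceil>) * (g * exp (g * s))) has_integral
      f (real (Suc J) * h) * (exp (g * (real (Suc J) * h)) - exp (g * (real J * h))))
      {real J * h..real (Suc J) * h}"
  proof (rule has_integral_spike_finite[OF _ _ *])
    show "finite {real J * h}" by simp
    fix s assume "s \<in> {real J * h..real (Suc J) * h} - {real J * h}"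
    then have "real J < s / h" "s / h \<le> real (Suc J)" using h by (auto simp: field_simps)
    then have "\<lceil>s / h\<rceil> = int (Suc J)" by (intro ceiling_unique) auto
    then show "f (h * \<lceil>s / h\<rceil>) * (g * exp (g * s)) = f (real (Suc J) * h) * (g * exp (g * s))"
      by (simp add: mult.commute)
  qed
  with Suc.IH have "((\<lambda>s. f (h * \<lceil>s / h\<rceil>) * (g * exp (g * s))) has_integral
     (\<Sum>i<J. f (real (Suc i) * h) * (exp (g * (real (Suc i) * h)) - exp (g * (real i * h)))) +
     f (real (Suc J) * h) * (exp (g * (real (Suc J) * h)) - exp (g * (real J * h)))) {0..real (Suc J) * h}"
    using h by (intro has_integral_combine[of 0 "real J * h"]) (auto intro!: mult_right_mono)
  then show ?case by simp
qed

text \<open>Right continuity gives pointwise convergence of the step integrands and boundedness of cadlag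
functions a dominating function. Dominated convergence then yields the integrability of the limit
together with the convergence of the integrals.\<close>

lemma ou_sum_convergence:
  assumes f: "cadlag_on {0..} f" "f 0 = 0" and t: "0 \<le> t"
    and h: "\<And>r. 0 < h r" "h \<longlonglongrightarrow> 0" and J: "\<And>r. real (J r) * h r = t"
  shows "(\<lambda>s. f s * (g * exp (g * s))) integrable_on {0..t}"
    and "(\<lambda>r. ou_sum g f (h r) (J r)) \<longlonglongrightarrow> ou_path g f t"
proof -
  have "cadlag_on {0..t} f" by (rule cadlag_on_subset[OF f(1)]) auto
  then obtain B where B: "\<And>s. s \<in> {0..t} \<Longrightarrow> \<bar>f s\<bar> \<le> B"
    using cadlag_on_compact_bounded[of "{0..t}" f] by blast
  let ?S = "\<lambda>r. \<Sum>i<J r. f (real (Suc i) * h r) * (exp (g * (real (Suc i) * h r)) - exp (g * (real i * h r)))"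
  let ?F = "\<lambda>r s. f (h r * \<lceil>s / h r\<rceil>) * (g * exp (g * s))"
  have hi: "(?F r has_integral ?S r) {0..t}" for r
    using has_integral_right_sampled[OF h(1), of f r g "J r"] by (simp add: J)
  have up: "s \<le> h r * \<lceil>s / h r\<rceil>" "h r * \<lceil>s / h r\<rceil> \<le> s + h r" for s r
  proof -
    have "s / h r \<le> \<lceil>s / h r\<rceil>" "\<lceil>s / h r\<rceil> \<le> s / h r + 1" by linarith+
    then have "h r * (s / h r) \<le> h r * \<lceil>s / h r\<rceil>" "h r * \<lceil>s / h r\<rceil> \<le> h r * (s / h r + 1)"
      using h(1)[of r] by (meson mult_left_mono less_imp_le)+
    moreover have "h r * (s / h r) = s" "h r * (s / h r + 1) = s + h r"
      using h(1)[of r] by (auto simp: distrib_left)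
    ultimately show "s \<le> h r * \<lceil>s / h r\<rceil>" "h r * \<lceil>s / h r\<rceil> \<le> s + h r"
      by simp_all
  qed
  have le_t: "h r * \<lceil>s / h r\<rceil> \<le> t" if "s \<in> {0..t}" for s r
  proof -
    have "s / h r \<le> real (J r)" using that J[of r] h(1)[of r] by (auto simp: field_simps)
    then have "\<lceil>s / h r\<rceil> \<le> int (J r)" by (simp add: ceiling_le_iff)
    then have "real_of_int \<lceil>s / h r\<rceil> \<le> real (J r)" by linarith
    then have "h r * \<lceil>s / h r\<rceil> \<le> h r * real (J r)" using h(1)[of r] by (intro mult_left_mono) auto
    then show ?thesis using J[of r] by (simp add: mult.commute)
  qed
  have conv: "(\<lambda>r. ?F r s) \<longlonglongrightarrow> f s * (g * exp (g * s))" if s: "s \<in> {0..t}" for s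
  proof -
    have lim: "(\<lambda>r. h r * \<lceil>s / h r\<rceil>) \<longlonglongrightarrow> s"
    proof (rule tendsto_sandwich[of "\<lambda>_. s" _ _ "\<lambda>r. s + h r"])
      show "(\<lambda>r. s + h r) \<longlonglongrightarrow> s" using tendsto_add[OF tendsto_const h(2), of s] by simp
    qed (use up in auto)
    have "(f \<longlongrightarrow> f s) (at s within ({0..} \<inter> {s..}))"
      using f s by (auto simp: cadlag_on_def continuous_within)
    then have "(\<lambda>r. f (h r * \<lceil>s / h r\<rceil>)) \<longlonglongrightarrow> f s"
    proof (rule continuous_within_tendsto_compose[rotated 2, OF lim, unfolded continuous_within])
      show "\<forall>\<^sub>F r in sequentially. h r * \<lceil>s / h r\<rceil> \<in> {0..} \<inter> {s..}"
        using up s by (intro always_eventually allI) (force intro: order_trans)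
    qed
    then show ?thesis by (intro tendsto_mult) auto
  qed
  have "continuous_on {0..t} (\<lambda>s. \<bar>B\<bar> * (\<bar>g\<bar> * exp (g * s)))" by (intro continuous_intros)
  then have dom: "(\<lambda>s. \<bar>B\<bar> * (\<bar>g\<bar> * exp (g * s))) integrable_on {0..t}" by (rule integrable_continuous_interval)
  have le: "norm (?F r s) \<le> \<bar>B\<bar> * (\<bar>g\<bar> * exp (g * s))" if s: "s \<in> {0..t}" for r s
  proof -
    have "h r * \<lceil>s / h r\<rceil> \<in> {0..t}" using le_t[OF s, of r] up(1)[of s r] s by auto
    then have "\<bar>f (h r * \<lceil>s / h r\<rceil>)\<bar> \<le> \<bar>B\<bar>" using B by force
    then show ?thesis by (auto simp: abs_mult intro!: mult_mono)
  qed
  have "(\<lambda>s. f s * (g * exp (g * s))) integrable_on {0..t} \<and>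
      (\<lambda>r. integral {0..t} (?F r)) \<longlonglongrightarrow> integral {0..t} (\<lambda>s. f s * (g * exp (g * s)))"
    using dominated_convergence[of ?F "{0..t}", OF _ dom le conv] hi by blast
  then show "(\<lambda>s. f s * (g * exp (g * s))) integrable_on {0..t}"
    and "(\<lambda>r. ou_sum g f (h r) (J r)) \<longlonglongrightarrow> ou_path g f t"
    using hi by (auto simp: ou_sum_by_parts[of f, OF f(2)] J ou_path_def integral_unique[OF hi]
        intro!: tendsto_intros simp del: of_nat_Suc)
qed

lemmas ou_sum_tendsto = ou_sum_convergence(2)

lemma cadlag_on_ou_path:
  assumes f: "cadlag_on {0..} f" "f 0 = 0"
  shows "cadlag_on {0..1} (ou_path g f)"
proof -
  have "(\<lambda>s. f s * (g * exp (g * s))) integrable_on {0..1}"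
  proof (rule ou_sum_convergence(1)[OF f])
    show "(\<lambda>r. 1 / real (Suc r)) \<longlonglongrightarrow> 0" using LIMSEQ_inverse_real_of_nat by (simp add: inverse_eq_divide)
    show "real (Suc r) * (1 / real (Suc r)) = 1" for r by simp
  qed auto
  then have "continuous_on {0..1} (\<lambda>t. integral {0..t} (\<lambda>s. f s * (g * exp (g * s))))"
    by (rule indefinite_integral_continuous_1)
  then have "cadlag_on {0..1} (\<lambda>t. - exp (- g * t) * integral {0..t} (\<lambda>s. f s * (g * exp (g * s))))"
    by (intro continuous_imp_cadlag_on continuous_intros)
  from cadlag_on_add[OF cadlag_on_subset[OF f(1)] this] show ?thesis
    unfolding ou_path_def[abs_def] by auto
qed

section \<open>Symmetric stable random variables\<close>

text \<open>The parameter \<open>c\<close> is the \<open>\<alpha>\<close>-th power of the usual scale parameter. It is additive over independent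
sums.\<close>

definition sym_stable :: "'a measure \<Rightarrow> real \<Rightarrow> real \<Rightarrow> ('a \<Rightarrow> real) \<Rightarrow> bool" where
  "sym_stable M \<alpha> c \<xi> \<longleftrightarrow> \<xi> \<in> borel_measurable M \<and>
     (\<forall>\<theta>. char (distr M borel \<xi>) \<theta> = complex_of_real (exp (- c * \<bar>\<theta>\<bar> powr \<alpha>)))"

lemma sym_stable_measurable: "sym_stable M \<alpha> c \<xi> \<Longrightarrow> \<xi> \<in> borel_measurable M"
  by (simp add: sym_stable_def)

lemma (in prob_space) char_scale:
  assumes [measurable]: "\<xi> \<in> borel_measurable M"
  shows "char (distr M borel (\<lambda>\<omega>. b * \<xi> \<omega>)) \<theta> = char (distr M borel \<xi>) (b * \<theta>)"
  by (simp add: char_def integral_distr mult_ac)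

lemma (in prob_space) sym_stable_scale:
  assumes "sym_stable M \<alpha> c \<xi>"
  shows "sym_stable M \<alpha> (c * \<bar>b\<bar> powr \<alpha>) (\<lambda>\<omega>. b * \<xi> \<omega>)"
  using assms unfolding sym_stable_def by (auto simp: char_scale abs_mult powr_mult mult_ac)

lemma (in prob_space) sym_stable_sum:
  assumes ind: "indep_vars (\<lambda>_. borel) \<xi> I" and st: "\<And>i. i \<in> I \<Longrightarrow> sym_stable M \<alpha> (d i) (\<xi> i)"
    and fin: "finite I"
  shows "sym_stable M \<alpha> (\<Sum>i\<in>I. d i * \<bar>b i\<bar> powr \<alpha>) (\<lambda>\<omega>. \<Sum>i\<in>I. b i * \<xi> i \<omega>)"
proof -
  have [measurable]: "\<xi> i \<in> borel_measurable M" if "i \<in> I" for i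
    using st[OF that] by (rule sym_stable_measurable)
  have ind': "indep_vars (\<lambda>_. borel) (\<lambda>i \<omega>. b i * \<xi> i \<omega>) I"
    by (rule indep_vars_compose2[OF ind]) auto
  have "char (distr M borel (\<lambda>\<omega>. \<Sum>i\<in>I. b i * \<xi> i \<omega>)) \<theta> =
      complex_of_real (exp (- (\<Sum>i\<in>I. d i * \<bar>b i\<bar> powr \<alpha>) * \<bar>\<theta>\<bar> powr \<alpha>))" for \<theta>
  proof -
    have "char (distr M borel (\<lambda>\<omega>. \<Sum>i\<in>I. b i * \<xi> i \<omega>)) \<theta> =
       (\<Prod>i\<in>I. char (distr M borel (\<lambda>\<omega>. b i * \<xi> i \<omega>)) \<theta>)" by (rule char_distr_sum[OF ind'])
    also have "\<dots> = (\<Prod>i\<in>I. complex_of_real (exp (- (d i * \<bar>b i\<bar> powr \<alpha>) * \<bar>\<theta>\<bar> powr \<alpha>)))"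
      using sym_stable_scale[OF st] by (intro prod.cong) (auto simp: sym_stable_def)
    also have "\<dots> = complex_of_real (exp (\<Sum>i\<in>I. - (d i * \<bar>b i\<bar> powr \<alpha>) * \<bar>\<theta>\<bar> powr \<alpha>))"
      by (simp add: exp_sum fin)
    finally show ?thesis by (simp add: sum_distrib_right sum_negf)
  qed
  then show ?thesis unfolding sym_stable_def by (auto intro!: borel_measurable_sum)
qed

lemma (in prob_space) sym_stable_symmetric:
  assumes "sym_stable M \<alpha> c \<xi>"
  shows "distr M borel (\<lambda>\<omega>. - \<xi> \<omega>) = distr M borel \<xi>"
proof (rule Levy_uniqueness)
  have [measurable]: "\<xi> \<in> borel_measurable M" using assms by (rule sym_stable_measurable)
  show "real_distribution (distr M borel \<xi>)" "real_distribution (distr M borel (\<lambda>\<omega>. - \<xi> \<omega>))"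
    by (auto intro!: real_distribution_distr)
  show "char (distr M borel (\<lambda>\<omega>. - \<xi> \<omega>)) = char (distr M borel \<xi>)"
    using sym_stable_scale[OF assms, of "-1"] assms by (auto simp: sym_stable_def fun_eq_iff)
qed

text \<open>A smooth substitute for \<open>min 1 (x\<^sup>2)\<close>. This choice makes \<open>1 - bump\<close> the characteristic function of a
standard Gaussian variable.\<close>

definition bump :: "real \<Rightarrow> real" where
  "bump x = 1 - exp (- x\<^sup>2 / 2)"

lemma bump_nonneg: "0 \<le> bump x" and bump_le_1: "bump x \<le> 1"
  by (auto simp: bump_def)

lemma continuous_on_bump: "continuous_on S bump"
  unfolding bump_def[abs_def] by (intro continuous_intros) auto

lemma bump_measurable [measurable]: "bump \<in> borel_measurable borel"
  by (intro borel_measurable_continuous_onI continuous_on_bump)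

lemma square_le_bump:
  assumes "\<bar>x\<bar> \<le> 1" shows "x\<^sup>2 \<le> 4 * bump x"
proof -
  have x: "x\<^sup>2 \<le> 1" using assms by (simp add: abs_square_le_1)
  have "1 + x\<^sup>2/2 \<le> exp (x\<^sup>2/2)" by (rule exp_ge_add_one_self)
  then have "exp (- (x\<^sup>2/2)) * (1 + x\<^sup>2/2) \<le> exp (- (x\<^sup>2/2)) * exp (x\<^sup>2/2)"
    by (intro mult_left_mono) auto
  then have a: "exp (- x\<^sup>2/2) * (1 + x\<^sup>2/2) \<le> 1" by (simp flip: exp_add)
  have "1 \<le> (1 - y/4) * (1 + y/2)" if "0 \<le> y" "y \<le> 1" for y :: real
  proof -
    have "0 \<le> y * (2 - y)" using that by (intro mult_nonneg_nonneg) auto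
    then show ?thesis by (simp add: field_simps)
  qed
  from this[OF zero_le_power2 x] have "1 \<le> (1 - x\<^sup>2/4) * (1 + x\<^sup>2/2)" .
  then have "exp (- x\<^sup>2/2) * (1 + x\<^sup>2/2) \<le> (1 - x\<^sup>2/4) * (1 + x\<^sup>2/2)" using a by linarith
  then have "exp (- x\<^sup>2/2) \<le> 1 - x\<^sup>2/4"
    by (rule mult_right_le_imp_le) (use zero_le_power2[of x] in linarith)
  then show ?thesis by (simp add: bump_def)
qed

lemma (in real_distribution) Re_char: "Re (char M t) = (\<integral>x. cos (t * x) \<partial>M)"
proof -
  have "integrable M (\<lambda>x. iexp (t * x))" by (rule integrable_iexp) auto
  from integral_Re[OF this] show ?thesis by (simp add: char_def Re_exp)
qed

definition normal_moment :: "real \<Rightarrow> real" where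
  "normal_moment \<alpha> = (\<integral>g. \<bar>g\<bar> powr \<alpha> \<partial>std_normal_distribution)"

lemma normal_moment_nonneg: "0 \<le> normal_moment \<alpha>"
  unfolding normal_moment_def by (intro integral_nonneg_AE) auto

lemma integrable_normal_moment:
  assumes "0 \<le> \<alpha>" "\<alpha> \<le> 2"
  shows "integrable std_normal_distribution (\<lambda>g. \<bar>g\<bar> powr \<alpha>)"
proof (rule Bochner_Integration.integrable_bound)
  show "integrable std_normal_distribution (\<lambda>g. g^0 + g^2)"
    by (intro Bochner_Integration.integrable_add integrable_std_normal_distribution_moment)
  have "\<bar>g\<bar> powr \<alpha> \<le> 1 + g\<^sup>2" for g :: real
  proof (cases "\<bar>g\<bar> \<le> 1")
    case True
    then have "\<bar>g\<bar> powr \<alpha> \<le> 1" using assms by (simp add: powr_le1)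
    then show ?thesis using zero_le_power2[of g] by linarith
  next
    case False
    then have "\<bar>g\<bar> powr \<alpha> \<le> \<bar>g\<bar> powr 2" using assms by (intro powr_mono) auto
    also have "\<dots> = g\<^sup>2" using False by (subst powr_numeral) auto
    finally show ?thesis by simp
  qed
  then show "AE g in std_normal_distribution. norm (\<bar>g\<bar> powr \<alpha>) \<le> norm (g^0 + g^2)"
    by (intro AE_I2) (auto intro: order_trans[OF _ abs_ge_self])
qed measurable

text \<open>If \<open>G\<close> is standard Gaussian, then \<open>bump (u x)\<close> is the expectation of \<open>1 - cos (u x G)\<close>. By Fubini
the left side is the average over \<open>G\<close> of \<open>1 - exp (- c \<bar>u G\<bar> powr \<alpha>) \<le> c \<bar>u G\<bar> powr \<alpha>\<close>. In this way the
characteristic function alone controls the tails.\<close>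

lemma (in prob_space) expectation_bump_le:
  assumes st: "sym_stable M \<alpha> c \<xi>" and \<alpha>: "0 \<le> \<alpha>" "\<alpha> \<le> 2"
  shows "(\<integral>\<omega>. bump (u * \<xi> \<omega>) \<partial>M) \<le> normal_moment \<alpha> * (c * \<bar>u\<bar> powr \<alpha>)"
proof -
  have [measurable]: "\<xi> \<in> borel_measurable M" using st by (rule sym_stable_measurable)
  interpret N: real_distribution std_normal_distribution by (rule real_dist_normal_dist)
  interpret D: real_distribution "distr M borel \<xi>" by (auto intro!: real_distribution_distr)
  let ?N = std_normal_distribution and ?D = "distr M borel \<xi>"
  interpret P: pair_prob_space ?N ?D ..
  have 1: "bump x = (\<integral>g. 1 - cos (x * g) \<partial>?N)" for x
  proof -
    have "(\<integral>g. cos (x * g) \<partial>?N) = exp (- x\<^sup>2 / 2)"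
      unfolding N.Re_char[symmetric] char_std_normal_distribution by simp
    moreover have "integrable ?N (\<lambda>g. cos (x * g))"
      by (rule N.integrable_const_bound[of _ 1]) auto
    ultimately show ?thesis using N.prob_space by (simp add: bump_def)
  qed
  have 2: "(\<integral>x. 1 - cos (u * x * g) \<partial>?D) = 1 - exp (- c * (\<bar>u\<bar> powr \<alpha> * \<bar>g\<bar> powr \<alpha>))" for g
  proof -
    have "(\<integral>x. cos (u * g * x) \<partial>?D) = exp (- c * \<bar>u * g\<bar> powr \<alpha>)"
      unfolding D.Re_char[symmetric] using st by (simp add: sym_stable_def)
    moreover have "integrable ?D (\<lambda>x. cos (u * g * x))"
      by (rule D.integrable_const_bound[of _ 1]) auto
    ultimately show ?thesis using D.prob_space by (simp add: abs_mult powr_mult mult_ac)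
  qed
  have "(\<integral>\<omega>. bump (u * \<xi> \<omega>) \<partial>M) = (\<integral>x. bump (u * x) \<partial>?D)" by (simp add: integral_distr)
  also have "\<dots> = (\<integral>x. (\<integral>g. 1 - cos (u * x * g) \<partial>?N) \<partial>?D)" unfolding 1 ..
  also have "\<dots> = (\<integral>g. (\<integral>x. 1 - cos (u * x * g) \<partial>?D) \<partial>?N)"
  proof (rule P.Fubini_integral)
    show "integrable (?N \<Otimes>\<^sub>M ?D) (\<lambda>(g, x). 1 - cos (u * x * g))"
    proof (rule P.P.integrable_const_bound[of _ 2])
      have "\<bar>1 - cos y\<bar> \<le> 2" for y :: real using cos_ge_minus_one[of y] cos_le_one[of y] by linarith
      then show "AE x in ?N \<Otimes>\<^sub>M ?D. norm (case x of (g, x) \<Rightarrow> 1 - cos (u * x * g)) \<le> 2" by auto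
    qed measurable
  qed
  also have "\<dots> = (\<integral>g. 1 - exp (- c * (\<bar>u\<bar> powr \<alpha> * \<bar>g\<bar> powr \<alpha>)) \<partial>?N)" unfolding 2 ..
  also have "\<dots> \<le> (\<integral>g. (c * \<bar>u\<bar> powr \<alpha>) * \<bar>g\<bar> powr \<alpha> \<partial>?N)"
  proof (rule integral_mono')
    show "integrable ?N (\<lambda>g. (c * \<bar>u\<bar> powr \<alpha>) * \<bar>g\<bar> powr \<alpha>)"
      using integrable_normal_moment[OF \<alpha>] by simp
    show "1 - exp (- c * (\<bar>u\<bar> powr \<alpha> * \<bar>g\<bar> powr \<alpha>)) \<le> (c * \<bar>u\<bar> powr \<alpha>) * \<bar>g\<bar> powr \<alpha>" for g
      using exp_ge_add_one_self[of "- c * (\<bar>u\<bar> powr \<alpha> * \<bar>g\<bar> powr \<alpha>)"] by (simp add: mult_ac)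
    fix g
    have "0 \<le> (\<integral>x. 1 - cos (u * x * g) \<partial>?D)" by (intro integral_nonneg_AE) auto
    also note 2[of g]
    also have "1 - exp (- c * (\<bar>u\<bar> powr \<alpha> * \<bar>g\<bar> powr \<alpha>)) \<le> (c * \<bar>u\<bar> powr \<alpha>) * \<bar>g\<bar> powr \<alpha>"
      using exp_ge_add_one_self[of "- c * (\<bar>u\<bar> powr \<alpha> * \<bar>g\<bar> powr \<alpha>)"] by (simp add: mult_ac)
    finally show "0 \<le> (c * \<bar>u\<bar> powr \<alpha>) * \<bar>g\<bar> powr \<alpha>" .
  qed
  finally show ?thesis by (simp add: normal_moment_def mult_ac)
qed

text \<open>The elementary bound \<open>1 - (\<Prod>i\<in>I. 1 - p i) \<le> (\<Sum>i\<in>I. p i)\<close> for \<open>p i = bump (x i)\<close>.\<close>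

lemma bump_sum_le:
  assumes "finite I"
  shows "1 - exp (- (\<Sum>i\<in>I. (x i)\<^sup>2) / 2) \<le> (\<Sum>i\<in>I. bump (x i))"
  using assms
proof (induction I)
  case (insert i I)
  let ?a = "exp (- (x i)\<^sup>2 / 2)" and ?b = "exp (- (\<Sum>i\<in>I. (x i)\<^sup>2) / 2)"
  have "exp (- (\<Sum>i\<in>insert i I. (x i)\<^sup>2) / 2) = ?a * ?b"
    using insert by (simp flip: exp_add)
  moreover have "1 - ?a * ?b \<le> (1 - ?a) + (1 - ?b)"
  proof -
    have "0 \<le> (1 - ?a) * (1 - ?b)" by (intro mult_nonneg_nonneg) (auto simp: sum_nonneg)
    then show ?thesis by (simp add: algebra_simps)
  qed
  ultimately show ?case using insert by (simp add: bump_def)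
qed simp

text \<open>Each \<open>\<xi> i\<close> has infinite variance, but the probability that the sum of squares exceeds \<open>\<eta>\<^sup>2\<close> is still
controlled through \<open>bump\<close>, which is subadditive in the sense of \<open>bump_sum_le\<close>. The factor 3 comes from
\<open>1 - exp (- 1/2) \<ge> 1/3\<close>.\<close>

lemma (in prob_space) prob_square_sum_le:
  assumes st: "\<And>i. i \<in> I \<Longrightarrow> sym_stable M \<alpha> (d i) (\<xi> i)" and fin: "finite I"
    and \<alpha>: "0 \<le> \<alpha>" "\<alpha> \<le> 2" and \<eta>: "\<eta> > 0"
  shows "prob {\<omega> \<in> space M. \<eta>\<^sup>2 < (\<Sum>i\<in>I. (w i * \<xi> i \<omega>)\<^sup>2)} \<le>
    3 * normal_moment \<alpha> * (\<Sum>i\<in>I. d i * \<bar>w i\<bar> powr \<alpha>) / \<eta> powr \<alpha>"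
proof -
  have meas[measurable]: "\<xi> i \<in> borel_measurable M" if "i \<in> I" for i
    using st[OF that] by (rule sym_stable_measurable)
  have bi: "integrable M (\<lambda>\<omega>. bump (u * \<xi> i \<omega>))" if "i \<in> I" for i u
    by (rule integrable_const_bound[of _ 1]) (use that in \<open>auto simp: bump_nonneg bump_le_1\<close>)
  let ?A = "{\<omega> \<in> space M. \<eta>\<^sup>2 < (\<Sum>i\<in>I. (w i * \<xi> i \<omega>)\<^sup>2)}"
  have A[measurable]: "?A \<in> events" by measurable
  have "prob ?A = (\<integral>\<omega>. indicator ?A \<omega> \<partial>M)" by simp
  also have "\<dots> \<le> (\<integral>\<omega>. 3 * (\<Sum>i\<in>I. bump (w i / \<eta> * \<xi> i \<omega>)) \<partial>M)"
  proof (rule integral_mono)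
    show "integrable M (\<lambda>\<omega>. 3 * (\<Sum>i\<in>I. bump (w i / \<eta> * \<xi> i \<omega>)))"
      by (intro Bochner_Integration.integrable_mult_right Bochner_Integration.integrable_sum bi)
    fix \<omega> assume "\<omega> \<in> space M"
    let ?S = "\<Sum>i\<in>I. (w i / \<eta> * \<xi> i \<omega>)\<^sup>2"
    show "indicator ?A \<omega> \<le> 3 * (\<Sum>i\<in>I. bump (w i / \<eta> * \<xi> i \<omega>))"
    proof (cases "\<omega> \<in> ?A")
      case True
      then have "\<eta>\<^sup>2 < (\<Sum>i\<in>I. (w i * \<xi> i \<omega>)\<^sup>2)" by simp
      also have "\<dots> = \<eta>\<^sup>2 * ?S" using \<eta> by (simp add: sum_distrib_left power_mult_distrib power_divide)
      finally have "1 < ?S" using \<eta> by simp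
      have "3/2 \<le> exp (1/2 :: real)" using exp_ge_add_one_self[of "1/2::real"] by simp
      then have "1 / exp (1/2) \<le> 1 / (3/2 :: real)" by (intro divide_left_mono) auto
      then have "exp (- (1/2)) \<le> 2 / (3 :: real)" by (simp add: exp_minus inverse_eq_divide)
      moreover have "exp (- ?S / 2) \<le> exp (- (1/2))" using \<open>1 < ?S\<close> by simp
      ultimately have "1/3 \<le> 1 - exp (- ?S / 2)" by linarith
      also have "\<dots> \<le> (\<Sum>i\<in>I. bump (w i / \<eta> * \<xi> i \<omega>))" by (rule bump_sum_le[OF fin])
      finally show ?thesis using True by simp
    qed (simp add: sum_nonneg bump_nonneg)
  qed (auto intro!: integrable_const_bound[of _ 1])
  also have "\<dots> = 3 * (\<Sum>i\<in>I. (\<integral>\<omega>. bump (w i / \<eta> * \<xi> i \<omega>) \<partial>M))"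
    using bi by (subst integral_mult_right_zero) (simp only: Bochner_Integration.integral_sum[OF bi])
  also have "\<dots> \<le> 3 * (\<Sum>i\<in>I. normal_moment \<alpha> * (d i * \<bar>w i / \<eta>\<bar> powr \<alpha>))"
    by (intro mult_left_mono sum_mono expectation_bump_le[OF st \<alpha>]) auto
  also have "\<dots> = 3 * normal_moment \<alpha> * (\<Sum>i\<in>I. d i * \<bar>w i\<bar> powr \<alpha>) / \<eta> powr \<alpha>"
    using \<eta> by (simp add: sum_distrib_left sum_divide_distrib powr_divide mult_ac)
  finally show ?thesis .
qed

text \<open>The expectation of \<open>1 - cos (\<theta> \<xi>)\<close> is of order \<open>\<theta> powr \<alpha> * c\<close>. The event \<open>\<bar>\<xi>\<bar> \<le> 1\<close> contributes only
\<open>O(\<theta>\<^sup>2 * c)\<close> to it, because the truncated second moment is at most of order \<open>c\<close>. Since \<open>\<alpha> < 2\<close>, a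
small fixed \<open>\<theta>\<close> forces the remaining part, at most twice the tail probability, to be of order \<open>c\<close>.\<close>

lemma stable_tail_lower_bound:
  assumes \<alpha>: "0 < \<alpha>" "\<alpha> < 2"
  obtains \<kappa> :: real where "\<kappa> > 0"
    "\<And>(M :: 'a measure) c \<xi>. prob_space M \<Longrightarrow> sym_stable M \<alpha> c \<xi> \<Longrightarrow> 0 \<le> c \<Longrightarrow> c \<le> 1 \<Longrightarrow>
       \<kappa> * c \<le> measure M {\<omega> \<in> space M. 1 < \<bar>\<xi> \<omega>\<bar>}"
proof -
  let ?K = "normal_moment \<alpha>"
  have K: "0 \<le> ?K" by (rule normal_moment_nonneg)
  \<comment> \<open>small enough for \<open>8 * K * \<theta>\<^sup>2 \<le> \<theta> powr \<alpha>\<close>\<close>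
  define \<theta> where "\<theta> = (1 / (8 * ?K + 8)) powr (1 / (2 - \<alpha>))"
  have \<theta>0: "0 < \<theta>" using K by (simp add: \<theta>_def)
  have \<theta>1: "\<theta> \<le> 1" unfolding \<theta>_def using K \<alpha> by (intro powr_le1) (auto simp: divide_simps)
  have eq: "\<theta> powr (2 - \<alpha>) = 1 / (8 * ?K + 8)" using \<alpha> K by (simp add: \<theta>_def powr_powr)
  have "8 * ?K * \<theta> powr (2 - \<alpha>) \<le> 1" unfolding eq using K by (simp add: divide_simps)
  then have "8 * ?K * \<theta> powr (2 - \<alpha>) * \<theta> powr \<alpha> \<le> \<theta> powr \<alpha>"
    by (intro mult_left_le_one_le) (use K in auto)
  then have \<theta>2: "8 * ?K * \<theta>\<^sup>2 \<le> \<theta> powr \<alpha>"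
    using \<theta>0 by (simp add: mult.assoc flip: powr_add)
  show thesis
  proof (rule that)
    show "\<theta> powr \<alpha> / 8 > 0" using \<theta>0 by simp
    fix M :: "'a measure" and c \<xi>
    assume "prob_space M" and st: "sym_stable M \<alpha> c \<xi>" and c: "0 \<le> c" "c \<le> 1"
    interpret prob_space M by fact
    have [measurable]: "\<xi> \<in> borel_measurable M" using st by (rule sym_stable_measurable)
    interpret D: real_distribution "distr M borel \<xi>" by (auto intro!: real_distribution_distr)
    let ?A = "{\<omega> \<in> space M. 1 < \<bar>\<xi> \<omega>\<bar>}"
    have A[measurable]: "?A \<in> events" by measurable
    have ci: "integrable M (\<lambda>\<omega>. cos (\<theta> * \<xi> \<omega>))" by (rule integrable_const_bound[of _ 1]) auto
    have bi: "integrable M (\<lambda>\<omega>. bump (\<xi> \<omega>))"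
      by (rule integrable_const_bound[of _ 1]) (auto simp: bump_nonneg bump_le_1)
    have ii: "integrable M (indicat_real ?A)" by (auto intro!: integrable_const_bound[of _ 1])
    let ?y = "c * \<theta> powr \<alpha>"
    have "\<theta> powr \<alpha> \<le> 1" using \<theta>0 \<theta>1 \<alpha> by (simp add: powr_le1)
    then have y: "0 \<le> ?y" "?y \<le> 1" using c by (auto intro: mult_le_one)
    have "?y / 2 \<le> 1 - exp (- ?y)"
    proof -
      have "exp (- ?y) * (1 + ?y) \<le> exp (- ?y) * exp ?y"
        by (intro mult_left_mono exp_ge_add_one_self) auto
      then have "exp (- ?y) * (1 + ?y) \<le> 1" by (simp flip: exp_add)
      also have "1 \<le> (1 - ?y / 2) * (1 + ?y)"
      proof -
        have "0 \<le> ?y * (1 - ?y)" using mult_nonneg_nonneg[of ?y "1 - ?y"] y by linarith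
        then show ?thesis by (simp add: algebra_simps)
      qed
      finally have "exp (- ?y) \<le> 1 - ?y / 2"
        by (rule mult_right_le_imp_le) (use y in linarith)
      then show ?thesis by simp
    qed
    also have "exp (- ?y) = (\<integral>\<omega>. cos (\<theta> * \<xi> \<omega>) \<partial>M)"
    proof -
      have "(\<integral>\<omega>. cos (\<theta> * \<xi> \<omega>) \<partial>M) = (\<integral>x. cos (\<theta> * x) \<partial>distr M borel \<xi>)"
        by (simp add: integral_distr)
      also have "\<dots> = exp (- ?y)"
        unfolding D.Re_char[symmetric] using st \<theta>0 by (simp add: sym_stable_def)
      finally show ?thesis by simp
    qed
    also have "1 - (\<integral>\<omega>. cos (\<theta> * \<xi> \<omega>) \<partial>M) = (\<integral>\<omega>. 1 - cos (\<theta> * \<xi> \<omega>) \<partial>M)"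
      using ci by (simp add: prob_space)
    also have "\<dots> \<le> (\<integral>\<omega>. 2 * indicator ?A \<omega> + 2 * \<theta>\<^sup>2 * bump (\<xi> \<omega>) \<partial>M)"
    proof (rule integral_mono)
      fix \<omega> assume \<omega>: "\<omega> \<in> space M"
      show "1 - cos (\<theta> * \<xi> \<omega>) \<le> 2 * indicator ?A \<omega> + 2 * \<theta>\<^sup>2 * bump (\<xi> \<omega>)"
      proof (cases "\<omega> \<in> ?A")
        case True
        have "1 - cos (\<theta> * \<xi> \<omega>) \<le> 2" using cos_ge_minus_one[of "\<theta> * \<xi> \<omega>"] by linarith
        moreover have "0 \<le> 2 * \<theta>\<^sup>2 * bump (\<xi> \<omega>)" using bump_nonneg by auto
        moreover have "indicat_real ?A \<omega> = 1" using True by simp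
        ultimately show ?thesis by linarith
      next
        case False
        have "1 - cos (\<theta> * \<xi> \<omega>) = 2 * (sin (\<theta> * \<xi> \<omega> / 2))\<^sup>2"
          using cos_double_sin[of "\<theta> * \<xi> \<omega> / 2"] by simp
        also have "\<dots> \<le> 2 * (\<theta> * \<xi> \<omega> / 2)\<^sup>2"
          using iffD1[OF abs_le_square_iff abs_sin_x_le_abs_x[of "\<theta> * \<xi> \<omega> / 2"]] by linarith
        also have "\<dots> = \<theta>\<^sup>2 * (\<xi> \<omega>)\<^sup>2 / 2" by (simp add: power_mult_distrib power_divide)
        also have "\<dots> \<le> \<theta>\<^sup>2 * (4 * bump (\<xi> \<omega>)) / 2"
          using False \<omega> by (intro divide_right_mono mult_left_mono square_le_bump) auto
        finally show ?thesis using False by (simp add: mult_ac)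
      qed
    qed (use ci bi ii in auto)
    also have "\<dots> = 2 * prob ?A + 2 * \<theta>\<^sup>2 * (\<integral>\<omega>. bump (\<xi> \<omega>) \<partial>M)"
      using bi ii by (subst Bochner_Integration.integral_add) auto
    also have "\<dots> \<le> 2 * prob ?A + 2 * \<theta>\<^sup>2 * (?K * c)"
      using expectation_bump_le[OF st, of 1] \<alpha> by (intro add_left_mono mult_left_mono) auto
    also have "2 * \<theta>\<^sup>2 * (?K * c) = 8 * ?K * \<theta>\<^sup>2 * c / 4" by simp
    also have "\<dots> \<le> \<theta> powr \<alpha> * c / 4" using \<theta>2 c by (intro divide_right_mono mult_right_mono) auto
    finally show "\<theta> powr \<alpha> / 8 * c \<le> prob ?A" by (simp add: algebra_simps)
  qed
qed

section \<open>Random signs and a maximal inequality\<close>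

text \<open>Sign vectors are represented by the set \<open>A\<close> of coordinates whose sign is reversed, so that averaging
over random signs on \<open>I\<close> is a sum over \<open>Pow I\<close>.\<close>

definition flip :: "'i set \<Rightarrow> ('i \<Rightarrow> real) \<Rightarrow> 'i \<Rightarrow> real" where
  "flip A x i = (if i \<in> A then - x i else x i)"

lemma flip_diff: "flip A x i - flip A y i = flip A (\<lambda>i. x i - y i) i"
  and flip_mult: "c i * flip A x i = flip A (\<lambda>i. c i * x i) i"
  by (auto simp: flip_def)

lemma sum_Pow_insert:
  fixes F :: "'i set \<Rightarrow> real"
  assumes "finite I" "x \<notin> I"
  shows "(\<Sum>A\<in>Pow (insert x I). F A) = (\<Sum>A\<in>Pow I. F A + F (insert x A))"
proof -
  have inj: "inj_on (insert x) (Pow I)" using assms by (auto simp: inj_on_def)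
  have "(\<Sum>A\<in>Pow (insert x I). F A) = (\<Sum>A\<in>Pow I. F A) + (\<Sum>A\<in>insert x ` Pow I. F A)"
    unfolding Pow_insert using assms by (intro sum.union_disjoint) auto
  also have "(\<Sum>A\<in>insert x ` Pow I. F A) = (\<Sum>A\<in>Pow I. F (insert x A))"
    by (simp add: sum.reindex[OF inj])
  finally show ?thesis by (simp add: sum.distrib)
qed

lemma sum_flip_insert:
  assumes "finite I" "x \<notin> I" "A \<subseteq> I"
  shows "(\<Sum>i\<in>insert x I. flip A b i) = (\<Sum>i\<in>I. flip A b i) + b x"
    and "(\<Sum>i\<in>insert x I. flip (insert x A) b i) = (\<Sum>i\<in>I. flip A b i) - b x"
proof -
  have "(\<Sum>i\<in>I. flip (insert x A) b i) = (\<Sum>i\<in>I. flip A b i)"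
    using assms by (intro sum.cong) (auto simp: flip_def)
  then show "(\<Sum>i\<in>insert x I. flip (insert x A) b i) = (\<Sum>i\<in>I. flip A b i) - b x"
    using assms by (simp add: flip_def[of "insert x A" b x])
  show "(\<Sum>i\<in>insert x I. flip A b i) = (\<Sum>i\<in>I. flip A b i) + b x"
    using assms by (auto simp: flip_def[of A b x])
qed

lemma sign_average_square:
  assumes "finite I"
  shows "(\<Sum>A\<in>Pow I. (\<Sum>i\<in>I. flip A b i)\<^sup>2) = 2 ^ card I * (\<Sum>i\<in>I. (b i)\<^sup>2)"
  using assms
proof (induction I)
  case (insert x I)
  have "(\<Sum>A\<in>Pow (insert x I). (\<Sum>i\<in>insert x I. flip A b i)\<^sup>2) =
     (\<Sum>A\<in>Pow I. 2 * (\<Sum>i\<in>I. flip A b i)\<^sup>2 + 2 * (b x)\<^sup>2)"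
    unfolding sum_Pow_insert[OF insert(1,2)]
    by (intro sum.cong refl) (simp add: sum_flip_insert[OF insert(1,2)] power2_eq_square algebra_simps)
  also have "\<dots> = 2 * (2 ^ card I * (\<Sum>i\<in>I. (b i)\<^sup>2)) + 2 ^ card I * (2 * (b x)\<^sup>2)"
    using insert(1) by (simp add: sum.distrib insert.IH card_Pow flip: sum_distrib_left)
  finally show ?case using insert by (simp add: algebra_simps)
qed simp

text \<open>Khintchine's inequality for the fourth moment: adding one more sign leaves only the even powers in
\<open>(s + y) ^ 4 + (s - y) ^ 4\<close>, and the mixed term is governed by \<open>sign_average_square\<close>.\<close>

lemma sign_average_fourth_le:
  assumes "finite I"
  shows "(\<Sum>A\<in>Pow I. (\<Sum>i\<in>I. flip A b i) ^ 4) \<le> 3 * 2 ^ card I * (\<Sum>i\<in>I. (b i)\<^sup>2)\<^sup>2"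
  using assms
proof (induction I)
  case (insert x I)
  let ?V = "\<Sum>i\<in>I. (b i)\<^sup>2" and ?n = "2 ^ card I :: real"
  have eq: "(s + y) ^ 4 + (s - y) ^ 4 = 2 * s ^ 4 + 12 * y\<^sup>2 * s\<^sup>2 + 2 * y ^ 4" for s y :: real
    by (simp add: power4_eq_xxxx power2_eq_square algebra_simps)
  have "(\<Sum>A\<in>Pow (insert x I). (\<Sum>i\<in>insert x I. flip A b i) ^ 4) =
     (\<Sum>A\<in>Pow I. 2 * (\<Sum>i\<in>I. flip A b i) ^ 4 + 12 * (b x)\<^sup>2 * (\<Sum>i\<in>I. flip A b i)\<^sup>2 + 2 * (b x) ^ 4)"
    unfolding sum_Pow_insert[OF insert(1,2)]
    by (intro sum.cong refl) (simp only: sum_flip_insert[OF insert(1,2)] Pow_iff eq)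
  also have "\<dots> = 2 * (\<Sum>A\<in>Pow I. (\<Sum>i\<in>I. flip A b i) ^ 4) + 12 * (b x)\<^sup>2 * (?n * ?V) + ?n * (2 * (b x) ^ 4)"
    using insert(1) by (simp add: sum.distrib sign_average_square card_Pow flip: sum_distrib_left)
  also have "\<dots> \<le> 2 * (3 * ?n * ?V\<^sup>2) + 12 * (b x)\<^sup>2 * (?n * ?V) + ?n * (6 * (b x) ^ 4)"
    using insert.IH by (intro add_mono mult_left_mono) auto
  also have "\<dots> = 3 * (2 * ?n) * (?V + (b x)\<^sup>2)\<^sup>2"
    by (simp add: power4_eq_xxxx power2_eq_square algebra_simps)
  finally show ?case using insert(1,2) by (simp add: add.commute)
qed simp

text \<open>Convexity with weights 1/6 and 5/6. What matters is \<open>(6/5) ^ 3 < 2\<close>: the bisection in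
\<open>fourth_moment_maximal\<close> gains a factor 1/2, which this must not use up.\<close>

lemma fourth_power_add_le:
  fixes x y :: real
  shows "(x + y) ^ 4 \<le> 216 * x ^ 4 + (6/5) ^ 3 * y ^ 4"
proof -
  have c: "(a/6 + 5*b/6)\<^sup>2 \<le> a\<^sup>2/6 + 5*b\<^sup>2/6" for a b :: real
  proof -
    have "a\<^sup>2/6 + 5*b\<^sup>2/6 - (a/6 + 5*b/6)\<^sup>2 = 5/36 * (a - b)\<^sup>2"
      by (simp add: power2_eq_square field_simps)
    then show ?thesis using zero_le_power2[of "a - b"] by linarith
  qed
  have "(x + y) ^ 4 = (((6*x)/6 + 5*(6*y/5)/6)\<^sup>2)\<^sup>2" by (simp flip: power_mult)
  also have "\<dots> \<le> ((6*x)\<^sup>2/6 + 5*(6*y/5)\<^sup>2/6)\<^sup>2"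
    by (intro power_mono c) auto
  also have "\<dots> \<le> ((6*x)\<^sup>2)\<^sup>2/6 + 5*((6*y/5)\<^sup>2)\<^sup>2/6" by (rule c)
  also have "\<dots> = 216 * x ^ 4 + (6/5) ^ 3 * y ^ 4"
    by (simp add: power_mult_distrib power_divide flip: power_mult)
  finally show ?thesis .
qed

text \<open>Bisection with respect to the clock \<open>G\<close> instead of the index: the interval is cut where \<open>G\<close> has gained
half of its increment, at neighbouring indices \<open>p\<close> and \<open>Suc p\<close> because \<open>G\<close> may jump there. The running
maximum is at most the increment up to \<open>Suc p\<close> plus the larger of the maxima of the two halves, whose
fourth moments add up to half of the bound for the whole interval. The constant satisfies
\<open>216 + (6/5) ^ 3 * 1600 / 2 \<le> 1600\<close>.\<close>

lemma fourth_moment_maximal: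
  fixes Z :: "nat \<Rightarrow> 'b \<Rightarrow> real" and G :: "nat \<Rightarrow> real"
  assumes mom: "\<And>l k. l \<le> k \<Longrightarrow> k \<le> N \<Longrightarrow> (\<Sum>\<omega>\<in>\<Omega>. (Z k \<omega> - Z l \<omega>) ^ 4) \<le> (G k - G l)\<^sup>2"
    and G: "\<And>l k. l \<le> k \<Longrightarrow> k \<le> N \<Longrightarrow> G l \<le> G k"
    and "l \<le> k" "k \<le> N"
  shows "\<exists>m. (\<forall>\<omega>. 0 \<le> m \<omega> \<and> (\<forall>j\<in>{l..k}. \<bar>Z j \<omega> - Z l \<omega>\<bar> \<le> m \<omega>)) \<and>
     (\<Sum>\<omega>\<in>\<Omega>. m \<omega> ^ 4) \<le> 1600 * (G k - G l)\<^sup>2"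
  using assms(3,4)
proof (induction "k - l" arbitrary: l k rule: less_induct)
  case less
  show ?case
  proof (cases "l = k")
    case True
    then show ?thesis by (intro exI[of _ "\<lambda>_. 0"]) auto
  next
    case False
    with less.prems have lk: "l < k" by simp
    let ?g = "G k - G l"
    have g0: "0 \<le> ?g" using G less.prems by simp
    \<comment> \<open>up to \<open>p\<close> the clock gains at most half of its increment, and after \<open>Suc p\<close> also\<close>
    define p where "p = (GREATEST p. l \<le> p \<and> p < k \<and> G p - G l \<le> ?g / 2)"
    have P: "l \<le> p \<and> p < k \<and> G p - G l \<le> ?g / 2"
      unfolding p_def by (rule GreatestI_nat[of _ l k]) (use lk g0 in auto)
    have pmax: "p' \<le> p" if "l \<le> p'" "p' < k" "G p' - G l \<le> ?g / 2" for p'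
      unfolding p_def by (rule Greatest_le_nat[of _ _ k]) (use that in auto)
    let ?q = "Suc p"
    have q: "G k - G ?q \<le> ?g / 2"
    proof (cases "?q = k")
      case True
      then show ?thesis using g0 by simp
    next
      case False
      then have "\<not> G ?q - G l \<le> ?g / 2" using pmax[of ?q] P by auto
      then show ?thesis by (simp add: field_simps)
    qed
    have "p - l < k - l" "l \<le> p" "p \<le> N" using P lk less.prems by auto
    from less.hyps[OF this] obtain m1 where
      m1: "\<And>\<omega>. 0 \<le> m1 \<omega>" "\<And>\<omega> j. j \<in> {l..p} \<Longrightarrow> \<bar>Z j \<omega> - Z l \<omega>\<bar> \<le> m1 \<omega>"
        "(\<Sum>\<omega>\<in>\<Omega>. m1 \<omega> ^ 4) \<le> 1600 * (G p - G l)\<^sup>2" by blast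
    have "k - ?q < k - l" "?q \<le> k" "k \<le> N" using P lk less.prems by auto
    from less.hyps[OF this] obtain m2 where
      m2: "\<And>\<omega>. 0 \<le> m2 \<omega>" "\<And>\<omega> j. j \<in> {?q..k} \<Longrightarrow> \<bar>Z j \<omega> - Z ?q \<omega>\<bar> \<le> m2 \<omega>"
        "(\<Sum>\<omega>\<in>\<Omega>. m2 \<omega> ^ 4) \<le> 1600 * (G k - G ?q)\<^sup>2" by blast
    let ?m = "\<lambda>\<omega>. \<bar>Z ?q \<omega> - Z l \<omega>\<bar> + max (m1 \<omega>) (m2 \<omega>)"
    have "\<bar>Z j \<omega> - Z l \<omega>\<bar> \<le> ?m \<omega>" if "j \<in> {l..k}" for j \<omega>
    proof (cases "j \<le> p")
      case True
      then show ?thesis using m1(2)[of j \<omega>] that by auto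
    next
      case False
      then have "\<bar>Z j \<omega> - Z ?q \<omega>\<bar> \<le> m2 \<omega>" using m2(2)[of j \<omega>] that by auto
      then show ?thesis by linarith
    qed
    moreover have "0 \<le> ?m \<omega>" for \<omega> using m1(1)[of \<omega>] by linarith
    moreover have "(\<Sum>\<omega>\<in>\<Omega>. ?m \<omega> ^ 4) \<le> 1600 * ?g\<^sup>2"
    proof -
      have "(\<Sum>\<omega>\<in>\<Omega>. ?m \<omega> ^ 4) \<le> (\<Sum>\<omega>\<in>\<Omega>. 216 * (Z ?q \<omega> - Z l \<omega>) ^ 4 + (6/5) ^ 3 * (m1 \<omega> ^ 4 + m2 \<omega> ^ 4))"
      proof (rule sum_mono)
        fix \<omega>
        have "?m \<omega> ^ 4 \<le> 216 * \<bar>Z ?q \<omega> - Z l \<omega>\<bar> ^ 4 + (6/5) ^ 3 * max (m1 \<omega>) (m2 \<omega>) ^ 4"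
          by (rule fourth_power_add_le)
        also have "max (m1 \<omega>) (m2 \<omega>) ^ 4 \<le> m1 \<omega> ^ 4 + m2 \<omega> ^ 4"
          by (auto simp: max_def)
        finally show "?m \<omega> ^ 4 \<le> 216 * (Z ?q \<omega> - Z l \<omega>) ^ 4 + (6/5) ^ 3 * (m1 \<omega> ^ 4 + m2 \<omega> ^ 4)"
          by (simp add: power_even_abs)
      qed
      also have "\<dots> = 216 * (\<Sum>\<omega>\<in>\<Omega>. (Z ?q \<omega> - Z l \<omega>) ^ 4) +
          (6/5) ^ 3 * ((\<Sum>\<omega>\<in>\<Omega>. m1 \<omega> ^ 4) + (\<Sum>\<omega>\<in>\<Omega>. m2 \<omega> ^ 4))"
        by (simp add: sum.distrib flip: sum_distrib_left)
      also have "\<dots> \<le> 216 * (G ?q - G l)\<^sup>2 + (6/5) ^ 3 * (1600 * (G p - G l)\<^sup>2 + 1600 * (G k - G ?q)\<^sup>2)"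
        using mom[of l ?q] P less.prems m1(3) m2(3) by (intro add_mono mult_left_mono) auto
      also have "\<dots> \<le> 216 * ?g\<^sup>2 + (6/5) ^ 3 * (1600 * (?g/2)\<^sup>2 + 1600 * (?g/2)\<^sup>2)"
        using P q G[of l ?q] G[of ?q k] G[of l p] less.prems
        by (intro add_mono mult_left_mono power_mono) auto
      also have "\<dots> \<le> 1600 * ?g\<^sup>2" by (simp add: power_divide)
      finally show ?thesis .
    qed
    ultimately show ?thesis by (intro exI[of _ ?m]) auto
  qed
qed

section \<open>Sign changes of independent symmetric random variables\<close>

text \<open>Both laws are the product of the same marginal laws.\<close>

lemma (in prob_space) distr_flip:
  assumes ind: "indep_vars (\<lambda>_. borel) \<xi> I"
    and sym: "\<And>i. i \<in> I \<Longrightarrow> distr M borel (\<lambda>\<omega>. - \<xi> i \<omega>) = distr M borel (\<xi> i)"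
  shows "distr M (Pi\<^sub>M I (\<lambda>_. borel)) (\<lambda>\<omega>. \<lambda>i\<in>I. flip A (\<lambda>i. \<xi> i \<omega>) i) =
         distr M (Pi\<^sub>M I (\<lambda>_. borel)) (\<lambda>\<omega>. \<lambda>i\<in>I. \<xi> i \<omega>)"
proof (cases "I = {}")
  case False
  have m[measurable]: "\<xi> i \<in> borel_measurable M" if "i \<in> I" for i
    using ind that by (auto simp: indep_vars_def)
  let ?g = "\<lambda>i y. if i \<in> A then - y else y :: real"
  have g: "distr M borel (\<lambda>\<omega>. ?g i (\<xi> i \<omega>)) = distr M borel (\<xi> i)" if "i \<in> I" for i
    using sym[OF that] by (cases "i \<in> A") simp_all
  have ind': "indep_vars (\<lambda>_. borel) (\<lambda>i \<omega>. ?g i (\<xi> i \<omega>)) I"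
    by (rule indep_vars_compose2[OF ind]) auto
  have "distr M (Pi\<^sub>M I (\<lambda>_. borel)) (\<lambda>\<omega>. \<lambda>i\<in>I. ?g i (\<xi> i \<omega>)) =
      Pi\<^sub>M I (\<lambda>i. distr M borel (\<lambda>\<omega>. ?g i (\<xi> i \<omega>)))"
    using ind' by (subst (asm) indep_vars_iff_distr_eq_PiM'[OF False]) auto
  also have "\<dots> = Pi\<^sub>M I (\<lambda>i. distr M borel (\<xi> i))"
    by (intro PiM_cong refl g)
  also have "\<dots> = distr M (Pi\<^sub>M I (\<lambda>_. borel)) (\<lambda>\<omega>. \<lambda>i\<in>I. \<xi> i \<omega>)"
    using ind by (subst (asm) indep_vars_iff_distr_eq_PiM'[OF False]) auto
  finally show ?thesis unfolding flip_def .
qed (simp add: restrict_def)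

text \<open>The condition on \<open>restrict\<close> says that \<open>Q\<close> depends on the coordinates in \<open>I\<close> only.\<close>

lemma (in prob_space) prob_flip:
  assumes ind: "indep_vars (\<lambda>_. borel) \<xi> I"
    and sym: "\<And>i. i \<in> I \<Longrightarrow> distr M borel (\<lambda>\<omega>. - \<xi> i \<omega>) = distr M borel (\<xi> i)"
    and Q: "{x \<in> space (Pi\<^sub>M I (\<lambda>_. borel)). Q x} \<in> sets (Pi\<^sub>M I (\<lambda>_. borel))"
    and cong: "\<And>x. Q (restrict x I) \<longleftrightarrow> Q x"
  shows "prob {\<omega> \<in> space M. Q (flip A (\<lambda>i. \<xi> i \<omega>))} = prob {\<omega> \<in> space M. Q (\<lambda>i. \<xi> i \<omega>)}"
proof -
  have m[measurable]: "\<xi> i \<in> borel_measurable M" if "i \<in> I" for i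
    using ind that by (auto simp: indep_vars_def)
  let ?S = "{x \<in> space (Pi\<^sub>M I (\<lambda>_. borel)). Q x}"
  have m2: "(\<lambda>\<omega>. \<lambda>i\<in>I. flip A (\<lambda>i. \<xi> i \<omega>) i) \<in> measurable M (Pi\<^sub>M I (\<lambda>_. borel))"
    unfolding flip_def by (intro measurable_restrict) auto
  have m1: "(\<lambda>\<omega>. \<lambda>i\<in>I. \<xi> i \<omega>) \<in> measurable M (Pi\<^sub>M I (\<lambda>_. borel))"
    by (intro measurable_restrict) auto
  have "prob {\<omega> \<in> space M. Q (flip A (\<lambda>i. \<xi> i \<omega>))} =
      measure (distr M (Pi\<^sub>M I (\<lambda>_. borel)) (\<lambda>\<omega>. \<lambda>i\<in>I. flip A (\<lambda>i. \<xi> i \<omega>) i)) ?S"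
    by (subst measure_distr[OF m2 Q]) (auto simp: space_PiM cong vimage_def Int_def conj_commute)
  also have "\<dots> = measure (distr M (Pi\<^sub>M I (\<lambda>_. borel)) (\<lambda>\<omega>. \<lambda>i\<in>I. \<xi> i \<omega>)) ?S"
    using distr_flip[OF ind, of A] sym by simp
  also have "\<dots> = prob {\<omega> \<in> space M. Q (\<lambda>i. \<xi> i \<omega>)}"
    by (subst measure_distr[OF m1 Q]) (auto simp: space_PiM cong vimage_def Int_def conj_commute)
  finally show ?thesis .
qed

text \<open>The law of \<open>\<xi>\<close> does not change under sign flips, so the probability equals its average over all flips,
taken inside the expectation. For fixed values of \<open>\<xi>\<close> this is an average over random signs, to which
\<open>fourth_moment_maximal\<close> applies with a multiple of the clock
\<open>k \<mapsto> (\<Sum>i\<in>I. (w i * \<xi> i)\<^sup>2 * v k i)\<close>. The total increment of this clock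
is at most twice the sum of squares; on the event that this sum exceeds \<open>\<eta>\<^sup>2\<close> the average is
bounded by 1.\<close>

lemma (in prob_space) prob_max_linear_le:
  fixes a v :: "nat \<Rightarrow> 'i \<Rightarrow> real" and w :: "'i \<Rightarrow> real"
  assumes fin: "finite I" and ind: "indep_vars (\<lambda>_. borel) \<xi> I"
    and sym: "\<And>i. i \<in> I \<Longrightarrow> distr M borel (\<lambda>\<omega>. - \<xi> i \<omega>) = distr M borel (\<xi> i)"
    and a0: "\<And>i. i \<in> I \<Longrightarrow> a 0 i = 0"
    and av: "\<And>i l k. i \<in> I \<Longrightarrow> l \<le> k \<Longrightarrow> k \<le> N \<Longrightarrow> (a k i - a l i)\<^sup>2 \<le> (w i)\<^sup>2 * (v k i - v l i)"
    and v: "\<And>i l k. i \<in> I \<Longrightarrow> l \<le> k \<Longrightarrow> k \<le> N \<Longrightarrow> v l i \<le> v k i"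
    and v2: "\<And>i. i \<in> I \<Longrightarrow> v N i - v 0 i \<le> 2"
    and pos: "\<rho> > 0" "\<eta> > 0"
  shows "prob {\<omega> \<in> space M. \<exists>k\<le>N. \<rho> < \<bar>\<Sum>i\<in>I. a k i * \<xi> i \<omega>\<bar>} \<le>
    prob {\<omega> \<in> space M. \<eta>\<^sup>2 < (\<Sum>i\<in>I. (w i * \<xi> i \<omega>)\<^sup>2)} + 19200 * (\<eta> / \<rho>) ^ 4"
proof -
  have m[measurable]: "\<xi> i \<in> borel_measurable M" if "i \<in> I" for i
    using ind that by (auto simp: indep_vars_def)
  let ?n = "2 ^ card I :: real"
  let ?Q = "\<lambda>x. \<exists>k\<le>N. \<rho> < \<bar>\<Sum>i\<in>I. a k i * x i\<bar>"
  have signs: "(\<Sum>A\<in>Pow I. of_bool (?Q (flip A x))) \<le> ?n * 19200 * ((\<Sum>i\<in>I. (w i * x i)\<^sup>2) / \<rho>\<^sup>2)\<^sup>2"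
    for x :: "'i \<Rightarrow> real"
  proof -
    let ?S = "\<Sum>i\<in>I. (w i * x i)\<^sup>2"
    define Z where "Z k A = (\<Sum>i\<in>I. a k i * flip A x i)" for k A
    define G where "G k = sqrt (3 * ?n) * (\<Sum>i\<in>I. (w i * x i)\<^sup>2 * v k i)" for k
    have Gdiff: "G k - G l = sqrt (3 * ?n) * (\<Sum>i\<in>I. (w i * x i)\<^sup>2 * (v k i - v l i))" for k l
      by (simp add: G_def right_diff_distrib sum_subtractf)
    have G: "G l \<le> G k" if "l \<le> k" "k \<le> N" for l k
      unfolding G_def by (intro mult_left_mono sum_mono v that) auto
    have mom: "(\<Sum>A\<in>Pow I. (Z k A - Z l A) ^ 4) \<le> (G k - G l)\<^sup>2" if "l \<le> k" "k \<le> N" for l k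
    proof -
      have "(\<Sum>A\<in>Pow I. (Z k A - Z l A) ^ 4) = (\<Sum>A\<in>Pow I. (\<Sum>i\<in>I. flip A (\<lambda>i. (a k i - a l i) * x i) i) ^ 4)"
        unfolding Z_def sum_subtractf[symmetric] flip_mult flip_diff
        by (simp add: left_diff_distrib)
      also have "\<dots> \<le> 3 * ?n * (\<Sum>i\<in>I. ((a k i - a l i) * x i)\<^sup>2)\<^sup>2"
        by (rule sign_average_fourth_le[OF fin])
      also have "\<dots> \<le> 3 * ?n * (\<Sum>i\<in>I. (w i * x i)\<^sup>2 * (v k i - v l i))\<^sup>2"
      proof (intro mult_left_mono power_mono sum_mono)
        fix i assume "i \<in> I"
        then have "(a k i - a l i)\<^sup>2 * (x i)\<^sup>2 \<le> (w i)\<^sup>2 * (v k i - v l i) * (x i)\<^sup>2"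
          by (intro mult_right_mono av that) auto
        then show "((a k i - a l i) * x i)\<^sup>2 \<le> (w i * x i)\<^sup>2 * (v k i - v l i)"
          by (simp add: power_mult_distrib mult_ac)
      qed (auto intro: sum_nonneg)
      also have "\<dots> = (G k - G l)\<^sup>2" by (simp add: Gdiff power_mult_distrib)
      finally show ?thesis .
    qed
    have "\<exists>m. (\<forall>A. 0 \<le> m A \<and> (\<forall>j\<in>{0..N}. \<bar>Z j A - Z 0 A\<bar> \<le> m A)) \<and>
        (\<Sum>A\<in>Pow I. m A ^ 4) \<le> 1600 * (G N - G 0)\<^sup>2"
      by (rule fourth_moment_maximal[where N=N]) (use mom G in auto)
    then obtain mx where mx: "\<And>A. 0 \<le> mx A" "\<And>A j. j \<le> N \<Longrightarrow> \<bar>Z j A - Z 0 A\<bar> \<le> mx A"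
      and mx4: "(\<Sum>A\<in>Pow I. mx A ^ 4) \<le> 1600 * (G N - G 0)\<^sup>2"
      by (auto simp: Ball_def)
    have Z0: "Z 0 A = 0" for A by (simp add: Z_def a0)
    have "(\<Sum>A\<in>Pow I. of_bool (?Q (flip A x))) \<le> (\<Sum>A\<in>Pow I. mx A ^ 4 / \<rho> ^ 4)"
    proof (rule sum_mono)
      fix A
      show "of_bool (?Q (flip A x)) \<le> mx A ^ 4 / \<rho> ^ 4"
      proof (cases "?Q (flip A x)")
        case True
        then obtain k where "k \<le> N" "\<rho> < \<bar>Z k A\<bar>" by (auto simp: Z_def)
        then have "\<rho> \<le> mx A" using mx(2)[of k A] by (simp add: Z0)
        then have "\<rho> ^ 4 \<le> mx A ^ 4" using pos by (intro power_mono) auto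
        then show ?thesis using True pos by simp
      qed (use mx pos in auto)
    qed
    also have "\<dots> = (\<Sum>A\<in>Pow I. mx A ^ 4) / \<rho> ^ 4" by (simp add: sum_divide_distrib)
    also have "\<dots> \<le> 1600 * (G N - G 0)\<^sup>2 / \<rho> ^ 4" using mx4 pos by (intro divide_right_mono) auto
    also have "(G N - G 0)\<^sup>2 = 3 * ?n * (\<Sum>i\<in>I. (w i * x i)\<^sup>2 * (v N i - v 0 i))\<^sup>2"
      by (simp add: Gdiff power_mult_distrib)
    also have "\<dots> \<le> 3 * ?n * (\<Sum>i\<in>I. (w i * x i)\<^sup>2 * 2)\<^sup>2"
      using v[of _ 0 N] by (intro mult_left_mono power_mono sum_mono v2 sum_nonneg mult_nonneg_nonneg) auto
    also have "\<dots> = 12 * ?n * ?S\<^sup>2" by (simp add: power_mult_distrib flip: sum_distrib_right)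
    finally have "(\<Sum>A\<in>Pow I. of_bool (?Q (flip A x))) \<le> 1600 * (12 * ?n * ?S\<^sup>2) / \<rho> ^ 4"
      using pos by (simp add: divide_right_mono)
    then show ?thesis by (simp add: power_divide mult_ac flip: power_mult)
  qed
  define E where "E A = {\<omega> \<in> space M. ?Q (flip A (\<lambda>i. \<xi> i \<omega>))}" for A
  define B where "B = {\<omega> \<in> space M. \<eta>\<^sup>2 < (\<Sum>i\<in>I. (w i * \<xi> i \<omega>)\<^sup>2)}"
  let ?c = "19200 * (\<eta> / \<rho>) ^ 4"
  have E[measurable]: "E A \<in> events" for A unfolding E_def flip_def by measurable
  have B[measurable]: "B \<in> events" unfolding B_def by measurable
  have eq: "prob (E A) = prob {\<omega> \<in> space M. ?Q (\<lambda>i. \<xi> i \<omega>)}" for A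
    unfolding E_def
  proof (rule prob_flip[OF ind sym, where Q="?Q"])
    show "{x \<in> space (Pi\<^sub>M I (\<lambda>_. borel)). ?Q x} \<in> sets (Pi\<^sub>M I (\<lambda>_. borel))" by measurable
    fix x :: "'i \<Rightarrow> real"
    have "(\<Sum>i\<in>I. a k i * restrict x I i) = (\<Sum>i\<in>I. a k i * x i)" for k by (intro sum.cong) auto
    then show "?Q (restrict x I) \<longleftrightarrow> ?Q x" by (simp only:)
  qed
  have ii: "integrable M (indicat_real (E A))" "integrable M (indicat_real B)" for A
    by (auto intro!: integrable_const_bound[of _ 1])
  have "?n * prob {\<omega> \<in> space M. ?Q (\<lambda>i. \<xi> i \<omega>)} = (\<Sum>A\<in>Pow I. prob (E A))"
    unfolding eq using fin by (simp only: sum_constant card_Pow of_nat_power of_nat_numeral)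
  also have "\<dots> = (\<integral>\<omega>. (\<Sum>A\<in>Pow I. indicat_real (E A) \<omega>) \<partial>M)"
    using ii by simp
  also have "\<dots> \<le> (\<integral>\<omega>. ?n * (indicat_real B \<omega> + ?c) \<partial>M)"
  proof (rule integral_mono)
    fix \<omega> assume \<omega>: "\<omega> \<in> space M"
    let ?x = "\<lambda>i. \<xi> i \<omega>"
    have le: "(\<Sum>A\<in>Pow I. indicat_real (E A) \<omega>) = (\<Sum>A\<in>Pow I. of_bool (?Q (flip A ?x)))"
      using \<omega> by (intro sum.cong) (auto simp: indicator_def E_def)
    show "(\<Sum>A\<in>Pow I. indicat_real (E A) \<omega>) \<le> ?n * (indicat_real B \<omega> + ?c)"
    proof (cases "\<omega> \<in> B")
      case True
      have "(\<Sum>A\<in>Pow I. indicat_real (E A) \<omega>) \<le> (\<Sum>A\<in>Pow I. 1)"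
        by (intro sum_mono) (auto simp: indicator_def)
      also have "\<dots> = ?n * 1" using fin by (simp add: card_Pow)
      also have "\<dots> \<le> ?n * (indicat_real B \<omega> + ?c)"
        using True pos by (intro mult_left_mono) auto
      finally show ?thesis .
    next
      case False
      then have S: "(\<Sum>i\<in>I. (w i * ?x i)\<^sup>2) \<le> \<eta>\<^sup>2" using \<omega> by (auto simp: B_def)
      have "(\<Sum>A\<in>Pow I. indicat_real (E A) \<omega>) \<le> ?n * 19200 * ((\<Sum>i\<in>I. (w i * ?x i)\<^sup>2) / \<rho>\<^sup>2)\<^sup>2"
        unfolding le by (rule signs)
      also have "\<dots> \<le> ?n * 19200 * (\<eta>\<^sup>2 / \<rho>\<^sup>2)\<^sup>2"
        using S pos by (intro mult_left_mono power_mono divide_right_mono) (auto intro!: sum_nonneg divide_nonneg_nonneg)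
      also have "\<dots> = ?n * ?c" by (simp add: power_divide flip: power_mult)
      finally show ?thesis using False by simp
    qed
  qed (use ii in auto)
  also have "\<dots> = ?n * (prob B + ?c)" using ii by (simp add: prob_space)
  finally show ?thesis by (simp add: B_def)
qed

text \<open>Reflection at the first index \<open>k\<close> for which the block sum is large. Flipping all signs outside \<open>B k\<close>
leaves the block sum of \<open>B k\<close> and the absolute values of the other block sums unchanged, hence also
the event that \<open>k\<close> is the first index. The full sum and the flipped full sum add up to twice the block
sum, so that one of them is large, and both have the same law on that event.\<close>

lemma (in prob_space) prob_block_max_le:
  fixes b :: "nat \<Rightarrow> 'i \<Rightarrow> real" and B :: "nat \<Rightarrow> 'i set"
  assumes fin: "finite I" and ind: "indep_vars (\<lambda>_. borel) \<xi> I"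
    and sym: "\<And>i. i \<in> I \<Longrightarrow> distr M borel (\<lambda>\<omega>. - \<xi> i \<omega>) = distr M borel (\<xi> i)"
    and BI: "\<And>k. B k \<subseteq> I" and disj: "\<And>j k. j \<noteq> k \<Longrightarrow> B j \<inter> B k = {}"
  shows "prob {\<omega> \<in> space M. \<exists>k<N. \<rho> < \<bar>\<Sum>i\<in>B k. b k i * \<xi> i \<omega>\<bar>} \<le>
    2 * prob {\<omega> \<in> space M. \<exists>k<N. \<rho> < \<bar>\<Sum>i\<in>I. b k i * \<xi> i \<omega>\<bar>}"
proof -
  have m[measurable]: "\<xi> i \<in> borel_measurable M" if "i \<in> I" for i
    using ind that by (auto simp: indep_vars_def)
  have mB[measurable]: "(\<lambda>\<omega>. \<Sum>i\<in>B k. b k i * \<xi> i \<omega>) \<in> borel_measurable M" for k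
    using BI[of k] by (intro borel_measurable_sum) auto
  have mC[measurable]: "(\<lambda>x. \<Sum>i\<in>B k. b k i * x i) \<in> borel_measurable (Pi\<^sub>M I (\<lambda>_. borel))" for k
    using BI[of k] by (intro borel_measurable_sum borel_measurable_times measurable_component_singleton) auto
  let ?V = "\<lambda>k x. \<Sum>i\<in>B k. b k i * x i" and ?U = "\<lambda>k x. \<Sum>i\<in>I. b k i * x i"
  let ?F = "\<lambda>k x. \<rho> < \<bar>?V k x\<bar> \<and> (\<forall>j<k. \<not> \<rho> < \<bar>?V j x\<bar>)"
  let ?Q = "\<lambda>k x. ?F k x \<and> \<rho> < \<bar>?U k x\<bar>"
  let ?X = "\<lambda>\<omega> i. \<xi> i \<omega>"
  have meas: "{\<omega> \<in> space M. ?F k (?X \<omega>)} \<in> events" "{\<omega> \<in> space M. ?Q k (?X \<omega>)} \<in> events"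
    "{\<omega> \<in> space M. ?Q k (flip A (?X \<omega>))} \<in> events" for k A
  proof -
    have [measurable]: "(\<lambda>\<omega>. ?V j (flip A (?X \<omega>))) \<in> borel_measurable M" for j
      unfolding flip_def using BI[of j] by (intro borel_measurable_sum) auto
    have [measurable]: "(\<lambda>\<omega>. ?U j (flip A (?X \<omega>))) \<in> borel_measurable M" for j
      unfolding flip_def by (intro borel_measurable_sum) auto
    show "{\<omega> \<in> space M. ?F k (?X \<omega>)} \<in> events" "{\<omega> \<in> space M. ?Q k (?X \<omega>)} \<in> events"
      "{\<omega> \<in> space M. ?Q k (flip A (?X \<omega>))} \<in> events" by measurable
  qed
  have step: "prob {\<omega> \<in> space M. ?F k (?X \<omega>)} \<le> 2 * prob {\<omega> \<in> space M. ?Q k (?X \<omega>)}" if k: "k < N" for k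
  proof -
    let ?A = "I - B k"
    have cov: "?Q k x \<or> ?Q k (flip ?A x)" if F: "?F k x" for x
    proof -
      have Vk: "?V k (flip ?A x) = ?V k x" by (intro sum.cong) (auto simp: flip_def)
      have Vj: "?V j (flip ?A x) = - ?V j x" if "j < k" for j
        unfolding sum_negf[symmetric] using disj[of j k] BI[of j] that k
        by (intro sum.cong) (auto simp: flip_def)
      have "?F k (flip ?A x)" using F by (auto simp: Vk Vj)
      moreover have "?U k x + ?U k (flip ?A x) = 2 * ?V k x"
      proof -
        have s: "?U k y = ?V k y + (\<Sum>i\<in>?A. b k i * y i)" for y
          using sum.subset_diff[OF BI[of k] fin, of "\<lambda>i. b k i * y i"] by simp
        have "(\<Sum>i\<in>?A. b k i * flip ?A x i) = - (\<Sum>i\<in>?A. b k i * x i)"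
          unfolding sum_negf[symmetric] by (intro sum.cong) (auto simp: flip_def)
        then show ?thesis unfolding s[of x] s[of "flip ?A x"] Vk by simp
      qed
      moreover from this F have "\<rho> < \<bar>?U k x\<bar> \<or> \<rho> < \<bar>?U k (flip ?A x)\<bar>" by arith
      ultimately show ?thesis using F by blast
    qed
    have "prob {\<omega> \<in> space M. ?F k (?X \<omega>)} \<le>
        prob ({\<omega> \<in> space M. ?Q k (?X \<omega>)} \<union> {\<omega> \<in> space M. ?Q k (flip ?A (?X \<omega>))})"
    proof (rule finite_measure_mono)
      show "{\<omega> \<in> space M. ?F k (?X \<omega>)} \<subseteq>
          {\<omega> \<in> space M. ?Q k (?X \<omega>)} \<union> {\<omega> \<in> space M. ?Q k (flip ?A (?X \<omega>))}"
      proof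
        fix \<omega> assume "\<omega> \<in> {\<omega> \<in> space M. ?F k (?X \<omega>)}"
        then show "\<omega> \<in> {\<omega> \<in> space M. ?Q k (?X \<omega>)} \<union> {\<omega> \<in> space M. ?Q k (flip ?A (?X \<omega>))}"
          using cov[of "?X \<omega>"] by simp
      qed
    qed (rule sets.Un[OF meas(2,3)])
    also have "\<dots> \<le> prob {\<omega> \<in> space M. ?Q k (?X \<omega>)} + prob {\<omega> \<in> space M. ?Q k (flip ?A (?X \<omega>))}"
      by (rule measure_Un_le[OF meas(2,3)])
    also have "prob {\<omega> \<in> space M. ?Q k (flip ?A (?X \<omega>))} = prob {\<omega> \<in> space M. ?Q k (?X \<omega>)}"
    proof (rule prob_flip[OF ind sym, where Q="?Q k"])
      show "{x \<in> space (Pi\<^sub>M I (\<lambda>_. borel)). ?Q k x} \<in> sets (Pi\<^sub>M I (\<lambda>_. borel))"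
        by measurable
      fix x :: "'i \<Rightarrow> real"
      have "?V j (restrict x I) = ?V j x" for j
        using BI[of j] by (intro sum.cong) auto
      moreover have "?U k (restrict x I) = ?U k x" by (intro sum.cong) auto
      ultimately show "?Q k (restrict x I) \<longleftrightarrow> ?Q k x" by (simp only:)
    qed
    finally show ?thesis by simp
  qed
  have disjF: "disjoint_family_on (\<lambda>k. {\<omega> \<in> space M. ?Q k (?X \<omega>)}) {..<N}"
    unfolding disjoint_family_on_def
  proof (intro ballI impI)
    fix j k :: nat assume "j \<noteq> k"
    then consider "j < k" | "k < j" by linarith
    then show "{\<omega> \<in> space M. ?Q j (?X \<omega>)} \<inter> {\<omega> \<in> space M. ?Q k (?X \<omega>)} = {}" by cases blast+
  qed
  have "prob {\<omega> \<in> space M. \<exists>k<N. \<rho> < \<bar>?V k (?X \<omega>)\<bar>} \<le> prob (\<Union>k\<in>{..<N}. {\<omega> \<in> space M. ?F k (?X \<omega>)})"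
  proof (rule finite_measure_mono)
    show "{\<omega> \<in> space M. \<exists>k<N. \<rho> < \<bar>?V k (?X \<omega>)\<bar>} \<subseteq> (\<Union>k\<in>{..<N}. {\<omega> \<in> space M. ?F k (?X \<omega>)})"
    proof clarify
      fix \<omega> k assume *: "\<omega> \<in> space M" "k < N" "\<rho> < \<bar>?V k (?X \<omega>)\<bar>"
      let ?k = "LEAST k. \<rho> < \<bar>?V k (?X \<omega>)\<bar>"
      have "?F ?k (?X \<omega>)" using LeastI[of "\<lambda>k. \<rho> < \<bar>?V k (?X \<omega>)\<bar>", OF *(3)] not_less_Least by blast
      moreover have "?k < N" using Least_le[of "\<lambda>k. \<rho> < \<bar>?V k (?X \<omega>)\<bar>", OF *(3)] *(2) by linarith
      ultimately show "\<omega> \<in> (\<Union>k\<in>{..<N}. {\<omega> \<in> space M. ?F k (?X \<omega>)})" using *(1) by blast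
    qed
  qed (rule sets.finite_UN[OF finite_lessThan meas(1)])
  also have "\<dots> \<le> (\<Sum>k<N. prob {\<omega> \<in> space M. ?F k (?X \<omega>)})"
    by (rule finite_measure_subadditive_finite[OF finite_lessThan]) (rule image_subsetI, rule meas(1))
  also have "\<dots> \<le> (\<Sum>k<N. 2 * prob {\<omega> \<in> space M. ?Q k (?X \<omega>)})"
    by (intro sum_mono step) simp
  also have "\<dots> = 2 * prob (\<Union>k\<in>{..<N}. {\<omega> \<in> space M. ?Q k (?X \<omega>)})"
    unfolding sum_distrib_left[symmetric]
      finite_measure_finite_Union[OF finite_lessThan image_subsetI[OF meas(2)] disjF] ..
  also have "\<dots> \<le> 2 * prob {\<omega> \<in> space M. \<exists>k<N. \<rho> < \<bar>?U k (?X \<omega>)\<bar>}"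
  proof (intro mult_left_mono finite_measure_mono)
    show "{\<omega> \<in> space M. \<exists>k<N. \<rho> < \<bar>?U k (?X \<omega>)\<bar>} \<in> events" by measurable
  qed (blast, simp)
  finally show ?thesis .
qed

section \<open>Passing to the limit in probabilities of events\<close>

text \<open>Fatou's lemma for events. Every passage to the limit below (Riemann sums, grids, partial sums) has
this form.\<close>

lemma (in prob_space) prob_le_of_eventually:
  assumes A: "A \<in> events" and Ar: "\<And>r. F r \<in> events"
    and ev: "AE \<omega> in M. \<omega> \<in> A \<longrightarrow> (\<forall>\<^sub>F r in sequentially. \<omega> \<in> F r)"
    and le: "\<forall>\<^sub>F r in sequentially. prob (F r) \<le> b"
  shows "prob A \<le> b"
proof -
  define B where "B m = (\<Inter>r\<in>{m..}. F r)" for m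
  have B: "B m \<in> events" for m unfolding B_def using Ar by auto
  have "incseq B" unfolding B_def incseq_def by auto
  then have "(\<lambda>m. prob (B m)) \<longlonglongrightarrow> prob (\<Union>m. B m)"
    using B by (intro finite_Lim_measure_incseq) auto
  moreover obtain m0 where m0: "\<And>r. r \<ge> m0 \<Longrightarrow> prob (F r) \<le> b" using le by (auto simp: eventually_sequentially)
  have "\<forall>\<^sub>F m in sequentially. prob (B m) \<le> b"
    unfolding eventually_sequentially
  proof (intro exI[of _ m0] allI impI)
    fix m assume "m0 \<le> m"
    have "prob (B m) \<le> prob (F m)" unfolding B_def using Ar by (intro finite_measure_mono) auto
    also have "\<dots> \<le> b" using m0 \<open>m0 \<le> m\<close> by auto
    finally show "prob (B m) \<le> b" .
  qed
  ultimately have "prob (\<Union>m. B m) \<le> b"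
    by (intro tendsto_upperbound[of "\<lambda>m. prob (B m)"]) auto
  moreover have "prob A \<le> prob (\<Union>m. B m)"
  proof (rule finite_measure_mono_AE)
    show "AE \<omega> in M. \<omega> \<in> A \<longrightarrow> \<omega> \<in> (\<Union>m. B m)"
      using ev by eventually_elim (auto simp: B_def eventually_sequentially)
  qed (use B in auto)
  ultimately show ?thesis by linarith
qed

lemma (in prob_space) conv_in_prob_unique:
  assumes conv: "conv_in_prob M Z Y" and ae: "AE \<omega> in M. (\<lambda>k. Z k \<omega>) \<longlonglongrightarrow> U \<omega>"
    and [measurable]: "\<And>k. Z k \<in> borel_measurable M" "Y \<in> borel_measurable M" "U \<in> borel_measurable M"
  shows "AE \<omega> in M. Y \<omega> = U \<omega>"
proof -
  have zero: "prob {\<omega> \<in> space M. 2 * e < \<bar>Y \<omega> - U \<omega>\<bar>} = 0" if e: "e > 0" for e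
  proof -
    have "prob {\<omega> \<in> space M. 2 * e < \<bar>Y \<omega> - U \<omega>\<bar>} \<le> d" if d: "d > 0" for d
    proof (rule prob_le_of_eventually)
      show "AE \<omega> in M. \<omega> \<in> {\<omega> \<in> space M. 2 * e < \<bar>Y \<omega> - U \<omega>\<bar>} \<longrightarrow>
         (\<forall>\<^sub>F k in sequentially. \<omega> \<in> {\<omega> \<in> space M. e < \<bar>Z k \<omega> - Y \<omega>\<bar>})"
        using ae
      proof eventually_elim
        case (elim \<omega>)
        show ?case
        proof
          assume *: "\<omega> \<in> {\<omega> \<in> space M. 2 * e < \<bar>Y \<omega> - U \<omega>\<bar>}"
          then have "2 * e < \<bar>Y \<omega> - U \<omega>\<bar>" by simp
          then have "e < \<bar>Z k \<omega> - Y \<omega>\<bar>" if "dist (Z k \<omega>) (U \<omega>) < e" for k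
            using that unfolding dist_real_def by arith
          then show "\<forall>\<^sub>F k in sequentially. \<omega> \<in> {\<omega> \<in> space M. e < \<bar>Z k \<omega> - Y \<omega>\<bar>}"
            using tendstoD[OF elim e] * by (auto elim: eventually_mono)
        qed
      qed
      have "(\<lambda>k. prob {\<omega> \<in> space M. e < \<bar>Z k \<omega> - Y \<omega>\<bar>}) \<longlonglongrightarrow> 0"
        using conv e by (auto simp: conv_in_prob_def)
      from order_tendstoD(2)[OF this d]
      show "\<forall>\<^sub>F k in sequentially. prob {\<omega> \<in> space M. e < \<bar>Z k \<omega> - Y \<omega>\<bar>} \<le> d"
        by (rule eventually_mono) simp
    qed (measurable; fail)+
    then have "prob {\<omega> \<in> space M. 2 * e < \<bar>Y \<omega> - U \<omega>\<bar>} \<le> 0" by (rule dense_ge)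
    then show ?thesis by (rule antisym) (rule measure_nonneg)
  qed
  have "AE \<omega> in M. \<not> 2 * (1 / real (Suc j)) < \<bar>Y \<omega> - U \<omega>\<bar>" for j
    using zero[of "1 / real (Suc j)"]
    by (intro AE_I'[of "{\<omega> \<in> space M. 2 * (1 / real (Suc j)) < \<bar>Y \<omega> - U \<omega>\<bar>}"])
      (auto simp: null_sets_def emeasure_eq_measure)
  then have "AE \<omega> in M. \<forall>j. \<not> 2 * (1 / real (Suc j)) < \<bar>Y \<omega> - U \<omega>\<bar>" by (simp add: AE_all_countable)
  then show ?thesis
  proof eventually_elim
    case (elim \<omega>)
    have "(\<lambda>j. 2 * (1 / real (Suc j))) \<longlonglongrightarrow> 2 * 0"
      using LIMSEQ_inverse_real_of_nat by (intro tendsto_intros) (simp add: inverse_eq_divide)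
    then have "\<bar>Y \<omega> - U \<omega>\<bar> \<le> 2 * 0"
      by (rule LIMSEQ_le_const) (use elim in \<open>auto simp: not_less\<close>)
    then show ?case by simp
  qed
qed

section \<open>Increments of the driving processes and regular versions of the coordinates\<close>

lemma (in prob_space) indep_vars_Sigma:
  fixes \<xi> :: "'i \<Rightarrow> 'j \<Rightarrow> 'a \<Rightarrow> real"
  assumes fin: "finite A" "finite B"
    and outer: "indep_vars (\<lambda>_. Pi\<^sub>M B (\<lambda>_. borel)) (\<lambda>n \<omega>. \<lambda>i\<in>B. \<xi> n i \<omega>) A"
    and inner: "\<And>n. n \<in> A \<Longrightarrow> indep_vars (\<lambda>_. borel) (\<xi> n) B"
  shows "indep_vars (\<lambda>_. borel) (\<lambda>p. \<xi> (fst p) (snd p)) (A \<times> B)"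
proof (cases "A \<times> B = {}")
  case True
  then show ?thesis unfolding indep_vars_def indep_sets_def by auto
next
  case False
  then have ne: "A \<noteq> {}" "B \<noteq> {}" by auto
  have rv: "\<xi> n i \<in> borel_measurable M" if "n \<in> A" "i \<in> B" for n i
    using inner[OF that(1)] that(2) by (auto simp: indep_vars_def)
  have *: "prob (\<Inter>p\<in>A \<times> B. \<xi> (fst p) (snd p) -` S p \<inter> space M) =
      (\<Prod>p\<in>A \<times> B. prob (\<xi> (fst p) (snd p) -` S p \<inter> space M))"
    if S: "S \<in> (\<Pi> p\<in>A \<times> B. sets borel)" for S
  proof -
    have S': "S (n, i) \<in> sets borel" if "n \<in> A" "i \<in> B" for n i using S that by auto
    let ?W = "\<lambda>n \<omega>. \<lambda>i\<in>B. \<xi> n i \<omega>"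
    have pre: "?W n -` (\<Pi>\<^sub>E i\<in>B. S (n, i)) \<inter> space M = (\<Inter>i\<in>B. \<xi> n i -` S (n, i) \<inter> space M)" for n
      using ne by auto
    have "(\<Inter>p\<in>A \<times> B. \<xi> (fst p) (snd p) -` S p \<inter> space M) =
        (\<Inter>n\<in>A. ?W n -` (\<Pi>\<^sub>E i\<in>B. S (n, i)) \<inter> space M)"
      unfolding pre using ne by auto
    also have "prob \<dots> = (\<Prod>n\<in>A. prob (?W n -` (\<Pi>\<^sub>E i\<in>B. S (n, i)) \<inter> space M))"
      using fin ne S' by (intro indep_varsD_finite[OF outer] sets_PiM_I_finite) auto
    also have "\<dots> = (\<Prod>n\<in>A. \<Prod>i\<in>B. prob (\<xi> n i -` S (n, i) \<inter> space M))"
      unfolding pre using fin ne S' by (intro prod.cong refl indep_varsD_finite[OF inner]) auto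
    also have "\<dots> = (\<Prod>p\<in>A \<times> B. prob (\<xi> (fst p) (snd p) -` S p \<inter> space M))"
      by (simp add: prod.cartesian_product case_prod_beta)
    finally show ?thesis .
  qed
  have "(indep_vars (\<lambda>_. borel) (\<lambda>p. \<xi> (fst p) (snd p)) (A \<times> B)) =
    (\<forall>S\<in>(\<Pi> p\<in>A \<times> B. sets borel). prob (\<Inter>p\<in>A \<times> B. \<xi> (fst p) (snd p) -` S p \<inter> space M) =
      (\<Prod>p\<in>A \<times> B. prob (\<xi> (fst p) (snd p) -` S p \<inter> space M)))"
  proof (rule indep_vars_finite)
    show "A \<times> B \<noteq> {}" by fact
    show "finite (A \<times> B)" using fin by simp
    show "sets (borel :: real measure) = sigma_sets (space borel) (sets borel)" by (metis sets.sigma_sets_eq)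
    show "Int_stable (sets (borel :: real measure))" by (auto simp: Int_stable_def)
  qed (use rv in auto)
  then show ?thesis using * by blast
qed

text \<open>The hypotheses on the driving noise; the Hilbert space enters only through the coefficients of a fixed
vector.\<close>

locale stable_ou = prob_space M for M :: "'a measure" +
  fixes \<alpha> :: real and \<gamma> \<sigma> :: "nat \<Rightarrow> real" and L X :: "nat \<Rightarrow> real \<Rightarrow> 'a \<Rightarrow> real"
  assumes \<alpha>: "0 < \<alpha>" "\<alpha> < 2"
    and \<gamma>: "\<And>n. 0 < \<gamma> n" and \<sigma>: "\<And>n. 0 \<le> \<sigma> n"
    and L: "\<And>n. std_sym_stable_levy \<alpha> M (L n)"
    and indep_L: "indep_processes M L"
    and X: "\<And>n t. t \<in> {0..1} \<Longrightarrow>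
           is_stoch_integral M (L n) (\<lambda>s. exp (- \<gamma> n * (t - s)) * \<sigma> n) t (X n t)"
    and sum_\<sigma>: "summable (\<lambda>n. \<sigma> n powr \<alpha> / (1 + \<gamma> n))"
begin

definition incr :: "nat \<Rightarrow> real \<Rightarrow> nat \<Rightarrow> 'a \<Rightarrow> real" where
  "incr n h i \<omega> = L n (real (Suc i) * h) \<omega> - L n (real i * h) \<omega>"

lemma L_measurable: "0 \<le> t \<Longrightarrow> L n t \<in> borel_measurable M"
  using L[of n] by (auto simp: std_sym_stable_levy_def levy_process_def cadlag_process_def)

lemma incr_measurable: "0 \<le> h \<Longrightarrow> incr n h i \<in> borel_measurable M"
  unfolding incr_def[abs_def] by (intro borel_measurable_diff L_measurable) auto

lemma X_measurable: "t \<in> {0..1} \<Longrightarrow> X n t \<in> borel_measurable M"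
  using X by (auto simp: is_stoch_integral_def)

lemma incr_stable:
  assumes "0 \<le> h" shows "sym_stable M \<alpha> h (incr n h i)"
proof -
  have "distr M borel (\<lambda>\<omega>. L n (real i * h + h) \<omega> - L n (real i * h) \<omega>) = distr M borel (L n h)"
    using L[of n] assms by (auto simp: std_sym_stable_levy_def levy_process_def)
  then have "distr M borel (incr n h i) = distr M borel (L n h)"
    by (simp add: incr_def[abs_def] algebra_simps)
  then show ?thesis
    using L[of n] assms incr_measurable[OF assms] by (auto simp: sym_stable_def std_sym_stable_levy_def)
qed

lemma indep_incr_single:
  assumes h: "0 \<le> h" shows "indep_vars (\<lambda>_. borel) (incr n h) {..<R}"
proof -
  have "\<forall>i<R. real i * h \<le> real (Suc i) * h" using h by (auto intro: mult_right_mono)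
  then show ?thesis
    using L[of n] unfolding std_sym_stable_levy_def levy_process_def incr_def[abs_def]
    by (auto dest!: spec[of _ "\<lambda>i. real i * h"])
qed

lemma indep_incr:
  assumes h: "0 \<le> h" and A: "finite A"
  shows "indep_vars (\<lambda>_. borel) (\<lambda>p. incr (fst p) h (snd p)) (A \<times> {..<R})"
proof (rule indep_vars_Sigma)
  let ?g = "\<lambda>x. \<lambda>i\<in>{..<R}. x (real (Suc i) * h) - x (real i * h) :: real"
  have "indep_vars (\<lambda>_. Pi\<^sub>M {0..} (\<lambda>_. borel)) (\<lambda>n \<omega>. \<lambda>t\<in>{0..}. L n t \<omega>) A"
    using indep_L unfolding indep_processes_def by (rule indep_vars_subset) auto
  then have "indep_vars (\<lambda>_. Pi\<^sub>M {..<R} (\<lambda>_. borel)) (\<lambda>n \<omega>. ?g (\<lambda>t\<in>{0..}. L n t \<omega>)) A"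
  proof (rule indep_vars_compose2)
    show "?g \<in> measurable (Pi\<^sub>M {0..} (\<lambda>_. borel)) (Pi\<^sub>M {..<R} (\<lambda>_. borel))"
      using h by (intro measurable_restrict borel_measurable_diff measurable_component_singleton) auto
  qed
  then show "indep_vars (\<lambda>_. Pi\<^sub>M {..<R} (\<lambda>_. borel)) (\<lambda>n \<omega>. \<lambda>i\<in>{..<R}. incr n h i \<omega>) A"
    using h by (simp add: incr_def cong: restrict_cong)
  show "indep_vars (\<lambda>_. borel) (incr n h) {..<R}" for n by (rule indep_incr_single[OF h])
qed (use A in auto)

text \<open>An arbitrary measurable null set outside which the path is cadlag and starts at 0. The set of
irregular paths itself need not be measurable.\<close>

definition bad :: "nat \<Rightarrow> 'a set" where
  "bad n = (SOME N. N \<in> null_sets M \<and>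
     {\<omega> \<in> space M. \<not> (cadlag_on {0..} (\<lambda>t. L n t \<omega>) \<and> L n 0 \<omega> = 0)} \<subseteq> N)"

lemma bad: "bad n \<in> null_sets M"
  "\<omega> \<in> space M \<Longrightarrow> \<omega> \<notin> bad n \<Longrightarrow> cadlag_on {0..} (\<lambda>t. L n t \<omega>) \<and> L n 0 \<omega> = 0"
proof -
  have "AE \<omega> in M. cadlag_on {0..} (\<lambda>t. L n t \<omega>) \<and> L n 0 \<omega> = 0"
    using L[of n] by (auto simp: std_sym_stable_levy_def levy_process_def cadlag_process_def)
  then have "\<exists>N. N \<in> null_sets M \<and>
     {\<omega> \<in> space M. \<not> (cadlag_on {0..} (\<lambda>t. L n t \<omega>) \<and> L n 0 \<omega> = 0)} \<subseteq> N"
    by (auto simp: eventually_ae_filter)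
  note N = someI_ex[OF this, folded bad_def]
  from N show "bad n \<in> null_sets M"
    "\<omega> \<in> space M \<Longrightarrow> \<omega> \<notin> bad n \<Longrightarrow> cadlag_on {0..} (\<lambda>t. L n t \<omega>) \<and> L n 0 \<omega> = 0"
    by blast+
qed

text \<open>A version of the coordinate process all of whose paths are cadlag.\<close>

definition Xc :: "nat \<Rightarrow> real \<Rightarrow> 'a \<Rightarrow> real" where
  "Xc n t \<omega> = (if \<omega> \<in> bad n then 0 else \<sigma> n * ou_path (\<gamma> n) (\<lambda>s. L n s \<omega>) t)"

lemma cadlag_Xc: "\<omega> \<in> space M \<Longrightarrow> cadlag_on {0..1} (\<lambda>t. Xc n t \<omega>)"
  unfolding Xc_def using bad(2)[of \<omega> n]
  by (cases "\<omega> \<in> bad n") (auto intro!: cadlag_on_mult cadlag_on_const cadlag_on_ou_path)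

definition Xsum :: "nat \<Rightarrow> real \<Rightarrow> nat \<Rightarrow> 'a \<Rightarrow> real" where
  "Xsum n h J \<omega> = \<sigma> n * ou_sum (\<gamma> n) (\<lambda>s. L n s \<omega>) h J"

lemma Xsum_incr: "Xsum n h J \<omega> = (\<Sum>i<J. \<sigma> n * exp (- \<gamma> n * (real (J - i) * h)) * incr n h i \<omega>)"
  by (simp add: Xsum_def ou_sum_def incr_def sum_distrib_left mult.assoc)

lemma Xsum_measurable: "0 \<le> h \<Longrightarrow> Xsum n h J \<in> borel_measurable M"
  unfolding Xsum_incr[abs_def]
  by (intro borel_measurable_sum borel_measurable_times incr_measurable) auto

lemma Xsum_tendsto:
  assumes "\<omega> \<in> space M" "\<omega> \<notin> bad n" "0 \<le> t"
    and "\<And>r. 0 < h r" "h \<longlonglongrightarrow> 0" "\<And>r. real (J r) * h r = t"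
  shows "(\<lambda>r. Xsum n (h r) (J r) \<omega>) \<longlonglongrightarrow> Xc n t \<omega>"
  unfolding Xsum_def Xc_def using bad(2)[OF assms(1,2)] assms
  by (auto intro!: tendsto_mult ou_sum_tendsto)

lemma exists_uniform_mesh:
  fixes t :: real
  assumes "0 \<le> t"
  obtains h :: "nat \<Rightarrow> real" and J :: "nat \<Rightarrow> nat"
  where "\<And>r. 0 < h r" "h \<longlonglongrightarrow> 0" "\<And>r. real (J r) * h r = t"
proof (cases "t = 0")
  case True
  show thesis
    by (rule that[of "\<lambda>r. 1 / real (Suc r)" "\<lambda>r. 0"])
      (use True LIMSEQ_inverse_real_of_nat in \<open>auto simp: inverse_eq_divide\<close>)
next
  case False
  have "(\<lambda>r. t * inverse (real (Suc r))) \<longlonglongrightarrow> t * 0"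
    by (intro tendsto_intros LIMSEQ_inverse_real_of_nat)
  then show thesis
    by (intro that[of "\<lambda>r. t * inverse (real (Suc r))" "\<lambda>r. Suc r"])
      (use False assms in \<open>auto simp: field_simps\<close>)
qed

lemma AE_not_bad: "AE \<omega> in M. \<forall>n. \<omega> \<notin> bad n"
  unfolding AE_all_countable using bad(1) by (auto intro: AE_not_in)

lemma Xc_measurable:
  assumes "0 \<le> t" shows "Xc n t \<in> borel_measurable M"
proof -
  obtain h J where hJ: "\<And>r. 0 < h r" "h \<longlonglongrightarrow> (0::real)" "\<And>r. real (J r) * h r = t"
    using exists_uniform_mesh[OF assms] by blast
  have [measurable]: "bad n \<in> sets M" using bad(1) by auto
  have [measurable]: "Xsum n (h r) (J r) \<in> borel_measurable M" for r
    using hJ(1)[of r] by (intro Xsum_measurable) auto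
  show ?thesis
  proof (rule borel_measurable_LIMSEQ_real)
    fix \<omega> assume "\<omega> \<in> space M"
    then show "(\<lambda>r. if \<omega> \<in> bad n then 0 else Xsum n (h r) (J r) \<omega>) \<longlonglongrightarrow> Xc n t \<omega>"
      using Xsum_tendsto[OF _ _ assms hJ, of \<omega> n] by (cases "\<omega> \<in> bad n") (auto simp: Xc_def)
  qed measurable
qed

text \<open>The Riemann sums converge to \<open>X n t\<close> in probability by assumption and to \<open>Xc n t\<close> almost surely by the
pathwise argument.\<close>

lemma AE_X_eq_Xc:
  assumes t: "t \<in> {0..1}" shows "AE \<omega> in M. X n t \<omega> = Xc n t \<omega>"
proof -
  obtain h J where hJ: "\<And>r. 0 < h r" "h \<longlonglongrightarrow> (0::real)" "\<And>r. real (J r) * h r = t"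
    using exists_uniform_mesh[of t] t by auto
  have "vanishing_mesh_partitions t J (\<lambda>r i. real i * h r)"
    unfolding vanishing_mesh_partitions_def
  proof (intro conjI allI impI)
    fix d :: real assume "0 < d"
    from order_tendstoD(2)[OF hJ(2) this]
    show "\<forall>\<^sub>F k in sequentially. \<forall>i<J k. real (Suc i) * h k - real i * h k < d"
      by (rule eventually_mono) (auto simp: algebra_simps)
  qed (use hJ in \<open>auto intro!: mult_right_mono simp: less_imp_le\<close>)
  then have "conv_in_prob M (\<lambda>k \<omega>. \<Sum>i<J k. exp (- \<gamma> n * (t - real i * h k)) * \<sigma> n *
      (L n (real (Suc i) * h k) \<omega> - L n (real i * h k) \<omega>)) (X n t)"
    using X[OF t, of n] unfolding is_stoch_integral_def by blast
  also have "(\<lambda>k \<omega>. \<Sum>i<J k. exp (- \<gamma> n * (t - real i * h k)) * \<sigma> n *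
      (L n (real (Suc i) * h k) \<omega> - L n (real i * h k) \<omega>)) = (\<lambda>k. Xsum n (h k) (J k))"
  proof -
    have "t - real i * h k = real (J k - i) * h k" if "i < J k" for i k
      using hJ(3)[of k] that by (simp add: of_nat_diff left_diff_distrib)
    then show ?thesis
      unfolding Xsum_incr[abs_def] incr_def by (intro ext sum.cong refl) (simp add: mult.commute)
  qed
  finally have c: "conv_in_prob M (\<lambda>k. Xsum n (h k) (J k)) (X n t)" .
  show ?thesis
  proof (rule conv_in_prob_unique[OF c])
    show "AE \<omega> in M. (\<lambda>k. Xsum n (h k) (J k) \<omega>) \<longlonglongrightarrow> Xc n t \<omega>"
      using AE_not_bad AE_space
      by eventually_elim (use t in \<open>auto intro!: Xsum_tendsto hJ\<close>)
    show "Xsum n (h k) (J k) \<in> borel_measurable M" for k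
      using hJ(1)[of k] by (intro Xsum_measurable) auto
  qed (use t X_measurable Xc_measurable in auto)
qed

end

section \<open>A maximal inequality uniform in the decay rates\<close>

text \<open>As a function of \<open>k\<close>, the kernel \<open>f\<close> of an impulse at time \<open>i\<close> jumps from 0 to a value of at most 1 and then
decreases. The function \<open>v\<close> has at least the same variation and stays between 0 and 2, no matter how
fast \<open>E\<close> decays.\<close>

lemma ou_kernel_increment:
  fixes E :: "nat \<Rightarrow> real" and i :: nat
  assumes E: "\<And>k. 0 \<le> E k" "\<And>k. E k \<le> 1" "\<And>k l. l \<le> k \<Longrightarrow> E k \<le> E l" and lk: "l \<le> k"
  defines "f \<equiv> \<lambda>k. if i < k then E k else 0"
    and "v \<equiv> \<lambda>k. if i < k then 2 - E k else 0"
  shows "(f k - f l)\<^sup>2 \<le> v k - v l" and "v l \<le> v k"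
proof -
  have sq: "x\<^sup>2 \<le> x" if "0 \<le> x" "x \<le> 1" for x :: real
    using that mult_left_le[of x x] by (simp add: power2_eq_square)
  consider "i < l" | "l \<le> i" "i < k" | "k \<le> i" by linarith
  then show "(f k - f l)\<^sup>2 \<le> v k - v l"
  proof cases
    case 1
    have "(E l - E k)\<^sup>2 \<le> E l - E k"
      using E(1)[of k] E(2)[of l] E(3)[OF lk] by (intro sq) linarith+
    then show ?thesis using 1 lk by (simp add: f_def v_def power2_commute)
  next
    case 2
    have "(E k)\<^sup>2 \<le> E k" by (intro sq E)
    also have "E k \<le> 2 - E k" using E(2)[of k] by linarith
    finally show ?thesis using 2 by (simp add: f_def v_def)
  next
    case 3
    then show ?thesis using lk by (simp add: f_def v_def)
  qed
  show "v l \<le> v k" using E(2)[of k] E(3)[OF lk] lk by (auto simp: v_def)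
qed

context stable_ou
begin

definition maximal_bound :: "(nat \<Rightarrow> real) \<Rightarrow> nat set \<Rightarrow> real \<Rightarrow> real \<Rightarrow> real" where
  "maximal_bound z A \<eta> \<rho> =
     3 * normal_moment \<alpha> * (\<Sum>n\<in>A. \<bar>z n * \<sigma> n\<bar> powr \<alpha>) / \<eta> powr \<alpha> + 19200 * (\<eta> / \<rho>) ^ 4"

text \<open>The maximal inequality for Riemann sums on the grid of mesh \<open>1 / N\<close>. Each of the \<open>N\<close> increments has
parameter \<open>1 / N\<close>, so these parameters add up to 1 for each coordinate, and the bound does not depend
on \<open>N\<close>.\<close>

lemma grid_maximal_inequality:
  assumes A: "finite A" and N: "0 < N" and pos: "\<rho> > 0" "\<eta> > 0"
  shows "prob {\<omega> \<in> space M. \<exists>k\<le>N. \<rho> < \<bar>\<Sum>n\<in>A. z n * Xsum n (1 / real N) k \<omega>\<bar>} \<le> maximal_bound z A \<eta> \<rho>"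
proof -
  define h where "h = 1 / real N"
  have h: "0 < h" "real N * h = 1" using N by (auto simp: h_def)
  define I where "I = A \<times> {..<N}"
  define \<xi> where "\<xi> p = incr (fst p) h (snd p)" for p
  define E where "E n i k = exp (- \<gamma> n * (real (k - i) * h))" for n i k :: nat
  define w where "w p = z (fst p) * \<sigma> (fst p)" for p :: "nat \<times> nat"
  define f where "f k p = (if snd p < k then E (fst p) (snd p) k else 0)" for k p
  define v where "v k p = (if snd p < k then 2 - E (fst p) (snd p) k else 0)" for k p
  have fin: "finite I" using A by (simp add: I_def)
  have st: "sym_stable M \<alpha> h (\<xi> p)" for p
    unfolding \<xi>_def using h by (intro incr_stable) simp
  have E: "0 \<le> E n i k" "E n i k \<le> 1" "l \<le> k \<Longrightarrow> E n i k \<le> E n i l" for n i k l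
    using \<gamma>[of n] h by (auto simp: E_def intro!: mult_left_mono mult_right_mono)
  have fv: "(f k p - f l p)\<^sup>2 \<le> v k p - v l p" "v l p \<le> v k p" if "l \<le> k" for k l p
    using ou_kernel_increment[where E="E (fst p) (snd p)" and i="snd p", OF E(1) E(2) E(3) that]
    unfolding f_def v_def by simp_all
  have eq: "(\<Sum>n\<in>A. z n * Xsum n h k \<omega>) = (\<Sum>p\<in>I. w p * f k p * \<xi> p \<omega>)" if k: "k \<le> N" for k \<omega>
  proof -
    have "(\<Sum>n\<in>A. z n * Xsum n h k \<omega>) = (\<Sum>n\<in>A. \<Sum>i<N. w (n, i) * f k (n, i) * \<xi> (n, i) \<omega>)"
    proof (rule sum.cong[OF refl])
      fix n
      have "z n * Xsum n h k \<omega> = (\<Sum>i<k. w (n, i) * f k (n, i) * \<xi> (n, i) \<omega>)"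
        unfolding Xsum_incr sum_distrib_left
        by (intro sum.cong) (auto simp: w_def f_def \<xi>_def E_def)
      also have "\<dots> = (\<Sum>i<N. w (n, i) * f k (n, i) * \<xi> (n, i) \<omega>)"
        using k by (intro sum.mono_neutral_left) (auto simp: f_def)
      finally show "z n * Xsum n h k \<omega> = \<dots>" .
    qed
    then show ?thesis by (simp add: I_def sum.cartesian_product)
  qed
  have "prob {\<omega> \<in> space M. \<exists>k\<le>N. \<rho> < \<bar>\<Sum>n\<in>A. z n * Xsum n h k \<omega>\<bar>} =
      prob {\<omega> \<in> space M. \<exists>k\<le>N. \<rho> < \<bar>\<Sum>p\<in>I. w p * f k p * \<xi> p \<omega>\<bar>}"
    by (intro arg_cong[where f=prob] Collect_cong) (auto simp: eq)
  also have "\<dots> \<le> prob {\<omega> \<in> space M. \<eta>\<^sup>2 < (\<Sum>p\<in>I. (w p * \<xi> p \<omega>)\<^sup>2)} + 19200 * (\<eta> / \<rho>) ^ 4"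
  proof (rule prob_max_linear_le[OF fin])
    show "indep_vars (\<lambda>_. borel) \<xi> I"
      unfolding I_def \<xi>_def[abs_def] using h A by (intro indep_incr) auto
    show "distr M borel (\<lambda>\<omega>. - \<xi> p \<omega>) = distr M borel (\<xi> p)" for p
      using st by (rule sym_stable_symmetric)
    show "(w p * f k p - w p * f l p)\<^sup>2 \<le> (w p)\<^sup>2 * (v k p - v l p)" if "l \<le> k" for p l k
      unfolding right_diff_distrib[symmetric] power_mult_distrib
      using fv(1)[OF that] by (intro mult_left_mono) auto
    show "v N p - v 0 p \<le> 2" for p using E(1) by (auto simp: v_def)
  qed (use pos fv in \<open>auto simp: f_def\<close>)
  also have "prob {\<omega> \<in> space M. \<eta>\<^sup>2 < (\<Sum>p\<in>I. (w p * \<xi> p \<omega>)\<^sup>2)} \<le>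
      3 * normal_moment \<alpha> * (\<Sum>p\<in>I. h * \<bar>w p\<bar> powr \<alpha>) / \<eta> powr \<alpha>"
    using fin \<alpha> pos by (intro prob_square_sum_le st) auto
  also have "(\<Sum>p\<in>I. h * \<bar>w p\<bar> powr \<alpha>) = (\<Sum>n\<in>A. \<Sum>i<N. h * \<bar>z n * \<sigma> n\<bar> powr \<alpha>)"
    by (simp only: I_def w_def sum.cartesian_product case_prod_unfold)
  also have "\<dots> = (\<Sum>n\<in>A. (real N * h) * \<bar>z n * \<sigma> n\<bar> powr \<alpha>)"
    by (simp add: mult.assoc)
  finally show ?thesis unfolding h(2) by (simp add: maximal_bound_def h_def)
qed

definition Xlin :: "(nat \<Rightarrow> real) \<Rightarrow> nat set \<Rightarrow> real \<Rightarrow> 'a \<Rightarrow> real" where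
  "Xlin z A t \<omega> = (\<Sum>n\<in>A. z n * Xc n t \<omega>)"

lemma Xlin_measurable: "0 \<le> t \<Longrightarrow> Xlin z A t \<in> borel_measurable M"
  unfolding Xlin_def[abs_def] by (intro borel_measurable_sum borel_measurable_times Xc_measurable) auto

lemma cadlag_Xlin: "\<omega> \<in> space M \<Longrightarrow> cadlag_on {0..1} (\<lambda>t. Xlin z A t \<omega>)"
  unfolding Xlin_def by (intro cadlag_on_sum cadlag_on_mult cadlag_on_const cadlag_Xc)

text \<open>Every cell of the grid of mesh \<open>1 / N\<close> is subdivided into \<open>Suc r\<close> cells, which keeps the coarse grid
points inside all the fine grids.\<close>

lemma Xlin_Riemann_tendsto:
  assumes "0 < N"
  shows "AE \<omega> in M. \<forall>k. (\<lambda>r. \<Sum>n\<in>A. z n * Xsum n (1 / real (N * Suc r)) (k * Suc r) \<omega>)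
     \<longlonglongrightarrow> Xlin z A (real k / real N) \<omega>"
  using AE_not_bad AE_space
proof eventually_elim
  case (elim \<omega>)
  have "(\<lambda>r. 1 / real N * inverse (real (Suc r))) \<longlonglongrightarrow> 1 / real N * 0"
    by (intro tendsto_intros LIMSEQ_inverse_real_of_nat)
  moreover have "1 / real (N * Suc r) = 1 / real N * inverse (real (Suc r))" for r
    by (simp only: of_nat_mult divide_inverse inverse_mult_distrib mult_1_left)
  ultimately have lim: "(\<lambda>r. 1 / real (N * Suc r)) \<longlonglongrightarrow> 0" by simp
  have "0 < N * Suc r" for r using assms by simp
  then have pos: "0 < 1 / real (N * Suc r)" for r by (simp only: zero_less_divide_1_iff of_nat_0_less_iff)
  have J: "real (k * Suc r) * (1 / real (N * Suc r)) = real k / real N" for k r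
    by (simp only: of_nat_mult times_divide_eq_right mult_1_right) (rule mult_divide_mult_cancel_right, simp)
  show ?case unfolding Xlin_def
    using elim by (intro allI tendsto_intros Xsum_tendsto lim pos J) auto
qed

text \<open>The values on a coarse grid are limits of Riemann sums over refined grids, and for all of those
\<open>grid_maximal_inequality\<close> gives the same bound.\<close>

lemma maximal_inequality_coarse:
  assumes A: "finite A" and N: "0 < N" and pos: "\<rho> > 0" "\<eta> > 0"
  shows "prob {\<omega> \<in> space M. \<exists>k\<le>N. \<rho> < \<bar>Xlin z A (real k / real N) \<omega>\<bar>} \<le> maximal_bound z A \<eta> \<rho>"
proof (rule prob_le_of_eventually)
  let ?F = "\<lambda>r. {\<omega> \<in> space M. \<exists>k\<le>N * Suc r. \<rho> < \<bar>\<Sum>n\<in>A. z n * Xsum n (1 / real (N * Suc r)) k \<omega>\<bar>}"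
  have [measurable]: "Xlin z A (real k / real N) \<in> borel_measurable M" for k
    by (rule Xlin_measurable) simp
  have [measurable]: "Xsum n (1 / real (N * Suc r)) k \<in> borel_measurable M" for n r k
    by (rule Xsum_measurable) simp
  show "{\<omega> \<in> space M. \<exists>k\<le>N. \<rho> < \<bar>Xlin z A (real k / real N) \<omega>\<bar>} \<in> events" by measurable
  show "?F r \<in> events" for r by measurable
  have "prob (?F r) \<le> maximal_bound z A \<eta> \<rho>" for r
    using N by (intro grid_maximal_inequality[OF A _ pos]) auto
  then show "\<forall>\<^sub>F r in sequentially. prob (?F r) \<le> maximal_bound z A \<eta> \<rho>"
    by (intro always_eventually allI)
  show "AE \<omega> in M. \<omega> \<in> {\<omega> \<in> space M. \<exists>k\<le>N. \<rho> < \<bar>Xlin z A (real k / real N) \<omega>\<bar>} \<longrightarrow>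
      (\<forall>\<^sub>F r in sequentially. \<omega> \<in> ?F r)"
    using Xlin_Riemann_tendsto[OF N, of z A]
  proof eventually_elim
    case (elim \<omega>)
    show ?case
    proof
      assume "\<omega> \<in> {\<omega> \<in> space M. \<exists>k\<le>N. \<rho> < \<bar>Xlin z A (real k / real N) \<omega>\<bar>}"
      then obtain k where k: "\<omega> \<in> space M" "k \<le> N" "\<rho> < \<bar>Xlin z A (real k / real N) \<omega>\<bar>" by auto
      from order_tendstoD(1)[OF tendsto_rabs[OF elim[rule_format, of k]] k(3)]
      show "\<forall>\<^sub>F r in sequentially. \<omega> \<in> ?F r"
      proof (rule eventually_mono)
        fix r assume "\<rho> < \<bar>\<Sum>n\<in>A. z n * Xsum n (1 / real (N * Suc r)) (k * Suc r) \<omega>\<bar>"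
        moreover have "k * Suc r \<le> N * Suc r" using k(2) by (rule mult_le_mono1)
        ultimately show "\<omega> \<in> ?F r" using k(1) by blast
      qed
    qed
  qed
qed

lemma event_exceeds: "{\<omega> \<in> space M. \<exists>t\<in>dyadic_points. \<rho> < \<bar>Xlin z A t \<omega>\<bar>} \<in> events"
proof -
  have "{\<omega> \<in> space M. \<exists>t\<in>dyadic_points. \<rho> < \<bar>Xlin z A t \<omega>\<bar>} =
     (\<Union>t\<in>dyadic_points. {\<omega> \<in> space M. \<rho> < \<bar>Xlin z A t \<omega>\<bar>})" by auto
  moreover have "{\<omega> \<in> space M. \<rho> < \<bar>Xlin z A t \<omega>\<bar>} \<in> events" if "t \<in> dyadic_points" for t
  proof -
    have [measurable]: "Xlin z A t \<in> borel_measurable M"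
      using dyadic_points_subset that by (intro Xlin_measurable) auto
    show ?thesis by measurable
  qed
  ultimately show ?thesis using countable_dyadic_points by (auto intro!: sets.countable_UN'')
qed

lemma maximal_inequality:
  assumes A: "finite A" and pos: "\<rho> > 0" "\<eta> > 0"
  shows "prob {\<omega> \<in> space M. \<exists>t\<in>dyadic_points. \<rho> < \<bar>Xlin z A t \<omega>\<bar>} \<le> maximal_bound z A \<eta> \<rho>"
proof (rule prob_le_of_eventually)
  let ?F = "\<lambda>m. {\<omega> \<in> space M. \<exists>k\<le>2 ^ m. \<rho> < \<bar>Xlin z A (real k / real (2 ^ m)) \<omega>\<bar>}"
  have [measurable]: "Xlin z A (real k / real N) \<in> borel_measurable M" for k N
    by (rule Xlin_measurable) simp
  show "{\<omega> \<in> space M. \<exists>t\<in>dyadic_points. \<rho> < \<bar>Xlin z A t \<omega>\<bar>} \<in> events"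
    by (rule event_exceeds)
  show "?F m \<in> events" for m by measurable
  have "prob (?F m) \<le> maximal_bound z A \<eta> \<rho>" for m
    by (intro maximal_inequality_coarse[OF A _ pos]) auto
  then show "\<forall>\<^sub>F m in sequentially. prob (?F m) \<le> maximal_bound z A \<eta> \<rho>"
    by (intro always_eventually allI)
  show "AE \<omega> in M. \<omega> \<in> {\<omega> \<in> space M. \<exists>t\<in>dyadic_points. \<rho> < \<bar>Xlin z A t \<omega>\<bar>} \<longrightarrow>
      (\<forall>\<^sub>F m in sequentially. \<omega> \<in> ?F m)"
  proof (rule AE_I2, rule impI)
    fix \<omega> assume "\<omega> \<in> {\<omega> \<in> space M. \<exists>t\<in>dyadic_points. \<rho> < \<bar>Xlin z A t \<omega>\<bar>}"
    then obtain m0 k where k: "\<omega> \<in> space M" "k \<le> 2 ^ m0" "\<rho> < \<bar>Xlin z A (real k / 2 ^ m0) \<omega>\<bar>"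
      by (auto simp: dyadic_points_def)
    have "\<omega> \<in> ?F m" if "m0 \<le> m" for m
    proof -
      have p: "(2::nat) ^ m = 2 ^ m0 * 2 ^ (m - m0)" using that by (simp flip: power_add)
      have "real k / 2 ^ m0 = real (k * 2 ^ (m - m0)) / real (2 ^ m)"
        unfolding p by simp
      moreover have "k * 2 ^ (m - m0) \<le> 2 ^ m" unfolding p using k(2) by (rule mult_le_mono1)
      ultimately show ?thesis using k by (auto intro!: exI[of _ "k * 2 ^ (m - m0)"])
    qed
    then show "\<forall>\<^sub>F m in sequentially. \<omega> \<in> ?F m" by (auto simp: eventually_sequentially)
  qed
qed

section \<open>Cadlag modifications of convergent series\<close>

text \<open>The auxiliary level \<open>\<eta>\<close> is fixed first, a small multiple \<open>x\<close> of \<open>\<rho>\<close>, such that the fourth power term of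
the maximal inequality is at most \<open>\<epsilon> / 2\<close>. With \<open>\<eta>\<close> fixed, the other term is a tail of the convergent
series.\<close>

lemma small_tail_oscillation:
  assumes sum: "summable (\<lambda>n. \<bar>z n * \<sigma> n\<bar> powr \<alpha>)" and pos: "\<rho> > 0" "\<epsilon> > 0"
  obtains m0 where "\<And>m m'. m0 \<le> m \<Longrightarrow> m \<le> m' \<Longrightarrow>
    prob {\<omega> \<in> space M. \<exists>t\<in>dyadic_points. \<rho> < \<bar>Xlin z {m..<m'} t \<omega>\<bar>} \<le> \<epsilon>"
proof -
  \<comment> \<open>\<open>38400 = 2 * 19200\<close>, and \<open>x ^ 4 \<le> x\<close> because \<open>x \<le> 1\<close>\<close>
  define x where "x = min 1 (\<epsilon> / 38400)"
  have x: "0 < x" "x \<le> 1" "19200 * x \<le> \<epsilon> / 2" using pos by (auto simp: x_def)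
  define \<eta> where "\<eta> = \<rho> * x"
  have \<eta>: "\<eta> > 0" using pos x by (simp add: \<eta>_def)
  have "x ^ 4 \<le> x" using x power_decreasing[of 1 4 x] by simp
  then have 1: "19200 * (\<eta> / \<rho>) ^ 4 \<le> \<epsilon> / 2" using x pos by (simp add: \<eta>_def)
  define K where "K = 3 * normal_moment \<alpha> / \<eta> powr \<alpha>"
  have K: "0 \<le> K" using normal_moment_nonneg[of \<alpha>] by (simp add: K_def)
  have "\<epsilon> / (2 * (K + 1)) > 0" using K pos by (intro divide_pos_pos) auto
  then obtain m0 where m0: "\<And>m m'. m0 \<le> m \<Longrightarrow> norm (\<Sum>n=m..<m'. \<bar>z n * \<sigma> n\<bar> powr \<alpha>) < \<epsilon> / (2 * (K + 1))"
    using sum unfolding summable_Cauchy by blast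
  show thesis
  proof (rule that)
    fix m m' :: nat assume "m0 \<le> m"
    let ?s = "\<Sum>n=m..<m'. \<bar>z n * \<sigma> n\<bar> powr \<alpha>"
    have "?s \<le> \<epsilon> / (2 * (K + 1))" using m0[OF \<open>m0 \<le> m\<close>, of m'] by (simp add: sum_nonneg)
    then have "K * ?s \<le> K * (\<epsilon> / (2 * (K + 1)))" using K by (rule mult_left_mono)
    also have "\<dots> = (K / (K + 1)) * (\<epsilon> / 2)" using K by (simp add: field_simps)
    also have "\<dots> \<le> 1 * (\<epsilon> / 2)" using K pos by (intro mult_right_mono) (auto simp: divide_le_eq)
    finally have 2: "K * ?s \<le> \<epsilon> / 2" by simp
    have "prob {\<omega> \<in> space M. \<exists>t\<in>dyadic_points. \<rho> < \<bar>Xlin z {m..<m'} t \<omega>\<bar>} \<le> maximal_bound z {m..<m'} \<eta> \<rho>"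
      by (rule maximal_inequality) (use pos \<eta> in auto)
    also have "\<dots> \<le> \<epsilon>" unfolding maximal_bound_def using 1 2 by (simp add: K_def)
    finally show "prob {\<omega> \<in> space M. \<exists>t\<in>dyadic_points. \<rho> < \<bar>Xlin z {m..<m'} t \<omega>\<bar>} \<le> \<epsilon>" .
  qed
qed

text \<open>The blocks between consecutive indices \<open>ms j\<close> exceed \<open>(1/2) ^ j\<close> somewhere with probability at most
\<open>(1/2) ^ j\<close>. By Borel-Cantelli the partial sums along \<open>ms\<close> therefore converge uniformly on almost every
path.\<close>

lemma cadlag_series:
  assumes sum: "summable (\<lambda>n. \<bar>z n * \<sigma> n\<bar> powr \<alpha>)"
  obtains Y ms where "cadlag_process M {0..1} Y" "strict_mono (ms :: nat \<Rightarrow> nat)"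
    "AE \<omega> in M. \<forall>t\<in>{0..1}. (\<lambda>j. Xlin z {..<ms j} t \<omega>) \<longlonglongrightarrow> Y t \<omega>"
proof -
  have "\<exists>m0. \<forall>m m'. m0 \<le> m \<longrightarrow> m \<le> m' \<longrightarrow>
    prob {\<omega> \<in> space M. \<exists>t\<in>dyadic_points. (1/2) ^ j < \<bar>Xlin z {m..<m'} t \<omega>\<bar>} \<le> (1/2) ^ j" for j :: nat
    by (rule small_tail_oscillation[OF sum, of "(1/2) ^ j" "(1/2) ^ j"]) (simp, simp, blast)
  then have "\<forall>j. \<exists>m0. \<forall>m m'. m0 \<le> m \<longrightarrow> m \<le> m' \<longrightarrow>
    prob {\<omega> \<in> space M. \<exists>t\<in>dyadic_points. (1/2) ^ j < \<bar>Xlin z {m..<m'} t \<omega>\<bar>} \<le> (1/2) ^ j" ..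
  from choice[OF this] obtain m0 :: "nat \<Rightarrow> nat" where m0: "m0 j \<le> m \<Longrightarrow> m \<le> m' \<Longrightarrow>
    prob {\<omega> \<in> space M. \<exists>t\<in>dyadic_points. (1/2) ^ j < \<bar>Xlin z {m..<m'} t \<omega>\<bar>} \<le> (1/2) ^ j" for j m m'
    by blast
  \<comment> \<open>a strictly increasing sequence that dominates \<open>m0\<close>\<close>
  define ms where "ms j = (\<Sum>i\<le>j. m0 i) + j" for j
  have mono: "strict_mono ms" unfolding strict_mono_Suc_iff ms_def by simp
  have ge: "m0 j \<le> ms j" for j unfolding ms_def using member_le_sum[of j "{..j}" m0] by simp
  have le: "ms j \<le> ms (Suc j)" for j using mono by (simp add: strict_mono_Suc_iff less_imp_le)
  define D where "D j t \<omega> = Xlin z {ms j..<ms (Suc j)} t \<omega>" for j t \<omega>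
  define Y where "Y t \<omega> = lim (\<lambda>j. Xlin z {..<ms j} t \<omega>)" for t \<omega>
  let ?A = "\<lambda>j. {\<omega> \<in> space M. \<exists>t\<in>dyadic_points. (1/2) ^ j < \<bar>D j t \<omega>\<bar>}"
  have telescope: "Xlin z {..<ms j} t \<omega> = Xlin z {..<ms 0} t \<omega> + (\<Sum>i<j. D i t \<omega>)" for j t \<omega>
  proof (induction j)
    case (Suc j)
    have eq: "{..<ms (Suc j)} = {..<ms j} \<union> {ms j..<ms (Suc j)}" using le[of j] by auto
    have "Xlin z {..<ms (Suc j)} t \<omega> = Xlin z {..<ms j} t \<omega> + D j t \<omega>"
      unfolding Xlin_def D_def eq by (rule sum.union_disjoint) auto
    then show ?case using Suc by simp
  qed simp
  have "AE \<omega> in M. \<forall>\<^sub>F j in sequentially. \<omega> \<in> space M - ?A j"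
  proof (rule borel_cantelli_AE1)
    show "?A j \<in> events" for j unfolding D_def by (rule event_exceeds)
    show "summable (\<lambda>j. prob (?A j))"
    proof (rule summable_comparison_test')
      show "summable (\<lambda>j. (1/2 :: real) ^ j)" by (rule summable_geometric) simp
      show "norm (prob (?A j)) \<le> (1/2) ^ j" for j
        using m0[OF ge le, of j] by (simp add: D_def)
    qed
  qed (simp add: emeasure_eq_measure)
  then have ae: "AE \<omega> in M. uniform_limit {0..1} (\<lambda>j t. Xlin z {..<ms j} t \<omega>) (\<lambda>t. Y t \<omega>) sequentially"
    using AE_space
  proof eventually_elim
    case (elim \<omega>)
    have "\<forall>\<^sub>F j in sequentially. \<forall>t\<in>{0..1}. norm (D j t \<omega>) \<le> (1/2) ^ j"
      using elim(1)
    proof (rule eventually_mono)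
      fix j assume "\<omega> \<in> space M - ?A j"
      then have *: "\<bar>D j t \<omega>\<bar> \<le> (1/2) ^ j" if "t \<in> dyadic_points" for t using that by force
      have "\<bar>D j t \<omega>\<bar> \<le> (1/2) ^ j" if "t \<in> {0..1}" for t
        by (rule cadlag_le_of_le_on_grid[OF _ * that])
          (auto simp: D_def intro: cadlag_Xlin elim(2))
      then show "\<forall>t\<in>{0..1}. norm (D j t \<omega>) \<le> (1/2) ^ j" by simp
    qed
    then have u: "uniform_limit {0..1} (\<lambda>j t. \<Sum>i<j. D i t \<omega>) (\<lambda>t. suminf (\<lambda>i. D i t \<omega>)) sequentially"
      by (rule Weierstrass_m_test_ev) (simp add: summable_geometric)
    have "uniform_limit {0..1} (\<lambda>j t. Xlin z {..<ms 0} t \<omega> + (\<Sum>i<j. D i t \<omega>))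
        (\<lambda>t. Xlin z {..<ms 0} t \<omega> + suminf (\<lambda>i. D i t \<omega>)) sequentially"
      by (intro uniform_limit_intros u)
    then have u2: "uniform_limit {0..1} (\<lambda>j t. Xlin z {..<ms j} t \<omega>)
        (\<lambda>t. Xlin z {..<ms 0} t \<omega> + suminf (\<lambda>i. D i t \<omega>)) sequentially"
      unfolding telescope[symmetric] .
    have Yeq: "Y t \<omega> = Xlin z {..<ms 0} t \<omega> + suminf (\<lambda>i. D i t \<omega>)" if "t \<in> {0..1}" for t
      unfolding Y_def by (rule limI[OF tendsto_uniform_limitI[OF u2 that]])
    show ?case by (rule iffD1[OF uniform_limit_cong' u2]) (simp_all add: Yeq)
  qed
  show thesis
  proof (rule that[OF _ mono])
    show "AE \<omega> in M. \<forall>t\<in>{0..1}. (\<lambda>j. Xlin z {..<ms j} t \<omega>) \<longlonglongrightarrow> Y t \<omega>"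
      using ae by eventually_elim (auto intro: tendsto_uniform_limitI)
    show "cadlag_process M {0..1} Y"
      unfolding cadlag_process_def
    proof
      have [measurable]: "Xlin z {..<ms j} t \<in> borel_measurable M" if "t \<in> {0..1}" for j t
        using that by (intro Xlin_measurable) auto
      show "\<forall>t\<in>{0..1}. Y t \<in> borel_measurable M"
        unfolding Y_def[abs_def] by (auto intro!: borel_measurable_lim_metric)
      show "AE \<omega> in M. cadlag_on {0..1} (\<lambda>t. Y t \<omega>)"
        using ae AE_space by eventually_elim (rule cadlag_on_uniform_limit, auto intro: cadlag_Xlin)
    qed
  qed
qed

section \<open>Square summability of the coordinates\<close>

text \<open>A geometric sum. Appending one cell replaces the sum \<open>S\<close> by \<open>exp (- a h) * (S + h)\<close>, which preserves
\<open>S \<le> 1 / a\<close>.\<close>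

lemma exp_sum_le:
  fixes a h :: real
  assumes "0 < a" "0 \<le> h"
  shows "(\<Sum>i<J. h * exp (- a * (real (J - i) * h))) \<le> 1 / a"
proof (induction J)
  case (Suc J)
  have "(\<Sum>i<Suc J. h * exp (- a * (real (Suc J - i) * h))) =
     exp (- a * h) * ((\<Sum>i<J. h * exp (- a * (real (J - i) * h))) + h)"
    unfolding distrib_left sum_distrib_left
    by (auto simp: Suc_diff_le algebra_simps simp flip: exp_add intro!: sum.cong)
  also have "\<dots> \<le> exp (- a * h) * (1 / a + h)" using Suc by (intro mult_left_mono) auto
  also have "\<dots> = exp (- a * h) * (1 + a * h) / a" using assms by (simp add: field_simps)
  also have "\<dots> \<le> exp (- a * h) * exp (a * h) / a"
    using assms by (intro divide_right_mono mult_left_mono) auto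
  also have "\<dots> = 1 / a" by (simp flip: exp_add)
  finally show ?case .
qed (use assms in simp)

text \<open>The parameter of the Riemann sum is at most \<open>\<sigma> n powr \<alpha>\<close> times the minimum of 1 and \<open>1 / (\<alpha> * \<gamma> n)\<close>.
This minimum is at most of order \<open>1 / (1 + \<gamma> n)\<close>, which is how the standing summability condition
enters.\<close>

lemma expectation_bump_Xc_le:
  assumes t: "t \<in> {0..1}"
  shows "(\<integral>\<omega>. bump (Xc n t \<omega>) \<partial>M) \<le> normal_moment \<alpha> * (1 + 1 / \<alpha>) * (\<sigma> n powr \<alpha> / (1 + \<gamma> n))"
proof -
  obtain h J where hJ: "\<And>r. 0 < h r" "h \<longlonglongrightarrow> (0::real)" "\<And>r. real (J r) * h r = t"
    using exists_uniform_mesh[of t] t by auto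
  have m[measurable]: "Xsum n (h r) (J r) \<in> borel_measurable M" for r
    using hJ(1)[of r] by (intro Xsum_measurable) auto
  have [measurable]: "Xc n t \<in> borel_measurable M" using t by (intro Xc_measurable) auto
  have "(\<lambda>r. \<integral>\<omega>. bump (Xsum n (h r) (J r) \<omega>) \<partial>M) \<longlonglongrightarrow> (\<integral>\<omega>. bump (Xc n t \<omega>) \<partial>M)"
  proof (rule integral_dominated_convergence[where w="\<lambda>_. 1"])
    show "AE \<omega> in M. (\<lambda>r. bump (Xsum n (h r) (J r) \<omega>)) \<longlonglongrightarrow> bump (Xc n t \<omega>)"
      using AE_not_bad AE_space
    proof eventually_elim
      case (elim \<omega>)
      have "(\<lambda>r. Xsum n (h r) (J r) \<omega>) \<longlonglongrightarrow> Xc n t \<omega>"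
        using elim t by (intro Xsum_tendsto hJ) auto
      moreover have "isCont bump (Xc n t \<omega>)"
        using continuous_on_bump[of UNIV] by (simp add: continuous_on_eq_continuous_at)
      ultimately show ?case by (rule isCont_tendsto_compose[rotated])
    qed
  qed (auto simp: bump_nonneg bump_le_1)
  then show ?thesis
  proof (rule LIMSEQ_le_const2, intro exI allI impI)
    fix r :: nat
    let ?h = "h r" and ?J = "J r"
    let ?c = "\<Sum>i<?J. ?h * \<bar>\<sigma> n * exp (- \<gamma> n * (real (?J - i) * ?h))\<bar> powr \<alpha>"
    have "indep_vars (\<lambda>_. borel) (incr n ?h) {..<?J}"
      using hJ(1)[of r] by (intro indep_incr_single) simp
    from sym_stable_sum[OF this incr_stable, where b="\<lambda>i. \<sigma> n * exp (- \<gamma> n * (real (?J - i) * ?h))"] hJ(1)[of r]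
    have "sym_stable M \<alpha> ?c (Xsum n ?h ?J)" unfolding Xsum_incr[abs_def] by simp
    from expectation_bump_le[OF this, of 1] \<alpha>
    have "(\<integral>\<omega>. bump (Xsum n ?h ?J \<omega>) \<partial>M) \<le> normal_moment \<alpha> * ?c" by simp
    also have "?c = \<sigma> n powr \<alpha> * (\<Sum>i<?J. ?h * exp (- (\<alpha> * \<gamma> n) * (real (?J - i) * ?h)))"
      unfolding sum_distrib_left
      by (intro sum.cong refl) (use \<sigma>[of n] in \<open>simp add: abs_mult powr_mult exp_powr_real mult_ac\<close>)
    also have "normal_moment \<alpha> * (\<sigma> n powr \<alpha> * (\<Sum>i<?J. ?h * exp (- (\<alpha> * \<gamma> n) * (real (?J - i) * ?h)))) \<le>
        normal_moment \<alpha> * (\<sigma> n powr \<alpha> * ((1 + 1 / \<alpha>) / (1 + \<gamma> n)))"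
    proof (intro mult_left_mono normal_moment_nonneg)
      let ?S = "\<Sum>i<?J. ?h * exp (- (\<alpha> * \<gamma> n) * (real (?J - i) * ?h))"
      have "?S \<le> 1 / (\<alpha> * \<gamma> n)" using \<alpha> \<gamma>[of n] hJ(1)[of r] by (intro exp_sum_le) auto
      then have "\<gamma> n * ?S \<le> \<gamma> n * (1 / (\<alpha> * \<gamma> n))" using \<gamma>[of n] by (intro mult_left_mono) auto
      then have 1: "\<gamma> n * ?S \<le> 1 / \<alpha>" using \<gamma>[of n] by simp
      have "?S \<le> (\<Sum>i<?J. ?h * 1)"
        using \<alpha> \<gamma>[of n] hJ(1)[of r] by (intro sum_mono mult_left_mono) auto
      also have "\<dots> \<le> 1" using hJ(3)[of r] t by simp
      finally have "(1 + \<gamma> n) * ?S \<le> 1 + 1 / \<alpha>" using 1 by (simp add: distrib_right)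
      then show "?S \<le> (1 + 1 / \<alpha>) / (1 + \<gamma> n)" using \<gamma>[of n] by (simp add: pos_le_divide_eq mult.commute)
    qed simp
    finally show "(\<integral>\<omega>. bump (Xsum n ?h ?J \<omega>) \<partial>M) \<le> normal_moment \<alpha> * (1 + 1 / \<alpha>) * (\<sigma> n powr \<alpha> / (1 + \<gamma> n))"
      by (simp add: mult_ac)
  qed
qed

text \<open>The sum of the expectations of \<open>bump (Xc n t)\<close> is finite, so that \<open>bump (Xc n t)\<close> is almost surely
summable over \<open>n\<close>. Then its terms tend to 0, and near 0 the function \<open>bump\<close> is comparable to the square.\<close>

lemma AE_summable_squares:
  assumes t: "t \<in> {0..1}" shows "AE \<omega> in M. summable (\<lambda>n. (X n t \<omega>)\<^sup>2)"
proof -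
  have [measurable]: "Xc n t \<in> borel_measurable M" for n using t by (intro Xc_measurable) auto
  have int: "integrable M (\<lambda>\<omega>. bump (Xc n t \<omega>))" for n
    by (rule integrable_const_bound[of _ 1]) (auto simp: bump_nonneg bump_le_1)
  let ?b = "\<lambda>n. \<integral>\<omega>. bump (Xc n t \<omega>) \<partial>M"
  have b0: "0 \<le> ?b n" for n by (intro integral_nonneg_AE) (auto simp: bump_nonneg)
  have "summable ?b"
  proof (rule summable_comparison_test')
    show "summable (\<lambda>n. normal_moment \<alpha> * (1 + 1 / \<alpha>) * (\<sigma> n powr \<alpha> / (1 + \<gamma> n)))"
      by (intro summable_mult sum_\<sigma>)
    show "norm (?b n) \<le> normal_moment \<alpha> * (1 + 1 / \<alpha>) * (\<sigma> n powr \<alpha> / (1 + \<gamma> n))" for n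
      using expectation_bump_Xc_le[OF t, of n] b0[of n] by simp
  qed
  have "(\<integral>\<^sup>+ \<omega>. (\<Sum>n. ennreal (bump (Xc n t \<omega>))) \<partial>M) = (\<Sum>n. \<integral>\<^sup>+ \<omega>. ennreal (bump (Xc n t \<omega>)) \<partial>M)"
    by (rule nn_integral_suminf) measurable
  also have "\<dots> = (\<Sum>n. ennreal (?b n))"
    by (simp add: nn_integral_eq_integral[OF int] bump_nonneg)
  also have "\<dots> = ennreal (\<Sum>n. ?b n)" by (rule suminf_ennreal2[OF b0 \<open>summable ?b\<close>])
  finally have fin: "(\<integral>\<^sup>+ \<omega>. (\<Sum>n. ennreal (bump (Xc n t \<omega>))) \<partial>M) \<noteq> \<infinity>" by simp
  have "AE \<omega> in M. (\<Sum>n. ennreal (bump (Xc n t \<omega>))) \<noteq> \<infinity>"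
    by (rule nn_integral_noteq_infinite[OF _ fin]) measurable
  moreover have "AE \<omega> in M. \<forall>n. X n t \<omega> = Xc n t \<omega>"
    unfolding AE_all_countable using AE_X_eq_Xc[OF t] by blast
  ultimately show ?thesis
  proof eventually_elim
    case (elim \<omega>)
    have sb: "summable (\<lambda>n. bump (Xc n t \<omega>))"
      using elim(1) by (intro summable_suminf_not_top bump_nonneg) simp
    have "0 < bump 1" by (simp add: bump_def)
    from order_tendstoD(2)[OF summable_LIMSEQ_zero[OF sb] this]
    have "\<forall>\<^sub>F n in sequentially. norm ((X n t \<omega>)\<^sup>2) \<le> 4 * bump (Xc n t \<omega>)"
    proof (rule eventually_mono)
      fix n assume lt: "bump (Xc n t \<omega>) < bump 1"
      have "\<bar>Xc n t \<omega>\<bar> \<le> 1"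
      proof (rule ccontr)
        assume "\<not> \<bar>Xc n t \<omega>\<bar> \<le> 1"
        then have "1\<^sup>2 \<le> \<bar>Xc n t \<omega>\<bar>\<^sup>2" by (intro power_mono) auto
        then have "bump 1 \<le> bump (Xc n t \<omega>)" by (simp add: bump_def)
        then show False using lt by simp
      qed
      then show "norm ((X n t \<omega>)\<^sup>2) \<le> 4 * bump (Xc n t \<omega>)"
        using square_le_bump elim(2) by simp
    qed
    then show ?case by (rule summable_comparison_test_ev) (intro summable_mult sb)
  qed
qed

end

section \<open>Large increments when the series diverges\<close>

text \<open>Sums over disjoint blocks are independent, so that all of them are small with probability at most
\<open>(1 - p) ^ N \<le> exp (- N p)\<close>.\<close>

lemma (in prob_space) prob_max_block_ge:
  fixes b :: "nat \<Rightarrow> 'i \<Rightarrow> real" and B :: "nat \<Rightarrow> 'i set"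
  assumes ind: "indep_vars (\<lambda>_. borel) \<xi> I" and N: "0 < N"
    and BI: "\<And>k. B k \<subseteq> I" and fin: "finite I" and disj: "\<And>j k. j \<noteq> k \<Longrightarrow> B j \<inter> B k = {}"
    and p: "\<And>k. k < N \<Longrightarrow> p \<le> prob {\<omega> \<in> space M. c < \<bar>\<Sum>i\<in>B k. b k i * \<xi> i \<omega>\<bar>}"
  shows "1 - exp (- (real N * p)) \<le> prob {\<omega> \<in> space M. \<exists>k<N. c < \<bar>\<Sum>i\<in>B k. b k i * \<xi> i \<omega>\<bar>}"
proof -
  have m[measurable]: "\<xi> i \<in> borel_measurable M" if "i \<in> I" for i
    using ind that by (auto simp: indep_vars_def)
  define V where "V k \<omega> = (\<Sum>i\<in>B k. b k i * \<xi> i \<omega>)" for k \<omega>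
  have V[measurable]: "V k \<in> borel_measurable M" for k
    unfolding V_def[abs_def] using BI[of k] by (intro borel_measurable_sum) auto
  have "indep_vars (\<lambda>k. Pi\<^sub>M (B k) (\<lambda>_. borel)) (\<lambda>k \<omega>. restrict (\<lambda>i. \<xi> i \<omega>) (B k)) {..<N}"
    by (rule indep_vars_restrict[OF ind]) (use BI disj in \<open>auto simp: disjoint_family_on_def\<close>)
  then have "indep_vars (\<lambda>_. borel) (\<lambda>k \<omega>. \<Sum>i\<in>B k. b k i * restrict (\<lambda>i. \<xi> i \<omega>) (B k) i) {..<N}"
    by (rule indep_vars_compose2[where Y="\<lambda>k x. \<Sum>i\<in>B k. b k i * x i"])
      (intro borel_measurable_sum borel_measurable_times measurable_component_singleton, auto)
  then have indV: "indep_vars (\<lambda>_. borel) V {..<N}"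
    unfolding V_def[abs_def] by (simp cong: sum.cong)
  have pre: "V k -` {x. \<bar>x\<bar> \<le> c} \<inter> space M = space M - {\<omega> \<in> space M. c < \<bar>V k \<omega>\<bar>}" for k by auto
  have E: "{\<omega> \<in> space M. \<exists>k<N. c < \<bar>V k \<omega>\<bar>} \<in> events" by measurable
  have "1 - prob {\<omega> \<in> space M. \<exists>k<N. c < \<bar>V k \<omega>\<bar>} = prob (space M - {\<omega> \<in> space M. \<exists>k<N. c < \<bar>V k \<omega>\<bar>})"
    using prob_compl[OF E] by simp
  also have "space M - {\<omega> \<in> space M. \<exists>k<N. c < \<bar>V k \<omega>\<bar>} = (\<Inter>k\<in>{..<N}. V k -` {x. \<bar>x\<bar> \<le> c} \<inter> space M)"
    using N by (auto simp: not_less) (meson lessThan_iff not_le)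
  also have "prob \<dots> = (\<Prod>k<N. prob (V k -` {x. \<bar>x\<bar> \<le> c} \<inter> space M))"
    using N by (intro indep_varsD_finite[OF indV]) auto
  also have "\<dots> \<le> (\<Prod>k<N. exp (- p))"
  proof (rule prod_mono, intro conjI measure_nonneg)
    fix k assume k: "k \<in> {..<N}"
    have "{\<omega> \<in> space M. c < \<bar>V k \<omega>\<bar>} \<in> events" by measurable
    then have "prob (V k -` {x. \<bar>x\<bar> \<le> c} \<inter> space M) = 1 - prob {\<omega> \<in> space M. c < \<bar>V k \<omega>\<bar>}"
      unfolding pre by (rule prob_compl)
    also have "\<dots> \<le> 1 - p" using p[of k] k by (simp add: V_def)
    also have "\<dots> \<le> exp (- p)" using exp_ge_add_one_self[of "- p"] by simp
    finally show "prob (V k -` {x. \<bar>x\<bar> \<le> c} \<inter> space M) \<le> exp (- p)" .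
  qed
  also have "\<dots> = exp (- (real N * p))" by (simp flip: exp_of_nat_mult)
  finally show ?thesis unfolding V_def by linarith
qed

context stable_ou
begin

text \<open>The increment over the k-th coarse cell consists of the decay of the earlier noise and of the fresh
noise in the \<open>q\<close> fine cells of that coarse cell. The block \<open>B k\<close> collects the fresh noise of the first
\<open>m\<close> coordinates. Once \<open>N\<close> is large compared with their decay rates, the kernel loses at most a factor
2 within a cell, so that the block sum is stable with parameter between \<open>A / (2 * N)\<close> and \<open>A / N\<close>. The
bound depends neither on the number \<open>m'\<close> of coordinates nor on the refinement \<open>q\<close>.\<close>

lemma Riemann_increments_large:
  fixes m m' N q :: nat and z :: "nat \<Rightarrow> real"
  defines "A \<equiv> \<Sum>n<m. \<bar>z n * \<sigma> n\<bar> powr \<alpha>" and "h \<equiv> 1 / real (N * q)"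
  defines "Z \<equiv> \<lambda>J \<omega>. \<Sum>n<m'. z n * Xsum n h J \<omega>"
  assumes \<kappa>: "0 < \<kappa>" "\<And>c \<xi>. sym_stable M \<alpha> c \<xi> \<Longrightarrow> 0 \<le> c \<Longrightarrow> c \<le> 1 \<Longrightarrow>
       \<kappa> * c \<le> prob {\<omega> \<in> space M. 1 < \<bar>\<xi> \<omega>\<bar>}"
    and N: "0 < N" "\<And>n. n < m \<Longrightarrow> 2 * (\<alpha> * \<gamma> n) \<le> real N" "A / c powr \<alpha> \<le> real N"
    and m: "m \<le> m'" and q: "0 < q" and c: "0 < c"
  shows "prob {\<omega> \<in> space M. \<forall>k<N. \<bar>Z (Suc k * q) \<omega> - Z (k * q) \<omega>\<bar> \<le> c} \<le>
    1 - (1 - exp (- (\<kappa> * A / (2 * c powr \<alpha>)))) / 2"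
proof -
  have h: "0 < h" "real N * (real q * h) = 1" using N q by (auto simp: h_def)
  define I where "I = {..<m'} \<times> {..<N * q}"
  define \<xi> where "\<xi> p = incr (fst p) h (snd p)" for p
  define w where "w n = z n * \<sigma> n" for n
  define F where "F J p = (if snd p < J then w (fst p) * exp (- \<gamma> (fst p) * (real (J - snd p) * h)) else 0)"
    for J and p :: "nat \<times> nat"
  define b where "b k p = F (Suc k * q) p - F (k * q) p" for k p
  define B where "B k = (if k < N then {..<m} \<times> {k * q..<Suc k * q} else {})" for k
  have fin: "finite I" by (simp add: I_def)
  have ind: "indep_vars (\<lambda>_. borel) \<xi> I"
    unfolding I_def \<xi>_def[abs_def] using h by (intro indep_incr) auto
  have st: "sym_stable M \<alpha> h (\<xi> p)" for p
    unfolding \<xi>_def using h by (intro incr_stable) simp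
  have Z: "Z J \<omega> = (\<Sum>p\<in>I. F J p * \<xi> p \<omega>)" if J: "J \<le> N * q" for J \<omega>
  proof -
    have "Z J \<omega> = (\<Sum>n<m'. \<Sum>i<N * q. F J (n, i) * \<xi> (n, i) \<omega>)"
      unfolding Z_def
    proof (rule sum.cong[OF refl])
      fix n
      have "z n * Xsum n h J \<omega> = (\<Sum>i<J. F J (n, i) * \<xi> (n, i) \<omega>)"
        unfolding Xsum_incr sum_distrib_left
        by (intro sum.cong) (auto simp: w_def F_def \<xi>_def)
      also have "\<dots> = (\<Sum>i<N * q. F J (n, i) * \<xi> (n, i) \<omega>)"
        using J by (intro sum.mono_neutral_left) (auto simp: F_def)
      finally show "z n * Xsum n h J \<omega> = \<dots>" .
    qed
    then show ?thesis by (simp add: I_def sum.cartesian_product)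
  qed
  have kq: "Suc k * q \<le> N * q" if "k < N" for k using that by (intro mult_le_mono1) simp
  have dZ: "Z (Suc k * q) \<omega> - Z (k * q) \<omega> = (\<Sum>p\<in>I. b k p * \<xi> p \<omega>)" if k: "k < N" for k \<omega>
  proof -
    have "k * q \<le> N * q" using k by simp
    then show ?thesis
      unfolding b_def left_diff_distrib sum_subtractf by (simp only: Z kq[OF k])
  qed
  have BI: "B k \<subseteq> I" for k
    unfolding B_def I_def using m kq[of k] by (auto intro: order_less_le_trans)
  have disj: "B j \<inter> B k = {}" if "j \<noteq> k" for j k
  proof -
    have *: "Suc j * q \<le> k * q" if "j < k" for j k using that by (intro mult_le_mono1) simp
    have "{j * q..<Suc j * q} \<inter> {k * q..<Suc k * q} = {}"
      using \<open>j \<noteq> k\<close> *[of j k] *[of k j] by (cases "j < k") auto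
    then show ?thesis by (auto simp: B_def)
  qed
  have A0: "0 \<le> A" unfolding A_def by (intro sum_nonneg) simp
  have cp: "0 < c powr \<alpha>" using c by simp
  have tail: "\<kappa> * A / (2 * c powr \<alpha>) / real N \<le> prob {\<omega> \<in> space M. c < \<bar>\<Sum>p\<in>B k. b k p * \<xi> p \<omega>\<bar>}"
    if k: "k < N" for k
  proof -
    let ?d = "\<Sum>p\<in>B k. h * \<bar>b k p\<bar> powr \<alpha>"
    have "indep_vars (\<lambda>_. borel) \<xi> (B k)" using ind BI by (rule indep_vars_subset)
    then have "sym_stable M \<alpha> ?d (\<lambda>\<omega>. \<Sum>p\<in>B k. b k p * \<xi> p \<omega>)"
      using finite_subset[OF BI fin] by (intro sym_stable_sum st)
    from sym_stable_scale[OF this, of "1 / c"]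
    have st': "sym_stable M \<alpha> (?d / c powr \<alpha>) (\<lambda>\<omega>. 1 / c * (\<Sum>p\<in>B k. b k p * \<xi> p \<omega>))"
      using c by (simp add: powr_divide)
    have d: "?d = (\<Sum>n<m. \<Sum>i\<in>{k * q..<Suc k * q}. h * \<bar>b k (n, i)\<bar> powr \<alpha>)"
      using k by (simp add: B_def sum.cartesian_product)
    have block_coeff: "\<bar>w n\<bar> powr \<alpha> / 2 \<le> \<bar>b k (n, i)\<bar> powr \<alpha>" "\<bar>b k (n, i)\<bar> powr \<alpha> \<le> \<bar>w n\<bar> powr \<alpha>"
      if n: "n < m" and i: "i \<in> {k * q..<Suc k * q}" for n i
    proof -
      let ?s = "real (Suc k * q - i) * h"
      have bE: "b k (n, i) = w n * exp (- \<gamma> n * ?s)" using i by (simp add: b_def F_def)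
      have "Suc k * q - i \<le> q" using i by auto
      then have "real (Suc k * q - i) \<le> real q" by (simp only: of_nat_le_iff)
      then have "?s \<le> real q * h" using h by (intro mult_right_mono) auto
      also have "\<dots> = 1 / real N" using h N by (simp add: field_simps)
      finally have s: "0 \<le> ?s" "?s \<le> 1 / real N" using h by auto
      have "\<alpha> * \<gamma> n * ?s \<le> \<alpha> * \<gamma> n * (1 / real N)"
        using s \<alpha> \<gamma>[of n] by (intro mult_left_mono) auto
      also have "\<dots> \<le> 1 / 2" using N(2)[OF n] N(1) by (simp add: field_simps)
      finally have "1 / 2 \<le> 1 + - (\<alpha> * \<gamma> n * ?s)" by simp
      also have "\<dots> \<le> exp (- (\<alpha> * \<gamma> n * ?s))" by (rule exp_ge_add_one_self)
      finally have e1: "1 / 2 \<le> exp (- (\<alpha> * \<gamma> n * ?s))" .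
      have e2: "exp (- (\<alpha> * \<gamma> n * ?s)) \<le> 1" using s \<alpha> \<gamma>[of n] by simp
      have eq: "\<bar>b k (n, i)\<bar> powr \<alpha> = \<bar>w n\<bar> powr \<alpha> * exp (- (\<alpha> * \<gamma> n * ?s))"
        unfolding bE by (simp add: abs_mult powr_mult exp_powr_real mult_ac)
      show "\<bar>w n\<bar> powr \<alpha> / 2 \<le> \<bar>b k (n, i)\<bar> powr \<alpha>"
        unfolding eq using mult_left_mono[OF e1, of "\<bar>w n\<bar> powr \<alpha>"] by simp
      show "\<bar>b k (n, i)\<bar> powr \<alpha> \<le> \<bar>w n\<bar> powr \<alpha>"
        unfolding eq using mult_left_mono[OF e2, of "\<bar>w n\<bar> powr \<alpha>"] by simp
    qed
    have cardq: "(\<Sum>n<m. \<Sum>i\<in>{k * q..<Suc k * q}. h * (\<bar>w n\<bar> powr \<alpha> * x)) = A * x / real N" for x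
    proof -
      have "(\<Sum>n<m. \<Sum>i\<in>{k * q..<Suc k * q}. h * (\<bar>w n\<bar> powr \<alpha> * x)) = (\<Sum>n<m. (real q * h) * (\<bar>w n\<bar> powr \<alpha> * x))"
        by (simp add: mult.assoc)
      also have "real q * h = 1 / real N" using h N by (simp add: field_simps)
      finally show ?thesis by (simp add: A_def w_def sum_divide_distrib sum_distrib_right)
    qed
    have dlow: "A * (1/2) / real N \<le> ?d"
      unfolding d cardq[symmetric] using block_coeff(1) h by (intro sum_mono mult_left_mono) auto
    have dup: "?d \<le> A * 1 / real N"
      unfolding d cardq[symmetric] using block_coeff(2) h by (intro sum_mono mult_left_mono) auto
    have "?d / c powr \<alpha> \<le> A / real N / c powr \<alpha>" using dup cp by (intro divide_right_mono) auto
    also have "\<dots> \<le> 1" using N cp by (simp add: field_simps)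
    finally have d1: "?d / c powr \<alpha> \<le> 1" .
    have "0 \<le> A * (1/2) / real N" using A0 by simp
    then have d0: "0 \<le> ?d / c powr \<alpha>" using dlow cp by (intro divide_nonneg_nonneg) auto
    have "\<kappa> * A / (2 * c powr \<alpha>) / real N = \<kappa> * (A * (1/2) / real N / c powr \<alpha>)" by simp
    also have "\<dots> \<le> \<kappa> * (?d / c powr \<alpha>)"
      using dlow cp \<kappa>(1) by (intro mult_left_mono divide_right_mono) auto
    also have "\<dots> \<le> prob {\<omega> \<in> space M. 1 < \<bar>1 / c * (\<Sum>p\<in>B k. b k p * \<xi> p \<omega>)\<bar>}"
      by (rule \<kappa>(2)[OF st' d0 d1])
    also have "{\<omega> \<in> space M. 1 < \<bar>1 / c * (\<Sum>p\<in>B k. b k p * \<xi> p \<omega>)\<bar>} =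
        {\<omega> \<in> space M. c < \<bar>\<Sum>p\<in>B k. b k p * \<xi> p \<omega>\<bar>}"
      using c by (auto simp: abs_mult divide_simps)
    finally show ?thesis .
  qed
  have "1 - exp (- (real N * (\<kappa> * A / (2 * c powr \<alpha>) / real N))) \<le>
      prob {\<omega> \<in> space M. \<exists>k<N. c < \<bar>\<Sum>p\<in>B k. b k p * \<xi> p \<omega>\<bar>}"
    by (rule prob_max_block_ge[OF ind N(1) BI fin disj tail])
  also have "\<dots> \<le> 2 * prob {\<omega> \<in> space M. \<exists>k<N. c < \<bar>\<Sum>p\<in>I. b k p * \<xi> p \<omega>\<bar>}"
    by (rule prob_block_max_le[OF fin ind sym_stable_symmetric[OF st] BI disj])
  also have "{\<omega> \<in> space M. \<exists>k<N. c < \<bar>\<Sum>p\<in>I. b k p * \<xi> p \<omega>\<bar>} =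
      space M - {\<omega> \<in> space M. \<forall>k<N. \<bar>Z (Suc k * q) \<omega> - Z (k * q) \<omega>\<bar> \<le> c}"
    by (auto simp: dZ not_le simp del: mult_Suc)
  also have "prob \<dots> = 1 - prob {\<omega> \<in> space M. \<forall>k<N. \<bar>Z (Suc k * q) \<omega> - Z (k * q) \<omega>\<bar> \<le> c}"
  proof (rule prob_compl)
    have [measurable]: "Z J \<in> borel_measurable M" for J
      unfolding Z_def using h by (intro borel_measurable_sum borel_measurable_times Xsum_measurable) auto
    show "{\<omega> \<in> space M. \<forall>k<N. \<bar>Z (Suc k * q) \<omega> - Z (k * q) \<omega>\<bar> \<le> c} \<in> events" by measurable
  qed
  finally have "1 - exp (- (\<kappa> * A / (2 * c powr \<alpha>))) \<le>
      2 * (1 - prob {\<omega> \<in> space M. \<forall>k<N. \<bar>Z (Suc k * q) \<omega> - Z (k * q) \<omega>\<bar> \<le> c})"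
    using N(1) by simp
  moreover have "p \<le> 1 - (1 - x) / 2" if "1 - x \<le> 2 * (1 - p)" for p x :: real
    using that by (simp add: field_simps)
  ultimately show ?thesis by blast
qed

text \<open>Cadlag paths on a compact interval are bounded, so the events that the path exceeds \<open>j\<close> decrease to a
null event.\<close>

lemma cadlag_process_bounded_in_prob:
  assumes Y: "cadlag_process M {0..1} Y" and \<epsilon>: "\<epsilon> > 0"
  obtains \<rho> where "\<rho> > 0" "prob {\<omega> \<in> space M. \<exists>t\<in>dyadic_points. \<rho> < \<bar>Y t \<omega>\<bar>} \<le> \<epsilon>"
    "{\<omega> \<in> space M. \<exists>t\<in>dyadic_points. \<rho> < \<bar>Y t \<omega>\<bar>} \<in> events"
proof -
  let ?A = "\<lambda>j::nat. {\<omega> \<in> space M. \<exists>t\<in>dyadic_points. real j < \<bar>Y t \<omega>\<bar>}"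
  have A: "?A j \<in> events" for j
  proof -
    have "?A j = (\<Union>t\<in>dyadic_points. {\<omega> \<in> space M. real j < \<bar>Y t \<omega>\<bar>})" by auto
    moreover have "{\<omega> \<in> space M. real j < \<bar>Y t \<omega>\<bar>} \<in> events" if "t \<in> dyadic_points" for t
    proof -
      have [measurable]: "Y t \<in> borel_measurable M"
        using dyadic_points_subset that Y by (auto simp: cadlag_process_def)
      show ?thesis by measurable
    qed
    ultimately show ?thesis using countable_dyadic_points by (auto intro!: sets.countable_UN'')
  qed
  have "decseq ?A"
    unfolding decseq_def by auto (meson le_less_trans of_nat_le_iff)
  then have "(\<lambda>j. prob (?A j)) \<longlonglongrightarrow> prob (\<Inter>j. ?A j)"
    using A by (intro finite_Lim_measure_decseq) auto
  moreover have "AE \<omega> in M. \<omega> \<notin> (\<Inter>j. ?A j)"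
  proof -
    have "AE \<omega> in M. cadlag_on {0..1} (\<lambda>t. Y t \<omega>)" using Y by (simp add: cadlag_process_def)
    then show ?thesis
    proof eventually_elim
      case (elim \<omega>)
      obtain C where C: "\<And>t. t \<in> {0..1} \<Longrightarrow> \<bar>Y t \<omega>\<bar> \<le> C"
        using cadlag_on_compact_bounded[OF compact_Icc elim] by blast
      obtain j where "C \<le> real j" using real_arch_simple by blast
      then have "\<omega> \<notin> ?A j" using C dyadic_points_subset by (force simp: not_less)
      then show ?case by blast
    qed
  qed
  then have "prob (\<Inter>j. ?A j) = 0" using A by (subst prob_eq_0) auto
  ultimately have "(\<lambda>j. prob (?A j)) \<longlonglongrightarrow> 0" by simp
  from order_tendstoD(2)[OF this \<epsilon>] obtain j0 where j0: "\<And>j. j0 \<le> j \<Longrightarrow> prob (?A j) < \<epsilon>"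
    by (auto simp: eventually_sequentially)
  show thesis
    by (rule that[OF _ less_imp_le[OF j0] A, of "Suc j0"]) auto
qed

text \<open>By \<open>Riemann_increments_large\<close>, after refining the grid and adding coordinates, the increments of \<open>Y\<close>
over some grid all stay below \<open>c = 3 * \<rho>\<close> with probability at most \<open>(1 + exp (- \<kappa> A / (2 c powr \<alpha>))) / 2\<close>,
where \<open>A\<close> is a partial sum of the series. Boundedness of the path makes this probability at least 7/8,
which limits \<open>A\<close>.\<close>

lemma summable_of_cadlag:
  assumes Y: "cadlag_process M {0..1} Y"
    and lim: "\<And>t. t \<in> {0..1} \<Longrightarrow> AE \<omega> in M. (\<lambda>m. Xlin z {..<m} t \<omega>) \<longlonglongrightarrow> Y t \<omega>"
  shows "summable (\<lambda>n. \<bar>z n * \<sigma> n\<bar> powr \<alpha>)"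
proof -
  obtain \<kappa> :: real where \<kappa>: "\<kappa> > 0"
    "\<And>(M :: 'a measure) c \<xi>. prob_space M \<Longrightarrow> sym_stable M \<alpha> c \<xi> \<Longrightarrow> 0 \<le> c \<Longrightarrow> c \<le> 1 \<Longrightarrow>
       \<kappa> * c \<le> measure M {\<omega> \<in> space M. 1 < \<bar>\<xi> \<omega>\<bar>}"
    using stable_tail_lower_bound[OF \<alpha>] by blast
  obtain \<rho> where \<rho>: "\<rho> > 0" "prob {\<omega> \<in> space M. \<exists>t\<in>dyadic_points. \<rho> < \<bar>Y t \<omega>\<bar>} \<le> 1/8"
    and \<rho>e: "{\<omega> \<in> space M. \<exists>t\<in>dyadic_points. \<rho> < \<bar>Y t \<omega>\<bar>} \<in> events"
    using cadlag_process_bounded_in_prob[OF Y, of "1/8"] by auto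
  \<comment> \<open>strictly more than \<open>2 * \<rho>\<close>, which bounds the increments of a path bounded by \<open>\<rho>\<close>\<close>
  define c where "c = 3 * \<rho>"
  have c: "0 < c" using \<rho> by (simp add: c_def)
  have bound: "(\<Sum>n<m. \<bar>z n * \<sigma> n\<bar> powr \<alpha>) \<le> 2 * c powr \<alpha> / \<kappa>" for m
  proof -
    let ?A = "\<Sum>n<m. \<bar>z n * \<sigma> n\<bar> powr \<alpha>"
    let ?b = "1 - (1 - exp (- (\<kappa> * ?A / (2 * c powr \<alpha>)))) / 2"
    \<comment> \<open>The mesh is a power of 1/2, so that the coarse grid consists of dyadic points.\<close>
    obtain l where l: "(\<Sum>n<m. 2 * (\<alpha> * \<gamma> n)) + ?A / c powr \<alpha> < 2 ^ l"
      using real_arch_pow[of 2] by auto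
    define N :: nat where "N = 2 ^ l"
    have S0: "0 \<le> (\<Sum>n<m. 2 * (\<alpha> * \<gamma> n))" "0 \<le> ?A / c powr \<alpha>"
      using \<alpha> \<gamma> by (auto intro!: sum_nonneg divide_nonneg_nonneg simp: less_imp_le)
    have N: "0 < N" "?A / c powr \<alpha> \<le> real N"
      using l S0 by (auto simp: N_def)
    have N2: "2 * (\<alpha> * \<gamma> n) \<le> real N" if "n < m" for n
    proof -
      have "2 * (\<alpha> * \<gamma> n) \<le> (\<Sum>n<m. 2 * (\<alpha> * \<gamma> n))"
        using that \<alpha> \<gamma> by (intro member_le_sum) (auto simp: less_imp_le)
      then show ?thesis using l S0 by (simp add: N_def)
    qed
    have grid: "real k / real N \<in> dyadic_points" if "k \<le> N" for k
      using that by (auto simp: dyadic_points_def N_def)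
    have in01: "real k / real N \<in> {0..1}" if "k \<le> N" for k
      using that N by simp
    have Xm[measurable]: "Xlin z A' (real k / real N) \<in> borel_measurable M" for A' k
      by (rule Xlin_measurable) simp
    have Ym[measurable]: "Y (real k / real N) \<in> borel_measurable M" if "k \<le> N" for k
      using Y in01[OF that] by (simp add: cadlag_process_def)
    have step1: "prob {\<omega> \<in> space M. \<forall>k<N. \<bar>Xlin z {..<m'} (real (Suc k) / real N) \<omega> -
        Xlin z {..<m'} (real k / real N) \<omega>\<bar> < c} \<le> ?b" (is "prob ?E \<le> _") if m': "m \<le> m'" for m'
    proof (rule prob_le_of_eventually)
      let ?Z = "\<lambda>r J \<omega>. \<Sum>n<m'. z n * Xsum n (1 / real (N * Suc r)) J \<omega>"
      let ?F = "\<lambda>r. {\<omega> \<in> space M. \<forall>k<N. \<bar>?Z r (Suc k * Suc r) \<omega> - ?Z r (k * Suc r) \<omega>\<bar> \<le> c}"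
      have [measurable]: "?Z r J \<in> borel_measurable M" for r J
        by (intro borel_measurable_sum borel_measurable_times Xsum_measurable) auto
      show "?F r \<in> events" for r by measurable
      show "?E \<in> events" by measurable
      have "prob (?F r) \<le> ?b" for r
        by (rule Riemann_increments_large[OF \<kappa>(1) \<kappa>(2)[OF prob_space_axioms]])
          (use N N2 m' c in auto)
      then show "\<forall>\<^sub>F r in sequentially. prob (?F r) \<le> ?b" by (intro always_eventually allI)
      show "AE \<omega> in M. \<omega> \<in> ?E \<longrightarrow> (\<forall>\<^sub>F r in sequentially. \<omega> \<in> ?F r)"
        using Xlin_Riemann_tendsto[OF N(1), of z "{..<m'}"]
      proof eventually_elim
        case (elim \<omega>)
        show ?case
        proof
          assume E: "\<omega> \<in> ?E"
          have "\<forall>\<^sub>F r in sequentially. \<bar>?Z r (Suc k * Suc r) \<omega> - ?Z r (k * Suc r) \<omega>\<bar> < c" if "k < N" for k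
          proof (rule order_tendstoD(2))
            show "(\<lambda>r. \<bar>?Z r (Suc k * Suc r) \<omega> - ?Z r (k * Suc r) \<omega>\<bar>) \<longlonglongrightarrow>
              \<bar>Xlin z {..<m'} (real (Suc k) / real N) \<omega> - Xlin z {..<m'} (real k / real N) \<omega>\<bar>"
              by (intro tendsto_rabs tendsto_diff elim[rule_format])
            show "\<bar>Xlin z {..<m'} (real (Suc k) / real N) \<omega> - Xlin z {..<m'} (real k / real N) \<omega>\<bar> < c"
              using E that by blast
          qed
          then have "\<forall>\<^sub>F r in sequentially. \<forall>k\<in>{..<N}. \<bar>?Z r (Suc k * Suc r) \<omega> - ?Z r (k * Suc r) \<omega>\<bar> < c"
            by (intro eventually_ball_finite) auto
          then show "\<forall>\<^sub>F r in sequentially. \<omega> \<in> ?F r"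
            by (rule eventually_mono) (use E in \<open>auto intro: less_imp_le\<close>)
        qed
      qed
    qed
    define EY where "EY = {\<omega> \<in> space M. \<forall>k<N. \<bar>Y (real (Suc k) / real N) \<omega> - Y (real k / real N) \<omega>\<bar> < c}"
    have EY: "EY \<in> events"
    proof -
      have "EY = space M \<inter> (\<Inter>k\<in>{..<N}. {\<omega> \<in> space M. \<bar>Y (real (Suc k) / real N) \<omega> - Y (real k / real N) \<omega>\<bar> < c})"
        unfolding EY_def by auto
      also have "\<dots> \<in> events"
      proof (rule sets.Int[OF sets.top sets.finite_INT])
        fix k assume "k \<in> {..<N}"
        then have [measurable]: "Y (real (Suc k) / real N) \<in> borel_measurable M" "Y (real k / real N) \<in> borel_measurable M"
          by (auto intro!: Ym simp del: of_nat_Suc)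
        show "{\<omega> \<in> space M. \<bar>Y (real (Suc k) / real N) \<omega> - Y (real k / real N) \<omega>\<bar> < c} \<in> events"
          by measurable
      qed (use N in auto)
      finally show ?thesis .
    qed
    have "prob EY \<le> ?b"
    proof (rule prob_le_of_eventually)
      let ?F = "\<lambda>m'. {\<omega> \<in> space M. \<forall>k<N. \<bar>Xlin z {..<m'} (real (Suc k) / real N) \<omega> -
        Xlin z {..<m'} (real k / real N) \<omega>\<bar> < c}"
      show "?F m' \<in> events" for m' by measurable
      show "EY \<in> events" by (rule EY)
      show "\<forall>\<^sub>F m' in sequentially. prob (?F m') \<le> ?b"
        using eventually_ge_at_top[of m] by (rule eventually_mono) (rule step1)
      have "AE \<omega> in M. \<forall>k\<in>{..N}. (\<lambda>m. Xlin z {..<m} (real k / real N) \<omega>) \<longlonglongrightarrow> Y (real k / real N) \<omega>"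
        by (rule AE_finite_allI) (auto intro!: lim in01)
      then show "AE \<omega> in M. \<omega> \<in> EY \<longrightarrow> (\<forall>\<^sub>F m' in sequentially. \<omega> \<in> ?F m')"
      proof eventually_elim
        case (elim \<omega>)
        show ?case
        proof
          assume E: "\<omega> \<in> EY"
          have "\<forall>\<^sub>F m' in sequentially. \<bar>Xlin z {..<m'} (real (Suc k) / real N) \<omega> -
             Xlin z {..<m'} (real k / real N) \<omega>\<bar> < c" if "k < N" for k
          proof (rule order_tendstoD(2))
            show "(\<lambda>m'. \<bar>Xlin z {..<m'} (real (Suc k) / real N) \<omega> - Xlin z {..<m'} (real k / real N) \<omega>\<bar>)
               \<longlonglongrightarrow> \<bar>Y (real (Suc k) / real N) \<omega> - Y (real k / real N) \<omega>\<bar>"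
              using that by (intro tendsto_rabs tendsto_diff elim[rule_format]) auto
            show "\<bar>Y (real (Suc k) / real N) \<omega> - Y (real k / real N) \<omega>\<bar> < c"
              using E that by (simp add: EY_def)
          qed
          then have "\<forall>\<^sub>F m' in sequentially. \<forall>k\<in>{..<N}. \<bar>Xlin z {..<m'} (real (Suc k) / real N) \<omega> -
             Xlin z {..<m'} (real k / real N) \<omega>\<bar> < c"
            by (intro eventually_ball_finite) auto
          then show "\<forall>\<^sub>F m' in sequentially. \<omega> \<in> ?F m'"
            by (rule eventually_mono) (use E in \<open>auto simp: EY_def\<close>)
        qed
      qed
    qed
    moreover have "1 - 1/8 \<le> prob EY" 
    proof -
      let ?G = "{\<omega> \<in> space M. \<exists>t\<in>dyadic_points. \<rho> < \<bar>Y t \<omega>\<bar>}"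
      have "1 - 1/8 \<le> prob (space M - ?G)" using \<rho>(2) prob_compl[OF \<rho>e] by simp
      also have "\<dots> \<le> prob EY"
      proof (rule finite_measure_mono)
        show "space M - ?G \<subseteq> EY"
        proof
          fix \<omega> assume \<omega>: "\<omega> \<in> space M - ?G"
          have "\<bar>Y (real (Suc k) / real N) \<omega> - Y (real k / real N) \<omega>\<bar> < c" if "k < N" for k
          proof -
            have "\<bar>Y (real (Suc k) / real N) \<omega>\<bar> \<le> \<rho>" "\<bar>Y (real k / real N) \<omega>\<bar> \<le> \<rho>"
              using \<omega> grid[of k] grid[of "Suc k"] that by (auto simp: not_less simp del: of_nat_Suc)
            then show ?thesis using \<rho>(1) by (simp add: c_def)
          qed
          then show "\<omega> \<in> EY" using \<omega> by (simp add: EY_def)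
        qed
        show "EY \<in> events" by (rule EY)
      qed
      finally show ?thesis .
    qed
    ultimately have "1 - 1/8 \<le> ?b" by (rule order_trans[rotated])
    then have "3/4 \<le> exp (- (\<kappa> * ?A / (2 * c powr \<alpha>)))" by (simp add: field_simps)
    moreover have "exp (-1 :: real) \<le> 1/2"
    proof -
      have "2 \<le> exp (1::real)" using exp_ge_add_one_self[of "1::real"] by simp
      then show ?thesis by (simp add: exp_minus field_simps)
    qed
    ultimately have "exp (-1) \<le> exp (- (\<kappa> * ?A / (2 * c powr \<alpha>)))" by linarith
    then have "\<kappa> * ?A / (2 * c powr \<alpha>) \<le> 1" by simp
    then show ?thesis using \<kappa>(1) c by (simp add: field_simps)
  qed
  show ?thesis
  proof (rule bounded_imp_summable)
    show "(\<Sum>k\<le>n. \<bar>z k * \<sigma> k\<bar> powr \<alpha>) \<le> 2 * c powr \<alpha> / \<kappa>" for n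
      using bound[of "Suc n"] by (simp add: lessThan_Suc_atMost)
  qed simp
qed

end

section \<open>Duality between weighted sequence spaces\<close>

text \<open>Young's inequality for the exponents \<open>2 / \<alpha>\<close> and \<open>2 / (2 - \<alpha>)\<close>, without optimal constants: if one of
\<open>z\<^sup>2\<close> and \<open>s powr q\<close> is the smaller one, then expressing its base through the larger one bounds the
product by the larger one.\<close>

lemma powr_product_le:
  fixes z s \<alpha> :: real
  assumes \<alpha>: "0 < \<alpha>" "\<alpha> < 2" and s: "0 \<le> s"
  shows "\<bar>z * s\<bar> powr \<alpha> \<le> z\<^sup>2 + s powr (2 * \<alpha> / (2 - \<alpha>))"
proof (cases "z = 0 \<or> s = 0")
  case False
  define q where "q = 2 * \<alpha> / (2 - \<alpha>)"
  have q: "0 < q" using \<alpha> by (simp add: q_def)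
  have z2: "z\<^sup>2 = \<bar>z\<bar> powr 2" using False by (subst powr_numeral) auto
  show ?thesis
  proof (cases "s powr q \<le> z\<^sup>2")
    case True
    have "s = (s powr q) powr (1 / q)" using q s False by (simp add: powr_powr)
    also have "\<dots> \<le> (\<bar>z\<bar> powr 2) powr (1 / q)" using True q unfolding z2 by (intro powr_mono2) auto
    finally have "s \<le> \<bar>z\<bar> powr (2 / q)" unfolding powr_powr by simp
    then have "\<bar>z * s\<bar> powr \<alpha> \<le> (\<bar>z\<bar> * \<bar>z\<bar> powr (2 / q)) powr \<alpha>"
      using \<alpha> s by (intro powr_mono2) (auto simp: abs_mult intro!: mult_left_mono)
    also have "\<bar>z\<bar> * \<bar>z\<bar> powr (2 / q) = \<bar>z\<bar> powr (1 + 2 / q)" using False by (simp add: powr_add)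
    also have "(\<bar>z\<bar> powr (1 + 2 / q)) powr \<alpha> = \<bar>z\<bar> powr ((1 + 2 / q) * \<alpha>)" by (rule powr_powr)
    also have "(1 + 2 / q) * \<alpha> = 2" using \<alpha> by (simp add: q_def field_simps)
    finally show ?thesis unfolding z2 q_def[symmetric] by (simp add: add_increasing2)
  next
    case nle: False
    have "\<bar>z\<bar> = (\<bar>z\<bar> powr 2) powr (1 / 2)" using False by (simp add: powr_powr)
    also have "\<dots> \<le> (s powr q) powr (1 / 2)" using nle unfolding z2 by (intro powr_mono2) auto
    finally have "\<bar>z\<bar> \<le> s powr (q / 2)" unfolding powr_powr by simp
    then have "\<bar>z * s\<bar> powr \<alpha> \<le> (s powr (q / 2) * s) powr \<alpha>"
      using \<alpha> s by (intro powr_mono2) (auto simp: abs_mult intro!: mult_right_mono)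
    also have "s powr (q / 2) * s = s powr (q / 2 + 1)" using False s by (simp add: powr_add)
    also have "(s powr (q / 2 + 1)) powr \<alpha> = s powr ((q / 2 + 1) * \<alpha>)" by (rule powr_powr)
    also have "(q / 2 + 1) * \<alpha> = q" using \<alpha> by (simp add: q_def field_simps)
    finally show ?thesis unfolding q_def[symmetric] by (simp add: add_increasing)
  qed
qed auto

text \<open>The area under \<open>t powr - (1 + \<delta>)\<close> between \<open>x\<close> and \<open>y\<close> dominates the rectangle of height
\<open>y powr - (1 + \<delta>)\<close>; the proof reduces this to \<open>ln u \<le> u - 1\<close> with \<open>u = x / y\<close>.\<close>

lemma powr_diff_lower_bound:
  fixes x y \<delta> :: real
  assumes "0 < x" "x \<le> y" "0 < \<delta>"
  shows "\<delta> * ((y - x) / y powr (1 + \<delta>)) \<le> x powr - \<delta> - y powr - \<delta>"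
proof -
  have y: "0 < y" using assms by simp
  have "ln (x / y) \<le> x / y - 1" using assms y by (intro ln_le_minus_one) simp
  then have "1 + \<delta> * (1 - x / y) \<le> 1 + - \<delta> * ln (x / y)"
    using assms mult_left_mono[of "ln (x / y)" "x / y - 1" \<delta>] by (simp add: algebra_simps)
  also have "\<dots> \<le> exp (- \<delta> * ln (x / y))" by (rule exp_ge_add_one_self)
  also have "\<dots> = (x / y) powr - \<delta>" using assms y by (simp add: powr_def)
  also have "\<dots> = x powr - \<delta> / y powr - \<delta>" using assms y by (simp add: powr_divide)
  finally have "(1 + \<delta> * (1 - x / y)) * y powr - \<delta> \<le> x powr - \<delta>"
    using y by (simp add: pos_le_divide_eq)
  moreover have "(1 + \<delta> * (1 - x / y)) * y powr - \<delta> = y powr - \<delta> + \<delta> * ((1 - x / y) * y powr - \<delta>)"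
    by (simp add: distrib_right)
  moreover have "(y - x) / y powr (1 + \<delta>) = (1 - x / y) * y powr - \<delta>"
    using y by (simp add: powr_add powr_minus field_simps)
  ultimately show ?thesis by simp
qed

text \<open>The theorem of Abel and Dini: dividing a divergent series by its own partial sums still leaves a
divergent series, while any power of the partial sums larger than 1 makes it convergent, by
telescoping.\<close>

lemma Abel_Dini:
  fixes a :: "nat \<Rightarrow> real"
  assumes a: "\<And>n. 0 \<le> a n" and div: "\<not> summable a" and \<delta>: "0 < \<delta>"
  defines "S \<equiv> \<lambda>n. \<Sum>k\<le>n. a k"
  shows "\<not> summable (\<lambda>n. a n / S n)" and "summable (\<lambda>n. a n / S n powr (1 + \<delta>))"
proof -
  have S_mono: "S m \<le> S n" if "m \<le> n" for m n
    unfolding S_def using that a by (intro sum_mono2) auto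
  have S0: "0 \<le> S n" for n unfolding S_def using a by (intro sum_nonneg) auto
  have unb: "\<exists>n. C < S n" for C
  proof (rule ccontr)
    assume "\<nexists>n. C < S n"
    then have "summable a" by (intro bounded_imp_summable[of a C] a) (auto simp: S_def not_less)
    then show False using div by simp
  qed
  have S_diff: "S n - S m = (\<Sum>k=Suc m..<Suc n. a k)" if "m \<le> n" for m n
  proof -
    have eq: "{..n} = {..m} \<union> {Suc m..<Suc n}" using that by auto
    have "S n = S m + (\<Sum>k=Suc m..<Suc n. a k)" unfolding S_def eq by (rule sum.union_disjoint) auto
    then show ?thesis by simp
  qed
  show "\<not> summable (\<lambda>n. a n / S n)"
  proof
    assume "summable (\<lambda>n. a n / S n)"
    then obtain N where N: "\<And>m n. N \<le> m \<Longrightarrow> norm (\<Sum>k=m..<n. a k / S k) < 1/2"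
      unfolding summable_Cauchy by (metis half_gt_zero zero_less_one)
    obtain n where n: "2 * S N + 1 < S n" using unb by blast
    then have "N < n" using S_mono[of n N] S0[of N] by (cases "N < n") auto
    have Sn: "0 < S n" using n S0[of N] by linarith
    have "1/2 \<le> (S n - S N) / S n" using n Sn S0[of N] by (simp add: field_simps)
    also have "\<dots> = (\<Sum>k=Suc N..<Suc n. a k / S n)"
      using \<open>N < n\<close> by (simp only: S_diff less_imp_le sum_divide_distrib)
    also have "\<dots> \<le> (\<Sum>k=Suc N..<Suc n. a k / S k)"
    proof (rule sum_mono)
      fix k assume k: "k \<in> {Suc N..<Suc n}"
      show "a k / S n \<le> a k / S k"
      proof (cases "a k = 0")
        case False
        then have "0 < a k" using a[of k] by simp
        also have "a k \<le> S k" unfolding S_def using a by (intro member_le_sum) auto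
        finally show ?thesis using S_mono[of k n] k a[of k] Sn by (intro divide_left_mono) auto
      qed simp
    qed
    also have "\<dots> < 1/2" using N[of "Suc N" "Suc n"] by simp
    finally show False by simp
  qed
  obtain n0 where n0: "0 < S n0" using unb by blast
  have Sp: "0 < S (k + n0)" for k using S_mono[of n0 "k + n0"] n0 by simp
  have "(\<Sum>k\<le>n. a (k + Suc n0) / S (k + Suc n0) powr (1 + \<delta>)) \<le> S n0 powr - \<delta> / \<delta>" for n
  proof -
    have "(\<Sum>k\<le>n. a (k + Suc n0) / S (k + Suc n0) powr (1 + \<delta>)) \<le>
       (\<Sum>k<Suc n. (S (k + n0) powr - \<delta> - S (Suc k + n0) powr - \<delta>) / \<delta>)"
      unfolding lessThan_Suc_atMost
    proof (rule sum_mono)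
      fix k
      have "a (k + Suc n0) = S (Suc k + n0) - S (k + n0)" by (simp add: S_def)
      then show "a (k + Suc n0) / S (k + Suc n0) powr (1 + \<delta>) \<le>
          (S (k + n0) powr - \<delta> - S (Suc k + n0) powr - \<delta>) / \<delta>"
        using powr_diff_lower_bound[OF Sp[of k] S_mono[of "k + n0" "Suc k + n0"] \<delta>] \<delta>
        by (simp add: pos_le_divide_eq mult.commute)
    qed
    also have "\<dots> = (S n0 powr - \<delta> - S (Suc n + n0) powr - \<delta>) / \<delta>"
      unfolding sum_divide_distrib[symmetric]
      by (subst sum_lessThan_telescope'[of "\<lambda>k. S (k + n0) powr - \<delta>" "Suc n"]) simp
    also have "\<dots> \<le> S n0 powr - \<delta> / \<delta>" using \<delta> by (intro divide_right_mono) auto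
    finally show ?thesis .
  qed
  then have "summable (\<lambda>k. a (k + Suc n0) / S (k + Suc n0) powr (1 + \<delta>))"
    using a by (intro bounded_imp_summable) auto
  then show "summable (\<lambda>n. a n / S n powr (1 + \<delta>))" 
    using summable_iff_shift[of "\<lambda>n. a n / S n powr (1 + \<delta>)" "Suc n0"] by simp
qed

text \<open>With \<open>a n = s n powr q\<close>, where \<open>q = 2 * \<alpha> / (2 - \<alpha>)\<close>, and \<open>S\<close> the partial sums of \<open>a\<close>, the choice
\<open>(x n)\<^sup>2 = a n / S n powr (2 / \<alpha>)\<close> is summable because \<open>2 / \<alpha> > 1\<close>, and the exponents are matched so that
\<open>\<bar>x n * s n\<bar> powr \<alpha> = a n / S n\<close>.\<close>

lemma exists_square_summable_multiplier:
  fixes s :: "nat \<Rightarrow> real"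
  assumes \<alpha>: "0 < \<alpha>" "\<alpha> < 2" and s: "\<And>n. 0 \<le> s n"
    and div: "\<not> summable (\<lambda>n. s n powr (2 * \<alpha> / (2 - \<alpha>)))"
  obtains x where "summable (\<lambda>n. (x n)\<^sup>2)" "\<not> summable (\<lambda>n. \<bar>x n * s n\<bar> powr \<alpha>)"
proof -
  define q where "q = 2 * \<alpha> / (2 - \<alpha>)"
  define a where "a n = s n powr q" for n
  define S where "S n = (\<Sum>k\<le>n. a k)" for n
  define x where "x n = sqrt (a n / S n powr (1 + (2 / \<alpha> - 1)))" for n
  have q: "0 < q" using \<alpha> by (simp add: q_def)
  have a: "0 \<le> a n" for n by (simp add: a_def)
  have S0: "0 \<le> S n" for n unfolding S_def using a by (intro sum_nonneg) auto
  have ndiv: "\<not> summable a" using div unfolding a_def[abs_def] q_def .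
  have \<delta>: "0 < 2 / \<alpha> - 1" using \<alpha> by simp
  note AD = Abel_Dini[OF a ndiv \<delta>, folded S_def]
  have "(x n)\<^sup>2 = a n / S n powr (1 + (2 / \<alpha> - 1))" for n
    unfolding x_def using a[of n] by simp
  then have 1: "summable (\<lambda>n. (x n)\<^sup>2)" using AD(2) by simp
  have "\<bar>x n * s n\<bar> powr \<alpha> = a n / S n" for n
  proof (cases "s n = 0")
    case False
    then have sp: "0 < s n" using s[of n] by simp
    then have ap: "0 < a n" by (simp add: a_def)
    also have "a n \<le> S n" unfolding S_def using a by (intro member_le_sum) auto
    finally have Sp: "0 < S n" .
    have "s n = a n powr (1 / q)" using sp q by (simp add: a_def powr_powr)
    then have "s n powr \<alpha> = a n powr (\<alpha> / q)" by (simp add: powr_powr)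
    also have "\<alpha> / q = 1 - \<alpha> / 2" using \<alpha> by (simp add: q_def field_simps)
    finally have s\<alpha>: "s n powr \<alpha> = a n powr (1 - \<alpha> / 2)" .
    have "x n = (a n / S n powr (2 / \<alpha>)) powr (1 / 2)"
      unfolding x_def using ap Sp by (simp add: powr_half_sqrt)
    then have "x n powr \<alpha> = (a n / S n powr (2 / \<alpha>)) powr (\<alpha> / 2)" by (simp add: powr_powr)
    also have "\<dots> = a n powr (\<alpha> / 2) / S n" using ap Sp \<alpha> by (simp add: powr_divide powr_powr)
    finally have x\<alpha>: "x n powr \<alpha> = a n powr (\<alpha> / 2) / S n" .
    have xp: "0 \<le> x n" unfolding x_def using a[of n] by simp
    have "\<bar>x n * s n\<bar> powr \<alpha> = x n powr \<alpha> * s n powr \<alpha>"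
      using xp sp by (simp add: powr_mult)
    also have "\<dots> = a n powr (\<alpha> / 2 + (1 - \<alpha> / 2)) / S n"
      unfolding x\<alpha> s\<alpha> by (simp only: powr_add times_divide_eq_left)
    also have "\<dots> = a n / S n" using ap by simp
    finally show ?thesis .
  qed (simp add: a_def)
  then have "\<not> summable (\<lambda>n. \<bar>x n * s n\<bar> powr \<alpha>)" using AD(1) by simp
  with 1 show thesis by (rule that)
qed

section \<open>Orthonormal series\<close>

lemma orthonormal_inner_sum:
  fixes e :: "nat \<Rightarrow> 'h::real_inner"
  assumes e: "\<And>m n. inner (e m) (e n) = (if m = n then 1 else 0)" and A: "finite A"
  shows "inner (\<Sum>n\<in>A. x n *\<^sub>R e n) (\<Sum>n\<in>A. x n *\<^sub>R e n) = (\<Sum>n\<in>A. (x n)\<^sup>2)"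
  using A by (simp add: inner_sum_left inner_sum_right e sum.delta power2_eq_square if_distrib cong: if_cong)

lemma orthonormal_Bessel:
  fixes e :: "nat \<Rightarrow> 'h::real_inner"
  assumes e: "\<And>m n. inner (e m) (e n) = (if m = n then 1 else 0)"
  shows "summable (\<lambda>n. (inner z (e n))\<^sup>2)"
proof (rule bounded_imp_summable)
  fix N
  let ?v = "\<Sum>n\<le>N. inner z (e n) *\<^sub>R e n"
  have "inner z ?v = (\<Sum>n\<le>N. (inner z (e n))\<^sup>2)"
    by (simp add: inner_sum_right power2_eq_square)
  moreover have "inner ?v ?v = (\<Sum>n\<le>N. (inner z (e n))\<^sup>2)" by (rule orthonormal_inner_sum[OF e]) simp
  moreover have "0 \<le> inner (z - ?v) (z - ?v)" by simp
  ultimately show "(\<Sum>n\<le>N. (inner z (e n))\<^sup>2) \<le> inner z z"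
    by (simp add: inner_diff_left inner_diff_right inner_commute)
qed simp

lemma orthonormal_series_summable:
  fixes e :: "nat \<Rightarrow> 'h::{real_inner, complete_space}"
  assumes e: "\<And>m n. inner (e m) (e n) = (if m = n then 1 else 0)"
    and x: "summable (\<lambda>n. (x n)\<^sup>2)"
  shows "summable (\<lambda>n. x n *\<^sub>R e n)"
proof -
  let ?P = "\<lambda>N. \<Sum>n<N. x n *\<^sub>R e n"
  have "Cauchy ?P"
  proof (rule CauchyI')
    fix d :: real assume d: "0 < d"
    then obtain N where N: "\<And>m n. N \<le> m \<Longrightarrow> norm (\<Sum>k=m..<n. (x k)\<^sup>2) < d\<^sup>2"
      using x unfolding summable_Cauchy by (meson zero_less_power)
    have "norm (?P m - ?P n) < d" if "N \<le> m" "m < n" for m n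
    proof -
      have "?P n - ?P m = (\<Sum>k=m..<n. x k *\<^sub>R e k)"
        using that by (simp add: sum_diff_nat_ivl lessThan_atLeast0)
      then have "(norm (?P n - ?P m))\<^sup>2 = (\<Sum>k=m..<n. (x k)\<^sup>2)"
        by (simp only: power2_norm_eq_inner) (rule orthonormal_inner_sum[OF e], simp)
      also have "\<dots> < d\<^sup>2" using N[OF that(1), of n] by simp
      finally have "norm (?P n - ?P m) < d" using d by (simp add: power_less_imp_less_base)
      then show ?thesis by (simp only: norm_minus_commute)
    qed
    then show "\<exists>M. \<forall>m\<ge>M. \<forall>n>m. dist (?P m) (?P n) < d" unfolding dist_norm by blast
  qed
  then have "convergent ?P" by (rule Cauchy_convergent)
  then show ?thesis by (simp add: summable_iff_convergent)
qed

lemma orthonormal_series_inner: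
  fixes e :: "nat \<Rightarrow> 'h::{real_inner, complete_space}"
  assumes e: "\<And>m n. inner (e m) (e n) = (if m = n then 1 else 0)"
    and x: "summable (\<lambda>n. (x n)\<^sup>2)"
  shows "(\<lambda>n. inner z (e n) * x n) sums inner z (\<Sum>n. x n *\<^sub>R e n)"
  using bounded_linear.sums[OF bounded_linear_inner_right summable_sums[OF orthonormal_series_summable[OF e x]], of z]
  by (simp add: mult.commute)

section \<open>The criterion\<close>

lemma (in stable_ou) Xlin_tendsto_inner:
  fixes e :: "nat \<Rightarrow> 'h::{real_inner, complete_space}"
  assumes e: "\<And>m n. inner (e m) (e n) = (if m = n then 1 else 0)" and t: "t \<in> {0..1}"
  shows "AE \<omega> in M. (\<lambda>m. Xlin (\<lambda>n. inner z (e n)) {..<m} t \<omega>) \<longlonglongrightarrow> inner z (\<Sum>n. X n t \<omega> *\<^sub>R e n)"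
proof -
  have "AE \<omega> in M. \<forall>n. X n t \<omega> = Xc n t \<omega>"
    unfolding AE_all_countable using AE_X_eq_Xc[OF t] by blast
  with AE_summable_squares[OF t] show ?thesis
  proof eventually_elim
    case (elim \<omega>)
    from orthonormal_series_inner[OF e elim(1), of z]
    show ?case unfolding sums_def Xlin_def using elim(2) by simp
  qed
qed

theorem corollary4p4:
  fixes M :: "'a measure"
    and e :: "nat \<Rightarrow> 'h::{real_inner, complete_space}"
    and \<alpha> :: real
    and \<gamma> \<sigma> :: "nat \<Rightarrow> real"
    and L X :: "nat \<Rightarrow> real \<Rightarrow> 'a \<Rightarrow> real"
  assumes "prob_space M"
    and "orthonormal_basis e"
    and "0 < \<alpha>" and "\<alpha> < 2"
    and "\<And>n. 0 < \<gamma> n"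
    and "\<And>n. 0 \<le> \<sigma> n"
    and "\<And>n. std_sym_stable_levy \<alpha> M (L n)"
    and "indep_processes M L"
    and "\<And>n t. t \<in> {0..1} \<Longrightarrow>
           is_stoch_integral M (L n) (\<lambda>s. exp (- \<gamma> n * (t - s)) * \<sigma> n) t (X n t)"
    and "summable (\<lambda>n. \<sigma> n powr \<alpha> / (1 + \<gamma> n))"
  shows "cylindrical_cadlag M (\<lambda>t \<omega>. \<Sum>n. X n t \<omega> *\<^sub>R e n) \<longleftrightarrow>
         summable (\<lambda>n. \<sigma> n powr (2 * \<alpha> / (2 - \<alpha>)))"
proof -
  interpret prob_space M by fact
  interpret stable_ou M \<alpha> \<gamma> \<sigma> L X
    by unfold_locales (use assms in auto)
  have e: "inner (e m) (e n) = (if m = n then 1 else 0)" for m n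
    using assms(2) by (simp add: orthonormal_basis_def)
  let ?U = "\<lambda>t \<omega>. \<Sum>n. X n t \<omega> *\<^sub>R e n"
  show ?thesis
  proof
    assume sum: "summable (\<lambda>n. \<sigma> n powr (2 * \<alpha> / (2 - \<alpha>)))"
    show "cylindrical_cadlag M ?U"
      unfolding cylindrical_cadlag_def
    proof
      fix z :: 'h
      let ?c = "\<lambda>n. inner z (e n)"
      have "summable (\<lambda>n. \<bar>?c n * \<sigma> n\<bar> powr \<alpha>)"
      proof (rule summable_comparison_test')
        show "summable (\<lambda>n. (?c n)\<^sup>2 + \<sigma> n powr (2 * \<alpha> / (2 - \<alpha>)))"
          by (intro summable_add orthonormal_Bessel[OF e] sum)
        show "norm (\<bar>?c n * \<sigma> n\<bar> powr \<alpha>) \<le> (?c n)\<^sup>2 + \<sigma> n powr (2 * \<alpha> / (2 - \<alpha>))" for n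
          using powr_product_le[OF \<alpha> \<sigma>] by simp
      qed
      then obtain Y ms where Y: "cadlag_process M {0..1} Y" "strict_mono (ms :: nat \<Rightarrow> nat)"
        "AE \<omega> in M. \<forall>t\<in>{0..1}. (\<lambda>j. Xlin ?c {..<ms j} t \<omega>) \<longlonglongrightarrow> Y t \<omega>"
        by (rule cadlag_series)
      have "modification_on M {0..1} Y (\<lambda>t \<omega>. inner z (?U t \<omega>))"
        unfolding modification_on_def
      proof
        fix t :: real assume t: "t \<in> {0..1}"
        from Y(3) Xlin_tendsto_inner[OF e t, of z] show "AE \<omega> in M. Y t \<omega> = inner z (?U t \<omega>)"
        proof eventually_elim
          case (elim \<omega>)
          have "(\<lambda>j. Xlin ?c {..<ms j} t \<omega>) \<longlonglongrightarrow> inner z (?U t \<omega>)"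
            using LIMSEQ_subseq_LIMSEQ[OF elim(2) Y(2)] by (simp add: comp_def)
          with elim(1) t show ?case by (blast intro: LIMSEQ_unique)
        qed
      qed
      with Y(1) show "\<exists>Y. cadlag_process M {0..1} Y \<and>
          modification_on M {0..1} Y (\<lambda>t \<omega>. inner z (?U t \<omega>))" by blast
    qed
  next
    assume cyl: "cylindrical_cadlag M ?U"
    show "summable (\<lambda>n. \<sigma> n powr (2 * \<alpha> / (2 - \<alpha>)))"
    proof (rule ccontr)
      assume "\<not> summable (\<lambda>n. \<sigma> n powr (2 * \<alpha> / (2 - \<alpha>)))"
      then obtain x where x: "summable (\<lambda>n. (x n)\<^sup>2)" "\<not> summable (\<lambda>n. \<bar>x n * \<sigma> n\<bar> powr \<alpha>)"
        by (rule exists_square_summable_multiplier[OF \<alpha> \<sigma>])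
      define z where "z = (\<Sum>n. x n *\<^sub>R e n)"
      have z: "inner z (e n) = x n" for n
      proof -
        have "(\<lambda>k. inner (e n) (e k) * x k) sums inner (e n) z"
          unfolding z_def by (rule orthonormal_series_inner[OF e x(1)])
        moreover have "(\<lambda>k. inner (e n) (e k) * x k) sums x n"
          using sums_single[of n x] by (rule back_subst[of "\<lambda>f. f sums x n"]) (auto simp: e)
        ultimately show ?thesis by (metis sums_unique2 inner_commute)
      qed
      obtain Y where Y: "cadlag_process M {0..1} Y"
        "modification_on M {0..1} Y (\<lambda>t \<omega>. inner z (?U t \<omega>))"
        using cyl unfolding cylindrical_cadlag_def by blast
      have "AE \<omega> in M. (\<lambda>m. Xlin x {..<m} t \<omega>) \<longlonglongrightarrow> Y t \<omega>" if t: "t \<in> {0..1}" for t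
      proof -
        have "AE \<omega> in M. Y t \<omega> = inner z (?U t \<omega>)"
          using Y(2) t by (simp add: modification_on_def)
        with Xlin_tendsto_inner[OF e t, of z] show ?thesis
          by eventually_elim (simp add: z)
      qed
      from summable_of_cadlag[OF Y(1) this] x(2) show False by blast
    qed
  qed
qed

end
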